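(* Let $X$ be a one-dimensional Brownian motion on $[0,1]$, let $0<\alpha<1$, and let $E_\alpha=E_\alpha(\omega)$ be its random set of $\alpha$-rapid points. Then for each $\gamma<1-\alpha^2$, with probability $1$ there exists a nonzero finite positive Borel measure $\mu$ supported on a compact subset of $E_\alpha$ such that $\hat\mu(u)=o(|u|^{-\gamma/2})$ as $|u|\to\infty$. That is, almost surely $E_\alpha$ is a set of Fourier dimension $1-\alpha^2$.
   Context: A Brownian motion on $[0,1]$ over a probability space $(\Omega,\mathcal B,\mathbf P)$ is a process $X:\Omega\times[0,1]\to\mathbb R$ with almost surely continuous paths, $X(0)=0$ almost surely, and independent increments such that $X(t)-X(s)$ is normal with mean $0$ and variance $t-s$ for $0\le s<t\le1$. The set of $\alpha$-rapid points is $$E_\alpha(\omega)=\left\{t\in[0,1]:\ \limsup_{h\to0}\frac{|X(t+h)-X(t)|}{\sqrt{2|h|\log(1/|h|)}}\ge\alpha\right\},$$ where $h$ ranges over nonzero reals (of either sign) with $t+h\in[0,1]$. The Fourier–Stieltjes transform of a finite Borel measure $\mu$ on $\mathbb R$ is $\hat\mu(u)=\int e^{ixu}\,d\mu(x)$. A compact set $K\subset\mathbb R$ is an $M_\beta$-set ($\beta>0$) if it carries a nonzero finite positive Borel measure $\mu$ with $\hat\mu(u)=o(|u|^{-\beta})$ as $|u|\to\infty$. The Fourier dimension $\dim_F K$ of a compact set $K$ is the supremum of those $a>0$ such that $K$ is an $M_{a/2}$-set (and $0$ if there are none). The Fourier dimension of a non-compact set $E$ is understood as the supremum of $\dim_F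 K$ over compact $K\subseteq E$. *)

theory Defs
  imports "HOL-Probability.Probability"
begin

text \<open>
  The process is indexed by all reals, but only its values at times in \<open>{0..1}\<close> are
  constrained or used below.
\<close>

locale brownian_motion_01 = prob_space M
  for M :: "'a measure" and X :: "real \<Rightarrow> 'a \<Rightarrow> real" +
  assumes measurable_at: "t \<in> {0..1} \<Longrightarrow> random_variable borel (X t)"
    and continuous_paths: "AE \<omega> in M. continuous_on {0..1} (\<lambda>t. X t \<omega>)"
    and start_0: "AE \<omega> in M. X 0 \<omega> = 0"
    and indep_increments:
      "strict_mono_on {..n} \<tau> \<Longrightarrow> \<tau> ` {..n} \<subseteq> {0..1} \<Longrightarrow>
        indep_vars (\<lambda>_. borel) (\<lambda>i \<omega>. X (\<tau> (Suc i)) \<omega> - X (\<tau> i) \<omega>) {..<n::nat}"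
    and normal_increments:
      "0 \<le> s \<Longrightarrow> s < t \<Longrightarrow> t \<le> 1 \<Longrightarrow>
        distributed M lborel (\<lambda>\<omega>. X t \<omega> - X s \<omega>)
          (\<lambda>x. ennreal (normal_density 0 (sqrt (t - s)) x))"

definition rapid_points :: "real \<Rightarrow> (real \<Rightarrow> real) \<Rightarrow> real set" where
  "rapid_points \<alpha> f = {t \<in> {0..1}.
     Limsup (at 0 within {h. t + h \<in> {0..1}})
       (\<lambda>h. ereal (\<bar>f (t + h) - f t\<bar> / sqrt (2 * \<bar>h\<bar> * ln (1 / \<bar>h\<bar>)))) \<ge> ereal \<alpha>}"

definition carries :: "real set \<Rightarrow> real measure \<Rightarrow> bool" where
  "carries K \<mu> \<longleftrightarrow> sets \<mu> = sets borel \<and> finite_measure \<mu> \<and>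
     emeasure \<mu> UNIV \<noteq> 0 \<and> emeasure \<mu> (- K) = 0"

text \<open>
  The library's \<^const>\<open>char\<close> is the Fourier--Stieltjes transform; its definition does not
  require a probability measure.
\<close>

definition fourier_decay :: "real measure \<Rightarrow> real \<Rightarrow> bool" where
  "fourier_decay \<mu> \<beta> \<longleftrightarrow> (\<lambda>u. norm (char \<mu> u)) \<in> o[at_infinity](\<lambda>u. \<bar>u\<bar> powr (- \<beta>))"

definition M_set :: "real \<Rightarrow> real set \<Rightarrow> bool" where
  "M_set \<beta> K \<longleftrightarrow> compact K \<and> \<beta> > 0 \<and> (\<exists>\<mu>. carries K \<mu> \<and> fourier_decay \<mu> \<beta>)"

text \<open>
  The supremum is taken in the extended reals because it is infinite for sets with
  nonempty interior.
\<close>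

definition fourier_dim_compact :: "real set \<Rightarrow> ereal" where
  "fourier_dim_compact K = Sup (insert 0 {ereal a | a. a > 0 \<and> M_set (a / 2) K})"

definition fourier_dim :: "real set \<Rightarrow> ereal" where
  "fourier_dim E = (SUP K \<in> {K. compact K \<and> K \<subseteq> E}. fourier_dim_compact K)"

end

(*
  Lower bound. Fix a between alpha and 1. At scale 2^-n, give each grid point k/2^(n+q) the weight
  1/p if the increment of X over the window of length 2^-n starting there exceeds
  a * sqrt (2 * 2^-n * ln (2^n)), an event of probability p, roughly 2^(-a^2 n), and 0 otherwise.
  The weights minus 1 are centred, with variance at most 1/p, and independent within each residue
  class of k modulo 2^q; Chernoff's bound on a net of frequencies shows that almost surely the
  density interpolating the weights differs from 1 by a function whose Fourier transform is
  o(1) * |u|^-beta uniformly in u, for every beta < (1 - a^2) / 2. The remaining construction is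
  deterministic: multiplication by tent functions preserves such decay, so a product of these
  densities over a sparse enough sequence of scales converges weakly to a nonzero measure with the
  same decay, carried by points with rapid increments at infinitely many scales.

  Upper bound. The rapid points are covered infinitely often by at most 2^(s n) grid cells of
  length 2^-(n+q), for any s > 1 - alpha^2. If the transform of mu is O(|u|^(-c/2)) with c > s, testing
  against a Gaussian of width r bounds the sum of mu(I)^2 over disjoint intervals I of length r by
  a multiple of r^c; by Cauchy-Schwarz and Borel-Cantelli, mu does not charge the rapid points.
*)

theory Submission
  imports Defs "HOL-Real_Asymp.Real_Asymp"
begin

subsection \<open>Gaussian tails\<close>

text \<open>The exponent (1 - a^2) / 2 is a square-root count. The 2^n - 1 centred weights of a
  residue class have variance at most 1/p, so their exponential sums have size about sqrt (2^n / p);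
  the width of the tents contributes another 2^-n, leaving 2^(-n (1 - a^2) / 2). Converting this
  into decay |u|^-\<beta> costs 2^(n \<beta>), because the tents start to decay only near frequency
  2^n.

  Windows that start close together overlap and are dependent, yet a point of the support must lie
  close to the start of a window to inherit its large increment. The fixed refinement q reconciles
  the two: moving by 2^-(n+q) changes X by about 2^(-q/2) times the threshold, which the gap between
  \<alpha> and a absorbs, while 2^q classes cost only a constant factor.

  Multiplication by a density already built keeps the decay only up to a constant depending on that
  density, so each scale is chosen after the previous product is known.

  In the upper bound one null set must serve uncountably many measures: the path enters only through
  its modulus of continuity and the number of cells.\<close>

definition gauss_tail :: "real \<Rightarrow> real" where
  "gauss_tail x = measure (density lborel std_normal_density) {y. \<bar>y\<bar> \<ge> x}"

lemma gauss_tail_le_1: "gauss_tail x \<le> 1"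
proof -
  interpret real_distribution std_normal_distribution by (rule real_dist_normal_dist)
  show ?thesis unfolding gauss_tail_def by (rule prob_le_1)
qed

text \<open>For y \<ge> x \<ge> 0 one has y^2 \<ge> x^2 + (y - x)^2, so beyond x the density is at
  most \<open>exp (- x\<^sup>2 / 2)\<close> times its own translate by x, which has mass 1. The left
  ray is the mirror image, treated at once through the sign \<open>c\<close>.\<close>

lemma gauss_tail_upper:
  assumes "0 \<le> x"
  shows "gauss_tail x \<le> 2 * exp (- x\<^sup>2 / 2)"
proof -
  interpret real_distribution std_normal_distribution by (rule real_dist_normal_dist)
  have half: "measure std_normal_distribution A \<le> exp (- x\<^sup>2 / 2)"
    if A: "A \<in> sets borel" and c: "c = 1 \<or> c = -1" and sub: "\<And>y. y \<in> A \<Longrightarrow> c * y \<ge> x" for A c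
  proof -
    have pt: "std_normal_density y * indicator A y \<le> exp (- x\<^sup>2 / 2) * std_normal_density (- x + c * y)" for y
    proof (cases "y \<in> A")
      case True
      have *: "- y\<^sup>2 / 2 \<le> - x\<^sup>2 / 2 - (- x + c * y)\<^sup>2 / 2"
      proof -
        have "x * (c * y - x) \<ge> 0" using sub[OF True] assms by simp
        moreover have "(c*y)\<^sup>2 = y\<^sup>2" using c by (auto simp: power2_eq_square)
        moreover have "(- x + c * y)\<^sup>2 = x\<^sup>2 + (c * y)\<^sup>2 - 2 * (x * (c * y - x)) - 2 * x\<^sup>2"
          by (simp add: power2_eq_square algebra_simps)
        ultimately show ?thesis by linarith
      qed
      have "exp (- y\<^sup>2 / 2) \<le> exp (- x\<^sup>2 / 2) * exp (- (- x + c * y)\<^sup>2 / 2)"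
        unfolding exp_add[symmetric] using * by simp
      then show ?thesis using True by (simp add: std_normal_density_def field_simps)
    qed simp
    have "emeasure std_normal_distribution A = (\<integral>\<^sup>+y. ennreal (std_normal_density y) * indicator A y \<partial>lborel)"
      using A by (simp add: emeasure_density)
    also have "\<dots> = (\<integral>\<^sup>+y. ennreal (std_normal_density y * indicator A y) \<partial>lborel)"
      by (intro nn_integral_cong) (auto simp: indicator_def)
    also have "\<dots> \<le> (\<integral>\<^sup>+y. ennreal (exp (- x\<^sup>2 / 2) * std_normal_density (- x + c * y)) \<partial>lborel)"
      using pt by (intro nn_integral_mono ennreal_leI) auto
    also have "\<dots> = ennreal (exp (- x\<^sup>2 / 2)) * (\<integral>\<^sup>+y. ennreal (std_normal_density (- x + c * y)) \<partial>lborel)"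
      by (subst nn_integral_cmult[symmetric]) (auto simp: ennreal_mult)
    also have "(\<integral>\<^sup>+y. ennreal (std_normal_density (- x + c * y)) \<partial>lborel) = (\<integral>\<^sup>+y. ennreal (std_normal_density y) \<partial>lborel)"
      using c by (subst nn_integral_real_affine[of _ c "-x" ]) auto
    also have "\<dots> = 1"
      using emeasure_space_1 by (simp add: emeasure_density)
    finally have "emeasure std_normal_distribution A \<le> ennreal (exp (- x\<^sup>2 / 2))" by simp
    then show ?thesis by (simp add: emeasure_eq_measure)
  qed
  have "gauss_tail x \<le> measure std_normal_distribution ({y. y \<ge> x} \<union> {y. - y \<ge> x})"
    unfolding gauss_tail_def by (intro finite_measure_mono) (auto simp: abs_if split: if_splits)
  also have "\<dots> \<le> measure std_normal_distribution {y. y \<ge> x} + measure std_normal_distribution {y. - y \<ge> x}"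
    by (intro measure_Un_le) auto
  also have "\<dots> \<le> exp (- x\<^sup>2 / 2) + exp (- x\<^sup>2 / 2)"
    by (intro add_mono half[of _ 1] half[of _ "-1"]) auto
  finally show ?thesis by simp
qed

text \<open>On the unit interval \<open>{x..x+1}\<close> the density is at least its value at the
  right end. Compared with the upper bound this loses a factor of order exp (- x), subexponential in
  n at thresholds of order sqrt n.\<close>

lemma gauss_tail_lower:
  assumes "0 \<le> x"
  shows "gauss_tail x \<ge> exp (- (x + 1)\<^sup>2 / 2) / sqrt (2 * pi)"
proof -
  interpret real_distribution std_normal_distribution by (rule real_dist_normal_dist)
  let ?c = "exp (- (x + 1)\<^sup>2 / 2) / sqrt (2 * pi)"
  have pt: "?c \<le> std_normal_density y" if "y \<in> {x..x+1}" for y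
  proof -
    have "y\<^sup>2 \<le> (x+1)\<^sup>2" using that assms by (intro power_mono) auto
    then have "exp (- (x + 1)\<^sup>2 / 2) \<le> exp (- y\<^sup>2 / 2)" by simp
    then show ?thesis by (simp add: std_normal_density_def field_simps)
  qed
  have "ennreal ?c = (\<integral>\<^sup>+y. ennreal ?c * indicator {x..x+1} y \<partial>lborel)"
    by (subst nn_integral_cmult_indicator) auto
  also have "\<dots> \<le> (\<integral>\<^sup>+y. ennreal (std_normal_density y) * indicator {x..x+1} y \<partial>lborel)"
    using pt by (intro nn_integral_mono) (auto simp: indicator_def ennreal_leI)
  also have "\<dots> = emeasure std_normal_distribution {x..x+1}"
    by (simp add: emeasure_density)
  finally have "?c \<le> measure std_normal_distribution {x..x+1}"
    by (simp add: emeasure_eq_measure)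
  also have "\<dots> \<le> gauss_tail x"
    unfolding gauss_tail_def using assms by (intro finite_measure_mono) auto
  finally show ?thesis .
qed

lemma gauss_tail_pos: "0 \<le> x \<Longrightarrow> 0 < gauss_tail x"
  by (rule less_le_trans[OF _ gauss_tail_lower]) auto

context brownian_motion_01
begin

lemma increment_measurable [measurable]:
  assumes "s \<in> {0..1}" "t \<in> {0..1}"
  shows "(\<lambda>\<omega>. X t \<omega> - X s \<omega>) \<in> borel_measurable M"
  using assms measurable_at by (intro borel_measurable_diff) auto

lemma prob_increment_ge:
  assumes "0 \<le> s" "s < t" "t \<le> 1"
  shows "prob {\<omega> \<in> space M. \<bar>X t \<omega> - X s \<omega>\<bar> \<ge> x * sqrt (t - s)} = gauss_tail x"
proof -
  let ?Y = "\<lambda>\<omega>. (X t \<omega> - X s \<omega> - 0) / sqrt (t - s)"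
  have d: "distributed M lborel ?Y std_normal_density"
    using normal_increments[OF assms] assms
    by (subst (asm) normal_standard_normal_convert) auto
  have "gauss_tail x = measure (distr M lborel ?Y) {y. \<bar>y\<bar> \<ge> x}"
    unfolding gauss_tail_def using distributed_distr_eq_density[OF d] by simp
  also have "\<dots> = prob (?Y -` {y. \<bar>y\<bar> \<ge> x} \<inter> space M)"
    using distributed_measurable[OF d] by (intro measure_distr) auto
  also have "?Y -` {y. \<bar>y\<bar> \<ge> x} \<inter> space M = {\<omega> \<in> space M. \<bar>X t \<omega> - X s \<omega>\<bar> \<ge> x * sqrt (t - s)}"
    using assms by (auto simp: abs_divide field_simps)
  finally show ?thesis ..
qed

end

subsection \<open>The modulus of continuity\<close>

lemma floor_double_cases:
  fixes x :: real
  shows "\<lfloor>2 * x\<rfloor> = 2 * \<lfloor>x\<rfloor> \<or> \<lfloor>2 * x\<rfloor> = 2 * \<lfloor>x\<rfloor> + 1"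
  by linarith

text \<open>Chaining along \<open>d j x\<close>, the point x rounded down to the grid of step 2^-j.
  From level j to j + 1 this point moves by one fine grid step or not at all. The constant is 22 =
  10 + 2 + 10: a chain at each of s and t, and one comparison of the two rounded points at level m,
  which are equal or adjacent.\<close>

lemma dyadic_chaining:
  fixes f :: "real \<Rightarrow> real"
  assumes cont: "continuous_on {0..1} f" and m0: "3 \<le> m0"
    and incr: "\<And>m k. m0 \<le> m \<Longrightarrow> k < 2 ^ m \<Longrightarrow>
      \<bar>f ((real k + 1) / 2 ^ m) - f (real k / 2 ^ m)\<bar> \<le> 2 * sqrt (m / 2 ^ m)"
    and m: "m0 \<le> m" and s: "s \<in> {0..1}" and t: "t \<in> {0..1}" and st: "\<bar>s - t\<bar> \<le> 1 / 2 ^ m"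
  shows "\<bar>f s - f t\<bar> \<le> 22 * sqrt (m / 2 ^ m)"
proof -
  define d where "d j x = of_int \<lfloor>2 ^ j * x\<rfloor> / (2 ^ j :: real)" for j :: nat and x :: real
  have incr': "\<bar>f ((of_int k + 1) / 2 ^ j) - f (of_int k / 2 ^ j)\<bar> \<le> 2 * sqrt (j / 2 ^ j)"
    if "m0 \<le> j" "0 \<le> k" "k < 2 ^ j" for j k
  proof -
    have "nat k < 2 ^ j" using that by (simp add: nat_less_iff)
    from incr[OF that(1) this] show ?thesis using that by simp
  qed
  have dle: "d j x \<le> x" and dge: "x - 1 / 2 ^ j < d j x" for j x
  proof -
    have "of_int \<lfloor>2 ^ j * x\<rfloor> \<le> 2 ^ j * x" by simp
    then show "d j x \<le> x" by (simp add: d_def field_simps)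
    have "2 ^ j * x - 1 < of_int \<lfloor>2 ^ j * x\<rfloor>" by linarith
    then have "(2 ^ j * x - 1) / 2 ^ j < d j x" unfolding d_def by (rule divide_strict_right_mono) simp
    then show "x - 1 / 2 ^ j < d j x" by (simp add: diff_divide_distrib)
  qed
  have d01: "d j x \<in> {0..1}" if "x \<in> {0..1}" for j x
  proof -
    have "0 \<le> d j x" using that by (simp add: d_def)
    then show ?thesis using that dle[of j x] by auto
  qed
  have step: "\<bar>f (d (Suc j) x) - f (d j x)\<bar> \<le> 2 * sqrt (Suc j / 2 ^ Suc j)"
    if "m0 \<le> j" "x \<in> {0..1}" for j x
  proof -
    let ?k = "\<lfloor>2 ^ j * x\<rfloor>"
    have eq: "2 ^ Suc j * x = 2 * (2 ^ j * x)" by simp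
    have "d (Suc j) x = d j x \<or> d (Suc j) x = (of_int (2 * ?k) + 1) / 2 ^ Suc j \<and> \<lfloor>2 ^ Suc j * x\<rfloor> = 2 * ?k + 1"
      using floor_double_cases[of "2 ^ j * x"] unfolding d_def eq by auto
    then show ?thesis
    proof
      assume "d (Suc j) x = d j x" then show ?thesis by simp
    next
      assume *: "d (Suc j) x = (of_int (2 * ?k) + 1) / 2 ^ Suc j \<and> \<lfloor>2 ^ Suc j * x\<rfloor> = 2 * ?k + 1"
      have "d j x = of_int (2 * ?k) / 2 ^ Suc j" by (simp add: d_def)
      moreover have "0 \<le> 2 * ?k" using that by simp
      moreover have "2 * ?k < 2 ^ Suc j"
      proof -
        have "of_int (2 * ?k + 1) \<le> 2 ^ Suc j * x" using * by (metis of_int_floor_le)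
        also have "\<dots> \<le> 2 ^ Suc j" using that by simp
        finally have "of_int (2 * ?k + 1) \<le> (of_int (2 ^ Suc j) :: real)" by simp
        then show ?thesis by linarith
      qed
      ultimately show ?thesis using * incr'[of "Suc j" "2 * ?k"] that by simp
    qed
  qed
  \<comment> \<open>The bound telescopes because 2 w(j+1) \<le> 10 w(j) - 10 w(j+1) for w(j) = sqrt
    (j / 2^j). Squared, this is 144 (j + 1) \<le> 200 j, true from j = 3 on: the origin of
    \<open>3 \<le> m0\<close>.\<close>
  have tel: "\<bar>f (d (m + i) x) - f (d m x)\<bar> \<le> 10 * sqrt (m / 2 ^ m) - 10 * sqrt ((m + i) / 2 ^ (m + i))"
    if x: "x \<in> {0..1}" for x i
  proof (induction i)
    case (Suc i)
    let ?j = "m + i"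
    have "12 * sqrt (Suc ?j / 2 ^ Suc ?j) = sqrt (144 * (Suc ?j / 2 ^ Suc ?j))"
      unfolding real_sqrt_mult by simp
    also have "\<dots> \<le> sqrt (100 * (?j / 2 ^ ?j))"
    proof (rule real_sqrt_le_mono)
      have "144 * real (Suc ?j) \<le> 200 * real ?j" using m m0 by simp
      then have "72 * real (Suc ?j) / 2 ^ ?j \<le> 100 * real ?j / 2 ^ ?j"
        by (intro divide_right_mono) auto
      moreover have "144 * (x / (2 * y)) = 72 * x / y" for x y :: real by simp
      ultimately show "144 * (Suc ?j / 2 ^ Suc ?j) \<le> 100 * (?j / 2 ^ ?j)"
        by (simp only: power_Suc times_divide_eq_right)
    qed
    also have "\<dots> = 10 * sqrt (?j / 2 ^ ?j)"
      unfolding real_sqrt_mult by simp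
    finally have "12 * sqrt (Suc ?j / 2 ^ Suc ?j) \<le> 10 * sqrt (?j / 2 ^ ?j)" .
    with Suc.IH step[of ?j x] m x show ?case by (simp add: of_nat_add add.commute)
  qed simp
  have lim: "\<bar>f x - f (d m x)\<bar> \<le> 10 * sqrt (m / 2 ^ m)" if x: "x \<in> {0..1}" for x
  proof (rule LIMSEQ_le_const2)
    have "(\<lambda>i. d (m + i) x) \<longlonglongrightarrow> x"
    proof (rule tendsto_sandwich)
      show "\<forall>\<^sub>F i in sequentially. x - (1 / 2 ^ m) * (1 / 2) ^ i \<le> d (m + i) x"
        using dge[of x "m + _"] by (intro always_eventually) (auto simp: power_add power_one_over less_imp_le)
      show "\<forall>\<^sub>F i in sequentially. d (m + i) x \<le> x" using dle by auto
      have "(\<lambda>i. (1 / 2 :: real) ^ i) \<longlonglongrightarrow> 0" by (rule LIMSEQ_realpow_zero) auto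
      then show "(\<lambda>i. x - (1 / 2 ^ m) * (1 / 2) ^ i) \<longlonglongrightarrow> x" by (auto intro!: tendsto_eq_intros)
    qed auto
    then have "(\<lambda>i. f (d (m + i) x)) \<longlonglongrightarrow> f x"
      using cont x d01[OF x] unfolding continuous_on_sequentially comp_def by (auto 0 3)
    then show "(\<lambda>i. \<bar>f (d (m + i) x) - f (d m x)\<bar>) \<longlonglongrightarrow> \<bar>f x - f (d m x)\<bar>"
      by (intro tendsto_intros)
    have "\<bar>f (d (m + i) x) - f (d m x)\<bar> \<le> 10 * sqrt (m / 2 ^ m)" for i
      using tel[OF x, of i] by (smt (verit) real_sqrt_ge_zero of_nat_0_le_iff divide_nonneg_nonneg zero_le_power)
    then show "\<exists>N. \<forall>i\<ge>N. \<bar>f (d (m + i) x) - f (d m x)\<bar> \<le> 10 * sqrt (m / 2 ^ m)" by auto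
  qed
  have mid: "\<bar>f (d m x) - f (d m y)\<bar> \<le> 2 * sqrt (m / 2 ^ m)"
    if "x \<in> {0..1}" "y \<in> {0..1}" "x \<le> y" "\<bar>x - y\<bar> \<le> 1 / 2 ^ m" for x y
  proof -
    let ?k = "\<lfloor>2 ^ m * x\<rfloor>"
    have "2 ^ m * y \<le> 2 ^ m * x + 1" "2 ^ m * x \<le> 2 ^ m * y"
      using that by (simp_all add: field_simps abs_if split: if_splits)
    then have "\<lfloor>2 ^ m * y\<rfloor> = ?k \<or> \<lfloor>2 ^ m * y\<rfloor> = ?k + 1" by linarith
    then show ?thesis
    proof
      assume *: "\<lfloor>2 ^ m * y\<rfloor> = ?k + 1"
      have "of_int (?k + 1) \<le> 2 ^ m * y" using * by (metis of_int_floor_le)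
      also have "\<dots> \<le> 2 ^ m" using that by simp
      finally have "of_int (?k + 1) \<le> (of_int (2 ^ m) :: real)" by simp
      then have "?k < 2 ^ m" by linarith
      then have "\<bar>f ((of_int ?k + 1) / 2 ^ m) - f (of_int ?k / 2 ^ m)\<bar> \<le> 2 * sqrt (m / 2 ^ m)"
        using that m by (intro incr') auto
      then show ?thesis unfolding d_def * by (simp add: abs_minus_commute)
    qed (simp add: d_def)
  qed
  have mid': "\<bar>f (d m s) - f (d m t)\<bar> \<le> 2 * sqrt (m / 2 ^ m)"
    using mid[of s t] mid[of t s] s t st by (cases "s \<le> t") (auto simp: abs_minus_commute)
  show ?thesis using lim[OF s] lim[OF t] mid' by linarith
qed

lemma (in prob_space) AE_eventually_not_in:
  assumes "\<And>n. A n \<in> events" and "\<And>n. n0 \<le> n \<Longrightarrow> prob (A n) \<le> b n" and "summable b"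
  shows "AE \<omega> in M. \<forall>\<^sub>F n in sequentially. \<omega> \<notin> A n"
proof -
  have "summable (\<lambda>n. prob (A n))"
    by (rule summable_comparison_test[OF _ assms(3)]) (use assms(2) in auto)
  from borel_cantelli_AE1[OF assms(1) _ this] show ?thesis
    by (auto simp: emeasure_eq_measure)
qed

text \<open>Levy's modulus sqrt (h log (1/h)) at dyadic h = 2^-m, with a factor 22 far from sharp.
  It is later beaten by the 2^(-q/2) gained from comparing distances 2^-(n+q) with windows of length
  2^-n.\<close>

definition has_modulus :: "(real \<Rightarrow> real) \<Rightarrow> bool" where
  "has_modulus f \<longleftrightarrow> (\<forall>\<^sub>F m in sequentially. \<forall>s\<in>{0..1}. \<forall>t\<in>{0..1}.
     \<bar>s - t\<bar> \<le> 1 / 2 ^ m \<longrightarrow> \<bar>f s - f t\<bar> \<le> 22 * sqrt (real m / 2 ^ m))"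

text \<open>Union bound over the 2^m dyadic intervals of length 2^-m: exceeding
  \<open>2 * sqrt m\<close> standard deviations has probability at most 2 exp (-2 m), and 2 / exp 2
  < 1 makes the total summable. Continuity of the path then carries the bound from grid points to
  all times.\<close>

lemma (in brownian_motion_01) AE_has_modulus: "AE \<omega> in M. has_modulus (\<lambda>t. X t \<omega>)"
proof -
  define B where "B m k = {\<omega> \<in> space M. \<bar>X ((real k + 1) / 2 ^ m) \<omega> - X (real k / 2 ^ m) \<omega>\<bar>
    \<ge> (2 * sqrt m) * sqrt ((real k + 1) / 2 ^ m - real k / 2 ^ m)}" for m k :: nat
  define A where "A m = (\<Union>k<2^m. B m k)" for m :: nat
  have in01: "(real k + 1) / 2 ^ m \<in> {0..1}" "real k / 2 ^ m \<in> {0..1}" if "k < 2 ^ m" for k m :: nat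
  proof -
    have "real (Suc k) \<le> real (2 ^ m)" using that by (intro of_nat_mono) simp
    then show "(real k + 1) / 2 ^ m \<in> {0..1}" "real k / 2 ^ m \<in> {0..1}" using that by simp_all
  qed
  have Bm: "B m k \<in> events" if "k < 2 ^ m" for m k
  proof -
    have [measurable]: "(\<lambda>\<omega>. X ((real k + 1) / 2 ^ m) \<omega> - X (real k / 2 ^ m) \<omega>) \<in> borel_measurable M"
      using in01[OF that] by (intro increment_measurable) auto
    show ?thesis unfolding B_def by measurable
  qed
  have "AE \<omega> in M. \<forall>\<^sub>F m in sequentially. \<omega> \<notin> A m"
  proof (rule AE_eventually_not_in[where b = "\<lambda>m. 2 * (2 / exp 2) ^ m" and ?n0.0 = 0])
    show "A m \<in> events" for m unfolding A_def using Bm by auto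
    show "prob (A m) \<le> 2 * (2 / exp 2) ^ m" for m
    proof -
      have "prob (A m) \<le> (\<Sum>k<2^m. prob (B m k))"
        unfolding A_def using Bm by (intro finite_measure_subadditive_finite) auto
      also have "\<dots> \<le> (\<Sum>k<(2::nat)^m. 2 * exp (- (2 * sqrt m)\<^sup>2 / 2))"
      proof (intro sum_mono)
        fix k :: nat assume "k \<in> {..<2 ^ m}"
        then have "prob (B m k) = gauss_tail (2 * sqrt m)"
          unfolding B_def using in01[of k m] by (intro prob_increment_ge) (auto simp: divide_strict_right_mono)
        then show "prob (B m k) \<le> 2 * exp (- (2 * sqrt m)\<^sup>2 / 2)"
          using gauss_tail_upper[of "2 * sqrt m"] by simp
      qed
      also have "\<dots> = 2 * (2 / exp 2) ^ m"
      proof -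
        have "exp (- (2 * sqrt m)\<^sup>2 / 2) = inverse (exp (real m * 2))"
          unfolding exp_minus[symmetric] by (simp add: power_mult_distrib)
        also have "exp (real m * 2) = exp 2 ^ m" by (rule exp_of_nat_mult)
        finally show ?thesis by (simp add: power_divide field_simps)
      qed
      finally show ?thesis .
    qed
    have "2 < exp (2::real)" using exp_ge_add_one_self[of 2] by simp
    then show "summable (\<lambda>m. 2 * (2 / exp (2::real)) ^ m)"
      by (intro summable_mult summable_geometric) auto
  qed
  with continuous_paths AE_space show ?thesis
  proof eventually_elim
    case (elim \<omega>)
    then obtain m1 where m1: "\<And>m. m1 \<le> m \<Longrightarrow> \<omega> \<notin> A m" by (auto simp: eventually_sequentially)
    show "has_modulus (\<lambda>t. X t \<omega>)" unfolding has_modulus_def eventually_sequentially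
    proof (intro exI[of _ "max 3 m1"] allI impI ballI)
      fix m s t assume "max 3 m1 \<le> m" "s \<in> {0..1}" "t \<in> {0..1}" "\<bar>s - t\<bar> \<le> 1 / (2::real) ^ m"
      then show "\<bar>X s \<omega> - X t \<omega>\<bar> \<le> 22 * sqrt (real m / 2 ^ m)"
      proof (intro dyadic_chaining[where f = "\<lambda>t. X t \<omega>" and ?m0.0 = "max 3 m1"])
        fix m k :: nat assume "max 3 m1 \<le> m" "k < 2 ^ m"
        then have "\<omega> \<notin> B m k" using m1[of m] by (auto simp: A_def)
        then have "\<bar>X ((real k + 1) / 2 ^ m) \<omega> - X (real k / 2 ^ m) \<omega>\<bar>
          < (2 * sqrt m) * sqrt ((real k + 1) / 2 ^ m - real k / 2 ^ m)"
          using elim by (auto simp: B_def)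
        also have "(2 * sqrt m) * sqrt ((real k + 1) / 2 ^ m - real k / 2 ^ m) = 2 * sqrt (m / 2 ^ m)"
          by (simp add: real_sqrt_divide flip: diff_divide_distrib)
        finally show "\<bar>X ((real k + 1) / 2 ^ m) \<omega> - X (real k / 2 ^ m) \<omega>\<bar> \<le> 2 * sqrt (m / 2 ^ m)" by simp
      qed (use elim in auto)
    qed
  qed
qed

subsection \<open>Exponential sums with random coefficients\<close>

lemma exp_le_quadratic:
  fixes x :: real
  assumes "\<bar>x\<bar> \<le> 1"
  shows "exp x \<le> 1 + x + x\<^sup>2"
proof (cases "0 \<le> x")
  case True
  then show ?thesis using assms exp_bound[of x] by simp
next
  case False
  define y where "y = - x"
  have y: "0 < y" using False y_def by simp
  have "exp x = 1 / exp y" by (simp add: y_def exp_minus field_simps)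
  also have "\<dots> \<le> 1 / (1 + y)"
    using y exp_ge_add_one_self[of y] by (intro divide_left_mono) auto
  also have "\<dots> \<le> 1 - y + y\<^sup>2"
  proof -
    have "(1 - y + y\<^sup>2) * (1 + y) = 1 + y ^ 3" by (simp add: power2_eq_square power3_eq_cube algebra_simps)
    then have "1 \<le> (1 - y + y\<^sup>2) * (1 + y)" using y by simp
    then show ?thesis using y by (simp add: divide_le_eq)
  qed
  finally show ?thesis by (simp add: y_def)
qed

text \<open>Exponential Markov inequality. The condition \<open>\<kappa> \<le> p\<close> keeps every
  exponent in [-1, 1], where exp x \<le> 1 + x + x^2; centring removes the linear term and the
  variance bounds the quadratic one, so each factor has mean at most
  \<open>exp (\<kappa>\<^sup>2 / p)\<close>. That 1/p bounds both size and variance is typical of a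
  Bernoulli variable divided by its mean.\<close>

lemma (in prob_space) chernoff_weighted_sum:
  fixes Y :: "'i \<Rightarrow> 'a \<Rightarrow> real" and p \<kappa> s :: real
  assumes indep: "indep_vars (\<lambda>_. borel) Y I" and fin: "finite I"
    and bd: "\<And>i \<omega>. i \<in> I \<Longrightarrow> \<omega> \<in> space M \<Longrightarrow> \<bar>Y i \<omega>\<bar> \<le> 1 / p"
    and mean: "\<And>i. i \<in> I \<Longrightarrow> expectation (Y i) = 0"
    and var: "\<And>i. i \<in> I \<Longrightarrow> expectation (\<lambda>\<omega>. (Y i \<omega>)\<^sup>2) \<le> 1 / p"
    and a: "\<And>i. i \<in> I \<Longrightarrow> \<bar>a i\<bar> \<le> 1" and l: "0 < \<kappa>" "\<kappa> \<le> p"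
  shows "prob {\<omega> \<in> space M. s \<le> (\<Sum>i\<in>I. a i * Y i \<omega>)} \<le> exp (card I * \<kappa>\<^sup>2 / p - \<kappa> * s)"
proof -
  have p: "0 < p" using l by simp
  have rv: "Y i \<in> borel_measurable M" if "i \<in> I" for i
    using indep that by (auto simp: indep_vars_def)
  define Z where "Z i \<omega> = exp (\<kappa> * a i * Y i \<omega>)" for i \<omega>
  have Zm: "Z i \<in> borel_measurable M" if "i \<in> I" for i
    unfolding Z_def using rv[OF that] by measurable
  have small: "\<bar>\<kappa> * a i * Y i \<omega>\<bar> \<le> 1" if "i \<in> I" "\<omega> \<in> space M" for i \<omega>
  proof -
    have "\<bar>\<kappa> * a i * Y i \<omega>\<bar> = \<kappa> * (\<bar>a i\<bar> * \<bar>Y i \<omega>\<bar>)" using l by (simp add: abs_mult)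
    also have "\<dots> \<le> p * (1 * (1 / p))"
      using l p a[OF that(1)] bd[OF that] by (intro mult_mono) auto
    finally show ?thesis using p by simp
  qed
  have Yint: "integrable M (Y i)" "integrable M (\<lambda>\<omega>. (Y i \<omega>)\<^sup>2)" if "i \<in> I" for i
  proof -
    show "integrable M (Y i)"
      using rv[OF that] bd[OF that] by (intro integrable_const_bound[where B = "1/p"]) auto
    have "(Y i \<omega>)\<^sup>2 \<le> (1 / p)\<^sup>2" if "\<omega> \<in> space M" for \<omega>
      using bd[OF \<open>i \<in> I\<close> that] p by (metis abs_le_square_iff abs_of_nonneg divide_nonneg_pos zero_le_one)
    then show "integrable M (\<lambda>\<omega>. (Y i \<omega>)\<^sup>2)"
      using rv[OF that] by (intro integrable_const_bound[where B = "(1/p)\<^sup>2"]) auto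
  qed
  have Zint: "integrable M (Z i)" if "i \<in> I" for i
  proof (rule integrable_const_bound[where B = "exp 1"])
    show "AE \<omega> in M. norm (Z i \<omega>) \<le> exp 1"
      using small[OF that] by (intro AE_I2) (auto simp: Z_def abs_le_iff)
  qed (rule Zm[OF that])
  have EZ: "expectation (Z i) \<le> exp (\<kappa>\<^sup>2 / p)" if i: "i \<in> I" for i
  proof -
    have "expectation (Z i) \<le> expectation (\<lambda>\<omega>. 1 + \<kappa> * a i * Y i \<omega> + (\<kappa> * a i)\<^sup>2 * (Y i \<omega>)\<^sup>2)"
    proof (rule integral_mono)
      show "integrable M (Z i)" by (rule Zint[OF i])
      show "integrable M (\<lambda>\<omega>. 1 + \<kappa> * a i * Y i \<omega> + (\<kappa> * a i)\<^sup>2 * (Y i \<omega>)\<^sup>2)"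
        using Yint[OF i] by auto
      show "Z i \<omega> \<le> 1 + \<kappa> * a i * Y i \<omega> + (\<kappa> * a i)\<^sup>2 * (Y i \<omega>)\<^sup>2" if "\<omega> \<in> space M" for \<omega>
        using exp_le_quadratic[OF small[OF i that]] by (simp add: Z_def power_mult_distrib)
    qed
    also have "\<dots> = 1 + (\<kappa> * a i)\<^sup>2 * expectation (\<lambda>\<omega>. (Y i \<omega>)\<^sup>2)"
      using Yint[OF i] mean[OF i] by (simp add: prob_space)
    also have "\<dots> \<le> 1 + \<kappa>\<^sup>2 * (1 / p)"
    proof -
      have "(\<kappa> * a i)\<^sup>2 \<le> \<kappa>\<^sup>2"
        using a[OF i] l by (simp add: power_mult_distrib abs_square_le_1 mult_left_le)
      then show ?thesis using var[OF i] p by (intro add_left_mono mult_mono) auto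
    qed
    also have "\<dots> \<le> exp (\<kappa>\<^sup>2 / p)" using exp_ge_add_one_self[of "\<kappa>\<^sup>2 / p"] by simp
    finally show ?thesis .
  qed
  have indZ: "indep_vars (\<lambda>_. borel) Z I"
    using indep_vars_compose2[OF indep, of "\<lambda>i x. exp (\<kappa> * a i * x)" "\<lambda>_. borel"] by (simp add: Z_def[abs_def])
  have EP: "expectation (\<lambda>\<omega>. \<Prod>i\<in>I. Z i \<omega>) = (\<Prod>i\<in>I. expectation (Z i))"
    by (rule indep_vars_lebesgue_integral[OF fin indZ Zint])
  have IP: "integrable M (\<lambda>\<omega>. \<Prod>i\<in>I. Z i \<omega>)"
    by (rule indep_vars_integrable[OF fin indZ Zint])
  have "{\<omega> \<in> space M. s \<le> (\<Sum>i\<in>I. a i * Y i \<omega>)} = {\<omega> \<in> space M. exp (\<kappa> * s) \<le> (\<Prod>i\<in>I. Z i \<omega>)}"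
    using l fin by (simp add: Z_def flip: exp_sum) (simp add: mult.assoc flip: sum_distrib_left)
  then have "prob {\<omega> \<in> space M. s \<le> (\<Sum>i\<in>I. a i * Y i \<omega>)}
      \<le> (1 / exp (\<kappa> * s)) * expectation (\<lambda>\<omega>. \<Prod>i\<in>I. Z i \<omega>)"
    using integral_Markov_inequality_measure[OF IP, of "{}" "exp (\<kappa> * s)"]
    by (simp add: Z_def prod_nonneg)
  also have "\<dots> \<le> (1 / exp (\<kappa> * s)) * (\<Prod>i\<in>I. exp (\<kappa>\<^sup>2 / p))"
    unfolding EP using EZ by (intro mult_left_mono prod_mono conjI integral_nonneg) (auto simp: Z_def)
  also have "\<dots> = exp (card I * \<kappa>\<^sup>2 / p - \<kappa> * s)"
    by (simp add: exp_diff flip: exp_of_nat_mult)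
  finally show ?thesis .
qed

lemma cis_diff_le: "cmod (cis x - cis y) \<le> \<bar>x - y\<bar>"
proof -
  have "cis x - cis y = cis y * (cis (x - y) - 1)"
    by (simp add: cis_mult algebra_simps)
  then have "cmod (cis x - cis y) = cmod (cis (x - y) - 1)"
    by (simp add: norm_mult)
  also have "\<dots> \<le> \<bar>x - y\<bar>"
    using iexp_approx1[of "x - y" 0] by (simp add: cis_conv_exp)
  finally show ?thesis .
qed

text \<open>Integer frequencies make the sum 2 pi-periodic in \<open>\<phi>\<close>, and each of its
  n terms is Lipschitz in \<open>\<phi>\<close> with constant at most B * n, so m equally spaced
  angles control all others.\<close>

lemma trig_poly_sup_le_net:
  fixes c :: "nat \<Rightarrow> real"
  assumes m: "0 < m" and c: "\<And>i. i < n \<Longrightarrow> \<bar>c i\<bar> \<le> B"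
    and net: "\<And>j. j < m \<Longrightarrow> cmod (\<Sum>i<n. of_real (c i) * cis (real i * (2 * pi * real j / real m))) \<le> s"
  shows "cmod (\<Sum>i<n. of_real (c i) * cis (real i * \<phi>)) \<le> s + 2 * pi * B * (real n)\<^sup>2 / real m"
proof -
  \<comment> \<open>\<open>k\<close> indexes the net angle just below \<open>\<phi>\<close> on the
    whole line; reducing it modulo m to \<open>j\<close> leaves every \<open>cis\<close>
    unchanged.\<close>
  define k where "k = \<lfloor>\<phi> * real m / (2 * pi)\<rfloor>"
  define j where "j = nat (k mod int m)"
  define \<theta> where "\<theta> = 2 * pi * of_int k / real m"
  have j: "j < m" "int j = k mod int m" using m by (simp_all add: j_def nat_less_iff)
  have km: "of_int k = real j + real m * of_int (k div int m)"
  proof -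
    have "k = int j + int m * (k div int m)" using j by simp
    then have "(of_int k :: real) = of_int (int j + int m * (k div int m))" by simp
    then show ?thesis by simp
  qed
  have per: "cis (real i * \<theta>) = cis (real i * (2 * pi * real j / real m))" for i
  proof -
    have "real i * \<theta> = real i * (2 * pi * real j / real m) + 2 * pi * of_int (int i * (k div int m))"
      unfolding \<theta>_def km using m by (simp add: field_simps)
    then show ?thesis by (simp add: cis_multiple_2pi flip: cis_mult)
  qed
  have near: "\<bar>\<phi> - \<theta>\<bar> \<le> 2 * pi / real m"
  proof -
    have "of_int k \<le> \<phi> * real m / (2 * pi)" "\<phi> * real m / (2 * pi) \<le> of_int k + 1"
      unfolding k_def by linarith+
    then have "of_int k * (2 * pi / real m) \<le> \<phi>" "\<phi> \<le> (of_int k + 1) * (2 * pi / real m)"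
      using m by (simp_all add: field_simps)
    then show ?thesis by (simp add: \<theta>_def algebra_simps add_divide_distrib)
  qed
  have "cmod ((\<Sum>i<n. of_real (c i) * cis (real i * \<phi>)) - (\<Sum>i<n. of_real (c i) * cis (real i * \<theta>)))
      \<le> (\<Sum>i<n. cmod (of_real (c i) * (cis (real i * \<phi>) - cis (real i * \<theta>))))"
    unfolding sum_subtractf[symmetric] right_diff_distrib[symmetric] by (rule norm_sum)
  also have "\<dots> \<le> (\<Sum>i<n. B * (real n * (2 * pi / real m)))"
  proof (intro sum_mono)
    fix i assume i: "i \<in> {..<n}"
    have "cmod (cis (real i * \<phi>) - cis (real i * \<theta>)) \<le> real i * \<bar>\<phi> - \<theta>\<bar>"
      using cis_diff_le[of "real i * \<phi>" "real i * \<theta>"] by (simp add: abs_mult flip: right_diff_distrib)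
    also have "\<dots> \<le> real n * (2 * pi / real m)" using near i by (intro mult_mono) auto
    finally show "cmod (of_real (c i) * (cis (real i * \<phi>) - cis (real i * \<theta>))) \<le> B * (real n * (2 * pi / real m))"
      unfolding norm_mult norm_of_real using c[of i] i
      by (intro mult_mono) (auto intro: order_trans[OF abs_ge_zero])
  qed
  also have "\<dots> = 2 * pi * B * (real n)\<^sup>2 / real m" by (simp add: power2_eq_square)
  finally have diff: "cmod ((\<Sum>i<n. of_real (c i) * cis (real i * \<phi>)) - (\<Sum>i<n. of_real (c i) * cis (real i * \<theta>)))
      \<le> 2 * pi * B * (real n)\<^sup>2 / real m" .
  moreover have "cmod (\<Sum>i<n. of_real (c i) * cis (real i * \<theta>)) \<le> s"
    unfolding per using net[OF j(1)] .
  ultimately show ?thesis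
    by (smt (verit) norm_triangle_sub)
qed

section \<open>Rapid windows and the exponential sums of their centred weights\<close>

definition rapid_threshold :: "real \<Rightarrow> nat \<Rightarrow> real" where
  "rapid_threshold a n = a * sqrt (2 * real n * ln 2)"

definition hit_prob :: "real \<Rightarrow> nat \<Rightarrow> real" where
  "hit_prob a n = gauss_tail (rapid_threshold a n)"

text \<open>The window has length 2^-n and starts at k / 2^(n+q). At h = 2^-n the quantity a * sqrt
  (2 h ln (1/h)) is \<open>rapid_threshold a n * sqrt h\<close>; sqrt h is the standard deviation of
  the increment, so for Brownian motion the event has probability exactly
  \<open>hit_prob a n\<close>.\<close>

definition hit :: "real \<Rightarrow> nat \<Rightarrow> nat \<Rightarrow> (real \<Rightarrow> real) \<Rightarrow> nat \<Rightarrow> bool" where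
  "hit a q n f k \<longleftrightarrow>
    rapid_threshold a n * sqrt (1 / 2 ^ n) \<le> \<bar>f ((real k + 2 ^ q) / 2 ^ (n + q)) - f (real k / 2 ^ (n + q))\<bar>"

definition hit_weight :: "real \<Rightarrow> nat \<Rightarrow> nat \<Rightarrow> (real \<Rightarrow> real) \<Rightarrow> nat \<Rightarrow> real" where
  "hit_weight a q n f k = (if hit a q n f k then 1 / hit_prob a n else 0)"

lemma hit_prob_pos: "0 \<le> a \<Longrightarrow> 0 < hit_prob a n"
  by (simp add: hit_prob_def gauss_tail_pos rapid_threshold_def)

lemma hit_prob_le_1: "hit_prob a n \<le> 1"
  by (simp add: hit_prob_def gauss_tail_le_1)

lemma hit_weight_bounds:
  assumes "0 \<le> a"
  shows "0 \<le> hit_weight a q n f k" "\<bar>hit_weight a q n f k - 1\<bar> \<le> 1 / hit_prob a n"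
  using hit_prob_pos[OF assms, of n] hit_prob_le_1[of a n]
  by (auto simp: hit_weight_def abs_le_iff field_simps)

text \<open>With x = a * sqrt (2 n ln 2) the exponent (x + 1)^2 / 2 is a^2 n ln 2 plus a term of
  order sqrt n; the gap between a^2 and \<open>\<rho>\<close> absorbs that term and the constant
  sqrt (2 pi).\<close>

lemma hit_prob_lower:
  assumes "0 \<le> a" "a\<^sup>2 < \<rho>"
  shows "\<forall>\<^sub>F n in sequentially. 2 powr (- \<rho> * real n) \<le> hit_prob a n"
proof -
  have "\<forall>\<^sub>F n in sequentially. a\<^sup>2 * (real n * ln 2) + a * sqrt (2 * real n * ln 2) + 1/2 + ln (sqrt (2 * pi)) \<le> \<rho> * (real n * ln 2)"
    using assms by real_asymp
  then show ?thesis
  proof eventually_elim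
    case (elim n)
    let ?x = "rapid_threshold a n"
    have x: "0 \<le> ?x" using assms by (simp add: rapid_threshold_def)
    have sq: "(?x + 1)\<^sup>2 / 2 = a\<^sup>2 * (real n * ln 2) + a * sqrt (2 * real n * ln 2) + 1/2"
      by (simp add: rapid_threshold_def power2_sum power_mult_distrib field_simps)
    have "2 powr (- \<rho> * real n) = exp (- (\<rho> * (real n * ln 2)))" by (simp add: powr_def)
    also have "\<dots> \<le> exp (- ((?x + 1)\<^sup>2 / 2) - ln (sqrt (2 * pi)))" unfolding sq using elim by simp
    also have "\<dots> = exp (- (?x + 1)\<^sup>2 / 2) / sqrt (2 * pi)"
      by (simp add: exp_diff)
    also have "\<dots> \<le> hit_prob a n" unfolding hit_prob_def by (rule gauss_tail_lower[OF x])
    finally show ?case .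
  qed
qed

context brownian_motion_01
begin

text \<open>Windows in one residue class modulo 2^q are consecutive and do not overlap, so their
  increments are independent and Chernoff's bound applies to each fixed choice of real coefficients.
  The unit sqrt (2^n / p) bounds the standard deviation of the sum.\<close>

lemma hit_sum_net_point:
  fixes a p s :: real and b :: "nat \<Rightarrow> real"
  assumes a: "0 \<le> a" and r: "r < 2 ^ q" and b: "\<And>i. \<bar>b i\<bar> \<le> 1"
    and p: "p = hit_prob a n" and pn: "1 \<le> 2 ^ n * p"
  defines "Y \<equiv> \<lambda>i \<omega>. hit_weight a q n (\<lambda>t. X t \<omega>) (r + i * 2 ^ q) - 1"
  shows "{\<omega> \<in> space M. s * sqrt (2 ^ n / p) \<le> (\<Sum>i<2^n-1. b i * Y i \<omega>)} \<in> events"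
    and "prob {\<omega> \<in> space M. s * sqrt (2 ^ n / p) \<le> (\<Sum>i<2^n-1. b i * Y i \<omega>)} \<le> exp (1 - s)"
proof -
  \<comment> \<open>Endpoints of the consecutive windows of class \<open>r\<close>. Only 2^n - 1
    windows are taken, since for r > 0 one more would end after time 1.\<close>
  define \<tau> where "\<tau> i = real (r + i * 2 ^ q) / 2 ^ (n + q)" for i :: nat
  have p0: "0 < p" using hit_prob_pos[OF a] p by simp
  have mono: "strict_mono_on {..2^n-1} \<tau>"
    by (auto simp: strict_mono_on_def \<tau>_def divide_strict_right_mono)
  have range: "\<tau> ` {..2^n-1} \<subseteq> {0..1}"
  proof -
    have "\<tau> i \<in> {0..1}" if "i \<le> 2 ^ n - 1" for i
    proof -
      have "r + i * 2 ^ q \<le> 2 ^ q + (2 ^ n - 1) * 2 ^ q" using that r by (intro add_mono mult_right_mono) auto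
      also have "\<dots> = 2 ^ (n + q)" by (simp add: algebra_simps power_add)
      finally have "real (r + i * 2 ^ q) \<le> real (2 ^ (n + q))" by (rule of_nat_mono)
      then show ?thesis by (simp add: \<tau>_def)
    qed
    then show ?thesis by auto
  qed
  have \<tau>01: "0 \<le> \<tau> i" "\<tau> i < \<tau> (Suc i)" "\<tau> (Suc i) \<le> 1" if "i < 2 ^ n - 1" for i
  proof -
    have "Suc i \<in> {..2^n-1}" using that by auto
    then have "\<tau> (Suc i) \<in> {0..1}" using range by blast
    then show "\<tau> (Suc i) \<le> 1" by simp
  qed (auto simp: \<tau>_def divide_strict_right_mono)
  have gap: "\<tau> (Suc i) - \<tau> i = 1 / 2 ^ n" for i
    by (simp add: \<tau>_def power_add flip: diff_divide_distrib)
  have \<tau>S: "(real (r + i * 2 ^ q) + 2 ^ q) / 2 ^ (n + q) = \<tau> (Suc i)" for i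
    by (simp add: \<tau>_def algebra_simps)
  define g where "g x = (if rapid_threshold a n * sqrt (1 / 2 ^ n) \<le> \<bar>x\<bar> then 1 / p else 0) - 1" for x
  have gm: "g \<in> borel_measurable borel" unfolding g_def by measurable
  have Y: "Y i \<omega> = g (X (\<tau> (Suc i)) \<omega> - X (\<tau> i) \<omega>)" for i \<omega>
    unfolding Y_def g_def hit_weight_def hit_def \<tau>S p by (simp add: \<tau>_def)
  have ind: "indep_vars (\<lambda>_. borel) Y {..<2^n-1}"
    using indep_vars_compose2[OF indep_increments[OF mono range], of "\<lambda>_. g" "\<lambda>_. borel"] gm
    by (simp add: Y[abs_def])
  then have rv: "Y i \<in> borel_measurable M" if "i < 2 ^ n - 1" for i
    using that by (auto simp: indep_vars_def)
  show "{\<omega> \<in> space M. s * sqrt (2 ^ n / p) \<le> (\<Sum>i<2^n-1. b i * Y i \<omega>)} \<in> events"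
    using rv by (intro borel_measurable_le borel_measurable_sum borel_measurable_times) auto
  have moments: "expectation (Y i) = 0 \<and> expectation (\<lambda>\<omega>. (Y i \<omega>)\<^sup>2) \<le> 1 / p" if i: "i < 2 ^ n - 1" for i
  proof -
    define H where "H = {\<omega> \<in> space M. \<bar>X (\<tau> (Suc i)) \<omega> - X (\<tau> i) \<omega>\<bar> \<ge> rapid_threshold a n * sqrt (\<tau> (Suc i) - \<tau> i)}"
    have [measurable]: "(\<lambda>\<omega>. X (\<tau> (Suc i)) \<omega> - X (\<tau> i) \<omega>) \<in> borel_measurable M"
      using \<tau>01[OF i] by (intro increment_measurable) auto
    have Hm[measurable]: "H \<in> events" unfolding H_def by measurable
    have iH: "integrable M (indicat_real H)"
      by (rule integrable_real_indicator) (auto simp: emeasure_eq_measure)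
    have pH: "prob H = p" unfolding H_def p hit_prob_def by (rule prob_increment_ge[OF \<tau>01[OF i]])
    have YH: "Y i \<omega> = (1 / p) * indicator H \<omega> - 1" "(Y i \<omega>)\<^sup>2 = (1 / p\<^sup>2 - 2 / p) * indicator H \<omega> + 1"
      if "\<omega> \<in> space M" for \<omega>
      using that by (auto simp: Y g_def H_def gap indicator_def power2_eq_square algebra_simps)
    have "expectation (Y i) = expectation (\<lambda>\<omega>. (1 / p) * indicator H \<omega> - 1)"
      by (intro Bochner_Integration.integral_cong refl YH)
    also have "\<dots> = (1 / p) * prob H - 1" using iH by (simp add: prob_space)
    finally have 1: "expectation (Y i) = 0" using pH p0 by simp
    have "expectation (\<lambda>\<omega>. (Y i \<omega>)\<^sup>2) = expectation (\<lambda>\<omega>. (1 / p\<^sup>2 - 2 / p) * indicator H \<omega> + 1)"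
      by (intro Bochner_Integration.integral_cong refl YH)
    also have "\<dots> = (1 / p\<^sup>2 - 2 / p) * prob H + 1"
      using iH by (simp add: prob_space)
    also have "\<dots> = 1 / p - 1" using p0 pH by (simp add: field_simps power2_eq_square)
    finally show ?thesis using 1 by simp
  qed
  \<comment> \<open>This choice makes the quadratic term of the exponent at most 1 and
    \<open>\<kappa>\<close> times the unit sqrt (2^n / p) equal to 1, whence exp (1 - s). The
    constraint \<open>\<kappa> \<le> p\<close> is then equivalent to
    \<open>1 \<le> 2 ^ n * p\<close>.\<close>
  define \<kappa> where "\<kappa> = sqrt (p / 2 ^ n)"
  have l0: "0 < \<kappa>" using p0 by (simp add: \<kappa>_def)
  have "p / 2 ^ n \<le> p\<^sup>2" using pn p0 by (simp add: field_simps power2_eq_square)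
  then have lp: "\<kappa> \<le> p" unfolding \<kappa>_def using p0 by (metis real_sqrt_le_mono real_sqrt_abs abs_of_pos)
  have ls: "\<kappa> * sqrt (2 ^ n / p) = 1"
    using p0 unfolding \<kappa>_def by (simp flip: real_sqrt_mult)
  have "prob {\<omega> \<in> space M. s * sqrt (2 ^ n / p) \<le> (\<Sum>i<2^n-1. b i * Y i \<omega>)}
     \<le> exp (real (card {..<(2::nat)^n-1}) * \<kappa>\<^sup>2 / p - \<kappa> * (s * sqrt (2 ^ n / p)))"
  proof (rule chernoff_weighted_sum[OF ind _ _ _ _ _ l0 lp])
    show "\<bar>Y i \<omega>\<bar> \<le> 1 / p" for i \<omega> unfolding Y_def p by (rule hit_weight_bounds[OF a])
  qed (use moments b in auto)
  also have "\<dots> \<le> exp (1 - s)"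
  proof -
    have "real (card {..<(2::nat)^n-1}) * \<kappa>\<^sup>2 / p \<le> 2 ^ n * \<kappa>\<^sup>2 / p"
      using p0 by (intro divide_right_mono mult_right_mono) (auto simp: of_nat_diff)
    also have "\<dots> = 1" using p0 by (simp add: \<kappa>_def)
    finally have "real (card {..<(2::nat)^n-1}) * \<kappa>\<^sup>2 / p \<le> 1" .
    moreover have "\<kappa> * (s * sqrt (2 ^ n / p)) = s"
      by (simp only: mult.left_commute[of \<kappa>] ls mult_1_right)
    ultimately show ?thesis unfolding exp_le_cancel_iff by linarith
  qed
  finally show "prob {\<omega> \<in> space M. s * sqrt (2 ^ n / p) \<le> (\<Sum>i<2^n-1. b i * Y i \<omega>)} \<le> exp (1 - s)" .
qed

text \<open>Union bound over the classes, a net of 8^n angles and four real functionals per angle. A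
  deviation of n^2 units has probability at most exp (1 - n^2), which outweighs 8^n, while the
  factor n^2 is harmless beside gains exponential in n. The final 3 collects the real part, the
  imaginary part and the net error.\<close>

lemma AE_hit_sums_small:
  assumes a: "0 \<le> a" "a < 1"
  shows "AE \<omega> in M. \<forall>\<^sub>F n in sequentially. \<forall>r<2^q. \<forall>\<phi>.
    cmod (\<Sum>i<2^n-1. of_real (hit_weight a q n (\<lambda>t. X t \<omega>) (r + i * 2 ^ q) - 1) * cis (real i * \<phi>))
      \<le> 3 * (real n)\<^sup>2 * sqrt (2 ^ n / hit_prob a n)"
proof -
  define Y where "Y n r i \<omega> = hit_weight a q n (\<lambda>t. X t \<omega>) (r + i * 2 ^ q) - 1" for n r i \<omega>
  define \<theta> where "\<theta> n j = 2 * pi * real j / real (8 ^ n)" for n j :: nat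
  \<comment> \<open>\<open>c\<close> selects cos, - cos, sin or - sin: the one-sided tail bound
    applied to all four controls both parts of the complex sum.\<close>
  define b where "b n j c i = (if c = 0 then cos (real i * \<theta> n j) else if c = 1 then - cos (real i * \<theta> n j)
    else if c = 2 then sin (real i * \<theta> n j) else - sin (real i * \<theta> n j))" for n j c i :: nat
  define B where "B n r j c = {\<omega> \<in> space M. (real n)\<^sup>2 * sqrt (2 ^ n / hit_prob a n) \<le> (\<Sum>i<2^n-1. b n j c i * Y n r i \<omega>)}"
    for n r j c
  \<comment> \<open>The Chernoff estimate requires 1 \<le> 2^n * p, which holds for all large n
    because a < 1; any other n is given the empty event.\<close>
  define A where "A n = (if 1 \<le> 2 ^ n * hit_prob a n then (\<Union>(r,j,c)\<in>{..<2^q}\<times>{..<8^n}\<times>{..<4}. B n r j c) else {})" for n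
  have b1: "\<bar>b n j c i\<bar> \<le> 1" for n j c i by (simp add: b_def)
  have Bm: "B n r j c \<in> events" and Bp: "prob (B n r j c) \<le> exp (1 - (real n)\<^sup>2)"
    if "1 \<le> 2 ^ n * hit_prob a n" "r < 2 ^ q" for n r j c
    unfolding B_def Y_def using hit_sum_net_point[OF a(1) that(2) b1 refl that(1)] by auto
  have A_ae: "AE \<omega> in M. \<forall>\<^sub>F n in sequentially. \<omega> \<notin> A n"
  proof (rule AE_eventually_not_in[where b = "\<lambda>n. 2 ^ q * 4 * exp 1 * (8 / exp 4) ^ n" and ?n0.0 = 4])
    show "A n \<in> events" for n using Bm by (auto simp: A_def)
    show "prob (A n) \<le> 2 ^ q * 4 * exp 1 * (8 / exp 4) ^ n" if "4 \<le> n" for n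
    proof (cases "1 \<le> 2 ^ n * hit_prob a n")
      case True
      let ?S = "{..<(2::nat)^q}\<times>{..<(8::nat)^n}\<times>{..<(4::nat)}"
      have "prob (A n) = prob (\<Union>x\<in>?S. case x of (r,j,c) \<Rightarrow> B n r j c)" using True by (simp add: A_def)
      also have "\<dots> \<le> (\<Sum>x\<in>?S. prob (case x of (r,j,c) \<Rightarrow> B n r j c))"
        using Bm[OF True] by (intro finite_measure_subadditive_finite) auto
      also have "\<dots> \<le> (\<Sum>x\<in>?S. exp (1 - (real n)\<^sup>2))"
        using Bp[OF True] by (intro sum_mono) auto
      also have "\<dots> = 2 ^ q * 4 * 8 ^ n * exp (1 - (real n)\<^sup>2)" by (simp add: card_cartesian_product)
      also have "\<dots> \<le> 2 ^ q * 4 * 8 ^ n * exp (1 - real n * 4)"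
        using that by (simp add: power2_eq_square)
      also have "\<dots> = 2 ^ q * 4 * exp 1 * (8 / exp 4) ^ n"
        unfolding exp_diff exp_of_nat_mult by (simp add: power_divide)
      finally show ?thesis .
    qed (simp add: A_def)
    have "exp (4::real) = (exp 2)\<^sup>2" by (simp flip: exp_of_nat_mult)
    moreover have "3\<^sup>2 \<le> (exp (2::real))\<^sup>2" using exp_ge_add_one_self[of 2] by (intro power_mono) auto
    ultimately have "8 < exp (4::real)" by simp
    then show "summable (\<lambda>n. 2 ^ q * 4 * exp 1 * (8 / exp 4 :: real) ^ n)"
      by (intro summable_mult summable_geometric) auto
  qed
  have big: "\<forall>\<^sub>F n in sequentially. 1 \<le> 2 ^ n * hit_prob a n"
    using hit_prob_lower[of a 1]
  proof (rule eventually_mono)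
    show "a\<^sup>2 < 1" using a by (simp add: abs_square_less_1)
    show "1 \<le> 2 ^ n * hit_prob a n" if "2 powr (- 1 * real n) \<le> hit_prob a n" for n
      using that by (simp add: powr_minus powr_realpow field_simps)
  qed (use a in auto)
  from A_ae AE_space show ?thesis
  proof (eventually_elim, goal_cases)
    case (1 \<omega>)
    from 1(1) big eventually_ge_at_top[of 3] show ?case
    proof (eventually_elim, intro allI impI)
      case (elim n)
      fix r \<phi> assume r: "r < (2::nat) ^ q"
      define p where "p = hit_prob a n"
      define s where "s = (real n)\<^sup>2 * sqrt (2 ^ n / p)"
      have p: "0 < p" "p \<le> 1" "1 \<le> 2 ^ n * p" using hit_prob_pos[OF a(1)] hit_prob_le_1 elim by (auto simp: p_def)
      have net: "cmod (\<Sum>i<2^n-1. of_real (Y n r i \<omega>) * cis (real i * (2 * pi * real j / real (8 ^ n)))) \<le> 2 * s"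
        if j: "j < 8 ^ n" for j
      proof -
        let ?z = "\<Sum>i<2^n-1. of_real (Y n r i \<omega>) * cis (real i * (2 * pi * real j / real (8 ^ n)))"
        have notB: "(\<Sum>i<2^n-1. b n j c i * Y n r i \<omega>) < s" if "c < 4" for c
        proof -
          have "\<omega> \<notin> B n r j c" using elim r j that by (auto simp: A_def)
          then show ?thesis using 1(2) by (auto simp: B_def s_def p_def)
        qed
        have "Re ?z = (\<Sum>i<2^n-1. b n j 0 i * Y n r i \<omega>)" "- Re ?z = (\<Sum>i<2^n-1. b n j 1 i * Y n r i \<omega>)"
          "Im ?z = (\<Sum>i<2^n-1. b n j 2 i * Y n r i \<omega>)" "- Im ?z = (\<Sum>i<2^n-1. b n j 3 i * Y n r i \<omega>)"
          by (simp_all add: b_def \<theta>_def sum_negf mult.commute)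
        then have "\<bar>Re ?z\<bar> \<le> s" "\<bar>Im ?z\<bar> \<le> s"
          using notB[of 0] notB[of 1] notB[of 2] notB[of 3] by linarith+
        then show ?thesis using cmod_le[of ?z] by linarith
      qed
      have "cmod (\<Sum>i<2^n-1. of_real (Y n r i \<omega>) * cis (real i * \<phi>))
          \<le> 2 * s + 2 * pi * (1 / p) * (real (2^n-1))\<^sup>2 / real (8 ^ n)"
        by (rule trig_poly_sup_le_net[OF _ _ net])
           (auto simp: Y_def p_def intro!: hit_weight_bounds a)
      \<comment> \<open>The net error is at most 2 pi (2^n)^2 / (8^n p) = 2 pi / (2^n p), which
        stays below 9 and hence below \<open>s\<close> once n \<ge> 3. This is what fixes the size
        8^n of the net.\<close>
      also have "2 * pi * (1 / p) * (real (2^n-1))\<^sup>2 / real (8 ^ n) \<le> 2 * pi * (1 / p) * (2 ^ n)\<^sup>2 / real (8 ^ n)"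
        using p by (intro divide_right_mono mult_left_mono power_mono) (auto simp: of_nat_diff)
      also have "\<dots> = 2 * pi / (2 ^ n * p)"
      proof -
        have "real (8 ^ n) = (2 * 2 * 2) ^ n" by simp
        also have "\<dots> = (2 ^ n)\<^sup>2 * 2 ^ n" by (simp only: power_mult_distrib power2_eq_square)
        finally show ?thesis using p by (simp add: field_simps)
      qed
      also have "\<dots> \<le> 9 * 1"
      proof -
        have "2 * pi / (2 ^ n * p) \<le> 2 * pi / 1" using p by (intro divide_left_mono) auto
        then show ?thesis using pi_less_4 by simp
      qed
      also have "\<dots> \<le> s" unfolding s_def
      proof (rule mult_mono)
        have "3\<^sup>2 \<le> (real n)\<^sup>2" using elim by (intro power_mono) auto
        then show "9 \<le> (real n)\<^sup>2" by simp
        have "1 \<le> 2 ^ n / p" using p by (simp add: field_simps) (meson order_trans one_le_power one_le_numeral)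
        then show "1 \<le> sqrt (2 ^ n / p)" by simp
      qed auto
      finally show "cmod (\<Sum>i<2^n-1. of_real (hit_weight a q n (\<lambda>t. X t \<omega>) (r + i * 2 ^ q) - 1) * cis (real i * \<phi>))
          \<le> 3 * (real n)\<^sup>2 * sqrt (2 ^ n / hit_prob a n)"
        by (simp add: Y_def s_def p_def)
    qed
  qed
qed

end

subsection \<open>The tent function as a Fourier multiplier\<close>

definition tent :: "real \<Rightarrow> real" where
  "tent t = max 0 (1 - \<bar>t\<bar>)"

lemma tent_bounds: "0 \<le> tent t" "tent t \<le> 1"
  by (auto simp: tent_def)

lemma tent_eq_0_iff: "tent t = 0 \<longleftrightarrow> 1 \<le> \<bar>t\<bar>"
  by (auto simp: tent_def max_def)

lemma continuous_on_tent [continuous_intros]: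
  "continuous_on S f \<Longrightarrow> continuous_on S (\<lambda>x. tent (f x))"
  unfolding tent_def by (intro continuous_intros)

lemma tent_measurable [measurable]: "tent \<in> borel_measurable borel"
  unfolding tent_def by measurable

lemma tent_Lipschitz: "\<bar>tent x - tent y\<bar> \<le> \<bar>x - y\<bar>"
  unfolding tent_def max_def by (auto simp: abs_if)

lemma sum_tent_int: "\<lfloor>x\<rfloor> = k \<Longrightarrow> tent (x - of_int k) + tent (x - of_int (k + 1)) = 1"
proof -
  assume "\<lfloor>x\<rfloor> = k"
  then have "of_int k \<le> x" "x < of_int k + 1" by linarith+
  then show ?thesis by (auto simp: tent_def max_def)
qed

text \<open>Only the tents centred at floor x and at the next integer can be nonzero at x, and both
  indices lie below n. This partition of unity makes the interpolation of the constant weight 1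
  equal to 1.\<close>

lemma sum_tent:
  assumes "0 \<le> x" "x < real n - 1"
  shows "(\<Sum>k<n. tent (x - real k)) = 1"
proof -
  define k where "k = nat \<lfloor>x\<rfloor>"
  have k: "\<lfloor>x\<rfloor> = int k" using assms by (simp add: k_def)
  have kx: "real k \<le> x" "x < real k + 1" using k by linarith+
  have "(\<Sum>j<n. tent (x - real j)) = (\<Sum>j\<in>{k, Suc k}. tent (x - real j))"
  proof (rule sum.mono_neutral_right)
    show "{k, Suc k} \<subseteq> {..<n}" using assms kx by auto
    show "\<forall>j\<in>{..<n} - {k, Suc k}. tent (x - real j) = 0"
    proof
      fix j assume "j \<in> {..<n} - {k, Suc k}"
      then have "j + 1 \<le> k \<or> k + 2 \<le> j" by auto
      then have "real j + 1 \<le> real k \<or> real k + 2 \<le> real j" by linarith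
      then show "tent (x - real j) = 0" unfolding tent_eq_0_iff using kx by linarith
    qed
  qed auto
  also have "\<dots> = 1" using sum_tent_int[OF k] by (simp add: add.commute)
  finally show ?thesis .
qed

text \<open>Defined on functions because it is applied to signed errors; the sign convention is that
  of \<open>char\<close>, so a measure with density f has \<open>char\<close> equal to
  \<open>ft f\<close>.\<close>

definition ft :: "(real \<Rightarrow> real) \<Rightarrow> real \<Rightarrow> complex" where
  "ft f u = (CLINT t|lborel. iexp (u * t) * of_real (f t))"

lemma ft_integrable:
  assumes "integrable lborel f"
  shows "integrable lborel (\<lambda>t. iexp (u * t) * complex_of_real (f t))"
  by (rule Bochner_Integration.integrable_bound[OF assms])
     (use assms in \<open>auto simp: norm_mult\<close>)

lemma ft_norm_le:
  assumes "integrable lborel f"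
  shows "cmod (ft f u) \<le> (LINT t|lborel. \<bar>f t\<bar>)"
proof -
  have "cmod (ft f u) \<le> (LINT t|lborel. cmod (iexp (u * t) * complex_of_real (f t)))"
    unfolding ft_def by (rule integral_norm_bound)
  then show ?thesis by (simp add: norm_mult)
qed

lemma ft_add:
  assumes "integrable lborel f" "integrable lborel g"
  shows "ft (\<lambda>t. f t + g t) u = ft f u + ft g u"
  unfolding ft_def of_real_add ring_distribs
  by (rule Bochner_Integration.integral_add; intro ft_integrable assms)

lemma ft_sum:
  assumes "\<And>i. i \<in> I \<Longrightarrow> integrable lborel (f i)"
  shows "ft (\<lambda>t. \<Sum>i\<in>I. f i t) u = (\<Sum>i\<in>I. ft (f i) u)"
  unfolding ft_def of_real_sum sum_distrib_left
  by (rule Bochner_Integration.integral_sum; intro ft_integrable assms)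

lemma ft_cmult: "ft (\<lambda>t. c * f t) u = of_real c * ft f u"
  unfolding ft_def by (simp flip: integral_mult_right_zero add: mult.left_commute)

lemma ft_0: "ft f 0 = of_real (LINT t|lborel. f t)"
  unfolding ft_def by simp

lemma ft_affine:
  assumes "0 < b"
  shows "ft (\<lambda>t. f (b * t - d)) u = of_real (1 / b) * iexp (u * d / b) * ft f (u / b)"
proof -
  have "ft (\<lambda>t. f (b * t - d)) u = \<bar>1/b\<bar> *\<^sub>R (CLINT t|lborel. iexp (u * (d / b + (1/b) * t)) * of_real (f (b * (d / b + (1/b) * t) - d)))"
    unfolding ft_def using assms by (subst lborel_integral_real_affine[where c = "1/b" and t = "d/b"]) auto
  also have "(\<lambda>t. iexp (u * (d / b + (1/b) * t)) * complex_of_real (f (b * (d / b + (1/b) * t) - d)))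
      = (\<lambda>t. iexp (u * d / b) * (iexp (u / b * t) * complex_of_real (f t)))"
  proof
    fix t
    have "u * (d / b + (1/b) * t) = u * d / b + u / b * t" "b * (d / b + (1/b) * t) - d = t"
      using assms by (simp_all add: field_simps)
    then show "iexp (u * (d / b + (1/b) * t)) * complex_of_real (f (b * (d / b + (1/b) * t) - d))
        = iexp (u * d / b) * (iexp (u / b * t) * complex_of_real (f t))"
      by (simp only: of_real_add distrib_left exp_add mult.assoc)
  qed
  finally show ?thesis using assms by (simp add: ft_def scaleR_conv_of_real)
qed

lemma tent_le_indicator: "tent t \<le> indicator {-1..1} t"
  by (auto simp: tent_def indicator_def)

lemma integrable_tent: "integrable lborel tent"
  by (rule Bochner_Integration.integrable_bound[of _ "indicator {-1..1}"])
     (use tent_le_indicator tent_bounds in \<open>auto simp: integrable_indicator_iff\<close>)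

text \<open>Half a period of translation flips the sign of the exponential, so the transform is
  controlled by the \<open>L\<^sup>1\<close> modulus of continuity.\<close>

lemma ft_tent_le: "cmod (ft tent u) \<le> 10 / (1 + \<bar>u\<bar>)"
proof (cases "\<bar>u\<bar> \<le> 4")
  case True
  have "cmod (ft tent u) \<le> (LINT t|lborel. \<bar>tent t\<bar>)" by (rule ft_norm_le[OF integrable_tent])
  also have "\<dots> \<le> (LINT t|lborel. indicator {-1..1::real} t)"
    using tent_le_indicator tent_bounds integrable_tent
    by (intro integral_mono) (auto simp: integrable_indicator_iff)
  also have "\<dots> = 2" by simp
  also have "\<dots> \<le> 10 / (1 + \<bar>u\<bar>)" using True by (simp add: field_simps)
  finally show ?thesis .
next
  case False
  define \<delta> where "\<delta> = pi / u"
  have d1: "\<bar>\<delta>\<bar> \<le> 1" using False pi_less_4 by (simp add: \<delta>_def field_simps)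
  have ud: "u * \<delta> = pi" using False by (auto simp: \<delta>_def)
  have int': "integrable lborel (\<lambda>t. tent (1 * t - (-\<delta>)))"
    using lborel_integrable_real_affine[OF integrable_tent, of 1 \<delta>] by (simp add: add.commute)
  have "ft (\<lambda>t. tent (1 * t - (-\<delta>))) u = - ft tent u"
    using ud by (subst ft_affine) (auto simp: exp_minus)
  then have "ft (\<lambda>t. tent t + (-1) * tent (1 * t - (-\<delta>))) u = 2 * ft tent u"
    using int' integrable_tent by (subst ft_add) (auto simp: ft_cmult[of "-1", simplified])
  then have "2 * cmod (ft tent u) = cmod (ft (\<lambda>t. tent t + (-1) * tent (1 * t - (-\<delta>))) u)"
    by (simp add: norm_mult)
  also have "\<dots> \<le> (LINT t|lborel. \<bar>tent t + (-1) * tent (1 * t - (-\<delta>))\<bar>)"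
    using int' integrable_tent by (intro ft_norm_le) auto
  also have "\<dots> \<le> (LINT t|lborel. \<bar>\<delta>\<bar> * indicator {-2..2::real} t)"
  proof (rule integral_mono)
    fix t
    show "\<bar>tent t + (-1) * tent (1 * t - (-\<delta>))\<bar> \<le> \<bar>\<delta>\<bar> * indicator {-2..2} t"
    proof (cases "t \<in> {-2..2}")
      case True
      then show ?thesis using tent_Lipschitz[of t "t + \<delta>"] by simp
    next
      case False
      then have "tent t = 0" "tent (t + \<delta>) = 0" unfolding tent_eq_0_iff using d1 by auto
      then show ?thesis by simp
    qed
  qed (use int' integrable_tent in \<open>auto simp: integrable_indicator_iff\<close>)
  also have "\<dots> = 4 * \<bar>\<delta>\<bar>" by simp
  finally have "cmod (ft tent u) \<le> 2 * \<bar>\<delta>\<bar>" by simp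
  also have "\<dots> = 2 * pi / \<bar>u\<bar>" by (simp add: \<delta>_def)
  also have "\<dots> \<le> 8 / \<bar>u\<bar>" using pi_less_4 by (intro divide_right_mono) auto
  also have "\<dots> \<le> 10 / (1 + \<bar>u\<bar>)" using False by (simp add: field_simps)
  finally show ?thesis .
qed

section \<open>The Fejer kernel, whose Fourier transform is a multiple of the tent\<close>

definition fejer :: "real \<Rightarrow> real" where
  "fejer v = (1 - cos v) / v\<^sup>2"

lemma fejer_measurable [measurable]: "fejer \<in> borel_measurable borel"
  unfolding fejer_def by measurable

lemma fejer_nonneg: "0 \<le> fejer v"
  by (simp add: fejer_def)

lemma fejer_even: "fejer (- v) = fejer v"
  by (simp add: fejer_def)

lemma fejer_le: "fejer v * (1 + \<bar>v\<bar>)\<^sup>2 \<le> 8"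
proof -
  have "1 - cos v = 2 * (sin (v / 2))\<^sup>2" using cos_double_sin[of "v / 2"] by simp
  also have "\<dots> \<le> 2 * (v / 2)\<^sup>2"
    using abs_sin_x_le_abs_x[of "v / 2"] unfolding abs_le_square_iff by simp
  finally have c2: "1 - cos v \<le> v\<^sup>2 / 2" by (simp add: power_divide)
  have "(1 + \<bar>v\<bar>)\<^sup>2 \<le> 2 + 2 * v\<^sup>2"
    using zero_le_power2[of "1 - \<bar>v\<bar>"] by (simp add: power2_eq_square algebra_simps)
  then have "fejer v * (1 + \<bar>v\<bar>)\<^sup>2 \<le> fejer v * (2 + 2 * v\<^sup>2)"
    by (intro mult_left_mono fejer_nonneg)
  also have "\<dots> \<le> 8"
  \<comment> \<open>At v = 0 the convention x / 0 = 0 gives \<open>fejer\<close> the value 0 instead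
    of its limit 1/2; a single point does not affect the integrals below.\<close>
  proof (cases "v = 0")
    case False
    then have eq: "fejer v * (2 + 2 * v\<^sup>2) = 2 * (1 - cos v) / v\<^sup>2 + 2 * (1 - cos v)"
      by (simp add: fejer_def field_simps)
    have "2 * (1 - cos v) / v\<^sup>2 \<le> 1" using c2 False by (simp add: divide_le_eq)
    moreover have "2 * (1 - cos v) \<le> 7"
    proof -
      have "2 * (1 - x) \<le> 7" if "- 1 \<le> x" for x :: real using that by simp
      then show ?thesis using cos_ge_minus_one .
    qed
    ultimately have "fejer v * (2 + 2 * v\<^sup>2) \<le> 1 + 7" unfolding eq by (rule add_mono)
    then show ?thesis by simp
  qed (simp add: fejer_def)
  finally show ?thesis .
qed

text \<open>The exponent is 1/2 - 2: the Fejer kernel decays like |v|^-2 and is integrated against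
  weights growing at most like |v|^(1/2). The half line has the primitive -2 (1 + v)^(-1/2), and
  evenness gives the rest.\<close>

lemma integrable_three_halves:
  "integrable lborel (\<lambda>v::real. (1 + \<bar>v\<bar>) powr (- (3/2)))"
proof -
  let ?f = "\<lambda>v::real. (1 + \<bar>v\<bar>) powr (- (3/2))"
  have "(\<integral>\<^sup>+v. ennreal (?f v) * indicator {0..} v \<partial>lborel) = ennreal (0 - (- 2 * (1 + 0) powr (- (1/2))))"
  proof (rule nn_integral_FTC_atLeast[where F = "\<lambda>v. - 2 * (1 + v) powr (- (1/2))"])
    fix x :: real assume x: "0 \<le> x"
    have "((\<lambda>v. - 2 * (1 + v) powr (- (1/2))) has_real_derivative (1 + x) powr (- (3/2))) (at x)"
      using x by (auto intro!: derivative_eq_intros)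
    then show "DERIV (\<lambda>v. - 2 * (1 + v) powr (- (1/2))) x :> ?f x" using x by simp
  next
    show "((\<lambda>v::real. - 2 * (1 + v) powr (- (1/2))) \<longlongrightarrow> 0) at_top" by real_asymp
  qed auto
  also have "(\<integral>\<^sup>+v. ennreal (?f v) * indicator {0..} v \<partial>lborel) = (\<integral>\<^sup>+v. ennreal (indicator {0..} v *\<^sub>R ?f v) \<partial>lborel)"
    by (intro nn_integral_cong) (auto simp: indicator_def)
  finally have "has_bochner_integral lborel (\<lambda>v. indicator {0..} v *\<^sub>R ?f v) 2"
    by (intro has_bochner_integral_nn_integral) auto
  then have "has_bochner_integral lborel ?f (2 *\<^sub>R 2)"
    by (rule has_bochner_integral_even_function) auto
  then show ?thesis by (auto simp: has_bochner_integral_iff)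
qed

lemma one_plus_abs_mult_le: "1 + \<bar>x * y\<bar> \<le> (1 + \<bar>x\<bar>) * (1 + \<bar>y :: real\<bar>)"
  by (simp add: abs_mult algebra_simps)

text \<open>Peetre's inequality: it transfers decay at u + b v to decay at u, at the cost of a power
  of 1 + |b v|.\<close>

lemma one_plus_abs_add_le: "1 + \<bar>x + y\<bar> \<le> (1 + \<bar>x\<bar>) * (1 + \<bar>y :: real\<bar>)"
proof -
  have "(1 + \<bar>x\<bar>) * (1 + \<bar>y\<bar>) = 1 + \<bar>x\<bar> + \<bar>y\<bar> + \<bar>x\<bar> * \<bar>y\<bar>" by (simp add: algebra_simps)
  moreover have "0 \<le> \<bar>x\<bar> * \<bar>y\<bar>" by simp
  ultimately show ?thesis using abs_triangle_ineq[of x y] by linarith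
qed

lemma fejer_weight_integrable:
  assumes "0 \<le> \<beta>" "\<beta> \<le> 1/2"
  shows "integrable lborel (\<lambda>v. (1 + \<bar>b * v\<bar>) powr \<beta> * fejer v)"
proof (rule Bochner_Integration.integrable_bound)
  show "integrable lborel (\<lambda>v::real. 8 * (1 + \<bar>b\<bar>) powr \<beta> * (1 + \<bar>v\<bar>) powr (- (3/2)))"
    using integrable_three_halves by simp
  show "AE v in lborel. norm ((1 + \<bar>b * v\<bar>) powr \<beta> * fejer v) \<le> norm (8 * (1 + \<bar>b\<bar>) powr \<beta> * (1 + \<bar>v\<bar>) powr (- (3/2)))"
  proof (rule AE_I2)
    fix v :: real
    have "fejer v \<le> 8 * (1 + \<bar>v\<bar>) powr (- 2)"
      using fejer_le[of v] by (simp add: powr_minus powr_numeral field_simps)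
    moreover have "(1 + \<bar>b * v\<bar>) powr \<beta> \<le> ((1 + \<bar>b\<bar>) * (1 + \<bar>v\<bar>)) powr \<beta>"
      using assms one_plus_abs_mult_le[of b v] by (intro powr_mono2) auto
    moreover have "((1 + \<bar>b\<bar>) * (1 + \<bar>v\<bar>)) powr \<beta> \<le> (1 + \<bar>b\<bar>) powr \<beta> * (1 + \<bar>v\<bar>) powr (1/2)"
      using assms by (subst powr_mult) (auto intro!: mult_left_mono powr_mono)
    ultimately have "(1 + \<bar>b * v\<bar>) powr \<beta> * fejer v
        \<le> ((1 + \<bar>b\<bar>) powr \<beta> * (1 + \<bar>v\<bar>) powr (1/2)) * (8 * (1 + \<bar>v\<bar>) powr (- 2))"
      using fejer_nonneg by (intro mult_mono) auto
    also have "\<dots> = 8 * (1 + \<bar>b\<bar>) powr \<beta> * ((1 + \<bar>v\<bar>) powr (1/2) * (1 + \<bar>v\<bar>) powr (- 2))"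
      by (simp only: mult_ac)
    also have "(1 + \<bar>v\<bar>) powr (1/2) * (1 + \<bar>v\<bar>) powr (- 2) = (1 + \<bar>v\<bar>) powr (- (3/2))"
      by (subst powr_add[symmetric]) simp
    finally show "norm ((1 + \<bar>b * v\<bar>) powr \<beta> * fejer v) \<le> norm (8 * (1 + \<bar>b\<bar>) powr \<beta> * (1 + \<bar>v\<bar>) powr (- (3/2)))"
      using fejer_nonneg[of v] by (simp add: abs_mult)
  qed
qed auto

lemma fejer_integrable: "integrable lborel fejer"
  using fejer_weight_integrable[of 0 0] by simp

definition fejer_mass :: real where
  "fejer_mass = (LINT v|lborel. fejer v)"

lemma fejer_mass_pos: "0 < fejer_mass"
proof -
  have c1: "cos 1 < (1::real)" using cos_monotone_0_pi[of 0 1] pi_gt3 by simp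
  have "(1 - cos 1) / (4::real) = (LINT v|lborel. (1 - cos 1) / 4 * indicator {1..2::real} v)"
    by simp
  also have "\<dots> \<le> fejer_mass" unfolding fejer_mass_def
  proof (rule integral_mono)
    fix v :: real
    show "(1 - cos 1) / 4 * indicator {1..2} v \<le> fejer v"
    proof (cases "v \<in> {1..2}")
      case True
      have "cos v \<le> cos 1" using True pi_gt3 by (intro cos_monotone_0_pi_le) auto
      moreover have "v\<^sup>2 \<le> 2\<^sup>2" using True by (intro power_mono) auto
      ultimately have "(1 - cos 1) / 4 \<le> (1 - cos v) / v\<^sup>2"
        using True c1 by (intro frac_le) auto
      then show ?thesis using True by (simp add: fejer_def)
    qed (simp add: fejer_nonneg)
  qed (use fejer_integrable in \<open>auto simp: integrable_indicator_iff\<close>)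
  finally show ?thesis using c1 by simp
qed

text \<open>By scaling, the integral is a fixed multiple of \<open>\<bar>a\<bar>\<close>; the value of the
  constant never matters.\<close>

lemma one_minus_cos_scaled:
  "has_bochner_integral lborel (\<lambda>v. (1 - cos (a * v)) / v\<^sup>2) (fejer_mass * \<bar>a\<bar>)"
proof (cases "a = 0")
  case False
  have eq: "(1 - cos (a * v)) / v\<^sup>2 = a\<^sup>2 * fejer (0 + a * v)" for v
    using False by (simp add: fejer_def power_mult_distrib)
  have i: "integrable lborel (\<lambda>v. a\<^sup>2 * fejer (0 + a * v))"
    using lborel_integrable_real_affine[OF fejer_integrable False, of 0] by simp
  have "fejer_mass = \<bar>a\<bar> *\<^sub>R (LINT v|lborel. fejer (0 + a * v))"
    unfolding fejer_mass_def using False by (rule lborel_integral_real_affine)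
  then have "fejer_mass * \<bar>a\<bar> = (\<bar>a\<bar> * \<bar>a\<bar>) * (LINT v|lborel. fejer (0 + a * v))"
    by (simp only: real_scaleR_def mult_ac)
  then have "(LINT v|lborel. a\<^sup>2 * fejer (0 + a * v)) = fejer_mass * \<bar>a\<bar>"
    by (simp add: power2_eq_square)
  then show ?thesis unfolding eq using i by (simp add: has_bochner_integral_iff)
qed auto

text \<open>The tent is the second difference (|t + 1| + |t - 1|) / 2 - |t|, and
  \<open>one_minus_cos_scaled\<close> turns each absolute value into an integral. Under the integral
  sign the same second difference yields cos (t v) * (1 - cos v), since cos ((t + 1) v) + cos ((t -
  1) v) = 2 cos (t v) cos v.\<close>

lemma cos_fejer_integral:
  "has_bochner_integral lborel (\<lambda>v. cos (t * v) * fejer v) (fejer_mass * tent t)"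
proof -
  have "has_bochner_integral lborel (\<lambda>v. (1/2) * ((1 - cos ((t + 1) * v)) / v\<^sup>2) + (1/2) * ((1 - cos ((t - 1) * v)) / v\<^sup>2)
     - (1 - cos (t * v)) / v\<^sup>2) ((1/2) * (fejer_mass * \<bar>t + 1\<bar>) + (1/2) * (fejer_mass * \<bar>t - 1\<bar>) - fejer_mass * \<bar>t\<bar>)"
    by (intro has_bochner_integral_diff has_bochner_integral_add has_bochner_integral_mult_right one_minus_cos_scaled)
  moreover have "(1/2) * ((1 - cos ((t + 1) * v)) / v\<^sup>2) + (1/2) * ((1 - cos ((t - 1) * v)) / v\<^sup>2) - (1 - cos (t * v)) / v\<^sup>2
     = cos (t * v) * fejer v" for v
  proof -
    have "cos ((t + 1) * v) + cos ((t - 1) * v) = 2 * cos (t * v) * cos v"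
      by (simp add: ring_distribs cos_add cos_diff)
    moreover have "(1/2) * ((1 - A) / w) + (1/2) * ((1 - B) / w) - (1 - c) / w = c * ((1 - k) / w)"
      if "A + B = 2 * c * k" for A B c k w :: real
    proof -
      have "(1/2) * ((1 - A) / w) + (1/2) * ((1 - B) / w) - (1 - c) / w = (2 * c - (A + B)) / (2 * w)"
        by (cases "w = 0") (simp_all add: field_simps)
      then show ?thesis unfolding that by (cases "w = 0") (simp_all add: field_simps)
    qed
    ultimately show ?thesis unfolding fejer_def by blast
  qed
  moreover have "(1/2) * (fejer_mass * \<bar>t + 1\<bar>) + (1/2) * (fejer_mass * \<bar>t - 1\<bar>) - fejer_mass * \<bar>t\<bar> = fejer_mass * tent t"
  proof -
    have "tent t = (1/2) * \<bar>t + 1\<bar> + (1/2) * \<bar>t - 1\<bar> - \<bar>t\<bar>" by (simp add: tent_def max_def abs_if field_simps)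
    then show ?thesis by (simp only: ring_distribs mult_ac)
  qed
  ultimately show ?thesis by simp
qed

lemma sin_fejer_integral: "(LINT v|lborel. sin (t * v) * fejer v) = 0"
proof -
  have "(LINT v|lborel. sin (t * v) * fejer v) = \<bar>-1\<bar> *\<^sub>R (LINT v|lborel. sin (t * (0 + (-1) * v)) * fejer (0 + (-1) * v))"
    by (rule lborel_integral_real_affine) simp
  then show ?thesis by (simp add: fejer_even)
qed

definition fejer_distr :: "real measure" where
  "fejer_distr = density lborel (\<lambda>v. ennreal (fejer v / fejer_mass))"

lemma real_distribution_fejer: "real_distribution fejer_distr"
proof -
  have "emeasure fejer_distr UNIV = (\<integral>\<^sup>+v. ennreal (fejer v / fejer_mass) \<partial>lborel)"
    by (simp add: fejer_distr_def emeasure_density)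
  also have "\<dots> = ennreal (LINT v|lborel. fejer v / fejer_mass)"
    using fejer_integrable fejer_nonneg fejer_mass_pos by (intro nn_integral_eq_integral) auto
  also have "\<dots> = 1" using fejer_mass_pos by (simp add: fejer_mass_def)
  finally have "prob_space fejer_distr" by (intro prob_spaceI) (simp add: fejer_distr_def)
  then show ?thesis unfolding real_distribution_def real_distribution_axioms_def by (simp add: fejer_distr_def)
qed

text \<open>Exhibits the tent as a characteristic function, so that multiplying by a tent amounts to
  averaging modulations over a probability law. The imaginary part vanishes because the kernel is
  even.\<close>

lemma char_fejer: "char fejer_distr t = of_real (tent t)"
proof -
  have ii: "integrable lborel (\<lambda>v. (fejer v / fejer_mass) *\<^sub>R iexp (t * v))"
    by (rule Bochner_Integration.integrable_bound[of _ "\<lambda>v. fejer v / fejer_mass"])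
       (use fejer_integrable in \<open>auto simp: norm_mult\<close>)
  have "char fejer_distr t = (CLINT v|lborel. (fejer v / fejer_mass) *\<^sub>R iexp (t * v))"
    unfolding char_def fejer_distr_def using fejer_nonneg fejer_mass_pos
    by (intro integral_density) auto
  moreover have "Re (CLINT v|lborel. (fejer v / fejer_mass) *\<^sub>R iexp (t * v)) = tent t"
  proof -
    have "Re (CLINT v|lborel. (fejer v / fejer_mass) *\<^sub>R iexp (t * v)) = (LINT v|lborel. (cos (t * v) * fejer v) / fejer_mass)"
      using ii by (subst integral_Re[symmetric]) (auto simp: Re_exp mult.commute)
    then show ?thesis using cos_fejer_integral[of t] fejer_mass_pos by (simp add: has_bochner_integral_iff)
  qed
  moreover have "Im (CLINT v|lborel. (fejer v / fejer_mass) *\<^sub>R iexp (t * v)) = 0"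
  proof -
    have "Im (CLINT v|lborel. (fejer v / fejer_mass) *\<^sub>R iexp (t * v)) = (LINT v|lborel. (sin (t * v) * fejer v) / fejer_mass)"
      using ii by (subst integral_Im[symmetric]) (auto simp: Im_exp mult.commute)
    then show ?thesis using sin_fejer_integral[of t] by simp
  qed
  ultimately show ?thesis by (simp add: complex_eq_iff)
qed

section \<open>Classes of Fourier decay and their multipliers\<close>

definition fourier_bounded :: "real \<Rightarrow> real \<Rightarrow> (real \<Rightarrow> real) \<Rightarrow> bool" where
  "fourier_bounded \<beta> \<epsilon> f \<longleftrightarrow> integrable lborel f \<and> (\<forall>u. cmod (ft f u) \<le> \<epsilon> * (1 + \<bar>u\<bar>) powr (- \<beta>))"

text \<open>The constant depends on f and \<beta> alone and is uniform in D: it is known before the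
  error at the next scale has to be made small.\<close>

definition fourier_multiplier :: "real \<Rightarrow> (real \<Rightarrow> real) \<Rightarrow> bool" where
  "fourier_multiplier \<beta> f \<longleftrightarrow>
    (\<exists>C\<ge>0. \<forall>D \<epsilon>. fourier_bounded \<beta> \<epsilon> D \<longrightarrow> fourier_bounded \<beta> (C * \<epsilon>) (\<lambda>t. f t * D t))"

lemma fourier_bounded_add:
  assumes "fourier_bounded \<beta> \<epsilon> f" "fourier_bounded \<beta> \<delta> g"
  shows "fourier_bounded \<beta> (\<epsilon> + \<delta>) (\<lambda>t. f t + g t)"
  unfolding fourier_bounded_def
proof (intro conjI allI)
  show "integrable lborel (\<lambda>t. f t + g t)" using assms by (simp add: fourier_bounded_def)
  fix u
  have "cmod (ft (\<lambda>t. f t + g t) u) \<le> cmod (ft f u) + cmod (ft g u)"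
    using assms by (subst ft_add) (auto simp: fourier_bounded_def intro: norm_triangle_ineq)
  also have "\<dots> \<le> \<epsilon> * (1 + \<bar>u\<bar>) powr (- \<beta>) + \<delta> * (1 + \<bar>u\<bar>) powr (- \<beta>)"
    using assms by (intro add_mono) (auto simp: fourier_bounded_def)
  finally show "cmod (ft (\<lambda>t. f t + g t) u) \<le> (\<epsilon> + \<delta>) * (1 + \<bar>u\<bar>) powr (- \<beta>)"
    by (simp add: ring_distribs)
qed

lemma fourier_bounded_cmult:
  "fourier_bounded \<beta> \<epsilon> f \<Longrightarrow> fourier_bounded \<beta> (\<bar>c\<bar> * \<epsilon>) (\<lambda>t. c * f t)"
  by (auto simp: fourier_bounded_def ft_cmult norm_mult mult.assoc intro!: mult_left_mono)

lemma fourier_multiplier_mult: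
  assumes "fourier_multiplier \<beta> f" "fourier_multiplier \<beta> g"
  shows "fourier_multiplier \<beta> (\<lambda>t. f t * g t)"
proof -
  obtain C where C: "0 \<le> C" "\<forall>D \<epsilon>. fourier_bounded \<beta> \<epsilon> D \<longrightarrow> fourier_bounded \<beta> (C * \<epsilon>) (\<lambda>t. f t * D t)"
    using assms(1) unfolding fourier_multiplier_def by auto
  obtain B where B: "0 \<le> B" "\<forall>D \<epsilon>. fourier_bounded \<beta> \<epsilon> D \<longrightarrow> fourier_bounded \<beta> (B * \<epsilon>) (\<lambda>t. g t * D t)"
    using assms(2) unfolding fourier_multiplier_def by auto
  have "fourier_bounded \<beta> (C * B * \<epsilon>) (\<lambda>t. f t * g t * D t)" if "fourier_bounded \<beta> \<epsilon> D" for D \<epsilon>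
    using C(2)[rule_format, OF B(2)[rule_format, OF that]] by (simp add: mult.assoc)
  then show ?thesis unfolding fourier_multiplier_def
    using B(1) C(1) by (intro exI[of _ "C * B"]) auto
qed

lemma fourier_multiplier_const: "fourier_multiplier \<beta> (\<lambda>_. c)"
  unfolding fourier_multiplier_def by (intro exI[of _ "\<bar>c\<bar>"]) (auto intro: fourier_bounded_cmult)

lemma fourier_multiplier_add:
  assumes "fourier_multiplier \<beta> f" "fourier_multiplier \<beta> g"
  shows "fourier_multiplier \<beta> (\<lambda>t. f t + g t)"
proof -
  obtain C where C: "0 \<le> C" "\<forall>D \<epsilon>. fourier_bounded \<beta> \<epsilon> D \<longrightarrow> fourier_bounded \<beta> (C * \<epsilon>) (\<lambda>t. f t * D t)"
    using assms(1) unfolding fourier_multiplier_def by auto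
  obtain B where B: "0 \<le> B" "\<forall>D \<epsilon>. fourier_bounded \<beta> \<epsilon> D \<longrightarrow> fourier_bounded \<beta> (B * \<epsilon>) (\<lambda>t. g t * D t)"
    using assms(2) unfolding fourier_multiplier_def by auto
  have "fourier_bounded \<beta> ((C + B) * \<epsilon>) (\<lambda>t. (f t + g t) * D t)" if "fourier_bounded \<beta> \<epsilon> D" for D \<epsilon>
    unfolding ring_distribs using that by (intro fourier_bounded_add B(2)[rule_format] C(2)[rule_format])
  then show ?thesis unfolding fourier_multiplier_def
    using B(1) C(1) by (intro exI[of _ "C + B"]) auto
qed

lemma fourier_multiplier_sum:
  assumes "finite I" "\<And>i. i \<in> I \<Longrightarrow> fourier_multiplier \<beta> (f i)"
  shows "fourier_multiplier \<beta> (\<lambda>t. \<Sum>i\<in>I. f i t)"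
  using assms by (induction rule: finite_induct) (auto intro: fourier_multiplier_const fourier_multiplier_add)

text \<open>By \<open>char_fejer\<close>, tent (b t + d) averages iexp ((b t + d) v) over the Fejer
  law, and each such modulation shifts the transform of D by b v. Peetre's inequality bounds the
  shifted decay by (1 + |b v|)^\<beta> times the decay at u, and this weight has finite mean as long
  as \<beta> \<le> 1/2.\<close>

lemma fourier_multiplier_tent:
  assumes \<beta>: "0 \<le> \<beta>" "\<beta> \<le> 1/2"
  shows "fourier_multiplier \<beta> (\<lambda>t. tent (b * t + d))"
proof -
  interpret G: real_distribution fejer_distr by (rule real_distribution_fejer)
  interpret P: pair_sigma_finite lborel fejer_distr ..
  define C where "C = (LINT v|fejer_distr. (1 + \<bar>b * v\<bar>) powr \<beta>)"
  have Cint: "integrable fejer_distr (\<lambda>v. (1 + \<bar>b * v\<bar>) powr \<beta>)"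
    unfolding fejer_distr_def using fejer_weight_integrable[OF \<beta>, of b] fejer_nonneg fejer_mass_pos
    by (subst integrable_density) (auto simp: mult.commute)
  have [measurable_cong]: "sets fejer_distr = sets borel" by simp
  show ?thesis unfolding fourier_multiplier_def fourier_bounded_def
  proof (intro exI[of _ C] conjI allI impI; (elim conjE)?)
    show "0 \<le> C" unfolding C_def by (intro Bochner_Integration.integral_nonneg) auto
    fix D \<epsilon> assume D: "integrable lborel D" and bd: "\<forall>u. cmod (ft D u) \<le> \<epsilon> * (1 + \<bar>u\<bar>) powr (- \<beta>)"
    have Dm[measurable]: "D \<in> borel_measurable borel" using borel_measurable_integrable[OF D] by simp
    show "integrable lborel (\<lambda>t. tent (b * t + d) * D t)"
      by (rule Bochner_Integration.integrable_bound[OF D])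
         (use tent_bounds in \<open>auto simp: abs_mult mult_left_le_one_le\<close>)
    fix u
    have e0: "0 \<le> \<epsilon>" using order_trans[OF norm_ge_zero bd[rule_format, of 0]] by simp
    \<comment> \<open>Integrating over v first produces the product with the tent, integrating over
      t first produces the shifted transform of D; Fubini equates the two.\<close>
    define F where "F t v = iexp (u * t) * complex_of_real (D t) * iexp ((b * t + d) * v)" for t v
    have F_eq: "F t v = iexp (d * v) * (iexp ((u + b * v) * t) * complex_of_real (D t))" for t v
    proof -
      have "u * t + (b * t + d) * v = d * v + (u + b * v) * t" by (simp add: algebra_simps)
      then have "iexp (u * t) * iexp ((b * t + d) * v) = iexp (d * v) * iexp ((u + b * v) * t)"
        by (simp only: exp_add[symmetric] distrib_left[symmetric] of_real_add[symmetric])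
      moreover have "F t v = (iexp (u * t) * iexp ((b * t + d) * v)) * complex_of_real (D t)"
        unfolding F_def by (simp only: mult_ac)
      ultimately show ?thesis by (simp only: mult.assoc)
    qed
    have Fm[measurable]: "(\<lambda>(t, v). F t v) \<in> borel_measurable (lborel \<Otimes>\<^sub>M fejer_distr)"
      unfolding F_def by measurable
    have Fn: "norm (F t v) = \<bar>D t\<bar>" for t v unfolding F_def by (simp add: norm_mult)
    have Fint: "integrable (lborel \<Otimes>\<^sub>M fejer_distr) (\<lambda>(t, v). F t v)"
    proof (rule P.Fubini_integrable)
      show "integrable lborel (\<lambda>t. LINT v|fejer_distr. norm (case (t, v) of (t, v) \<Rightarrow> F t v))"
        using D by (simp add: Fn G.prob_space[simplified])
      show "AE t in lborel. integrable fejer_distr (\<lambda>v. case (t, v) of (t, v) \<Rightarrow> F t v)"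
      proof (rule AE_I2)
        fix t show "integrable fejer_distr (\<lambda>v. case (t, v) of (t, v) \<Rightarrow> F t v)"
        proof (rule G.integrable_const_bound[where B = "\<bar>D t\<bar>"])
          show "(\<lambda>v. case (t, v) of (t, v) \<Rightarrow> F t v) \<in> borel_measurable fejer_distr"
            unfolding F_def prod.case by (subst measurable_cong_sets[OF G.events_eq_borel refl]) measurable
        qed (simp add: Fn)
      qed
    qed measurable
    have "ft (\<lambda>t. tent (b * t + d) * D t) u = (CLINT t|lborel. CLINT v|fejer_distr. F t v)"
    proof -
      have "iexp (u * t) * complex_of_real (tent (b * t + d) * D t) = (CLINT v|fejer_distr. F t v)" for t
        unfolding F_def of_real_mult char_fejer[symmetric] char_def
        by (simp flip: integral_mult_right_zero integral_mult_left_zero add: mult_ac)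
      then show ?thesis unfolding ft_def by simp
    qed
    also have "\<dots> = (CLINT v|fejer_distr. CLINT t|lborel. F t v)"
      using P.Fubini_integral[OF Fint] by simp
    also have "\<dots> = (CLINT v|fejer_distr. iexp (d * v) * ft D (u + b * v))"
      unfolding F_eq ft_def by (intro Bochner_Integration.integral_cong refl integral_mult_right_zero)
    finally have eq: "ft (\<lambda>t. tent (b * t + d) * D t) u = (CLINT v|fejer_distr. iexp (d * v) * ft D (u + b * v))" .
    have pt: "norm (iexp (d * v) * ft D (u + b * v)) \<le> \<epsilon> * (1 + \<bar>u\<bar>) powr (- \<beta>) * (1 + \<bar>b * v\<bar>) powr \<beta>" for v
    proof -
      have "norm (iexp (d * v) * ft D (u + b * v)) \<le> \<epsilon> * (1 + \<bar>u + b * v\<bar>) powr (- \<beta>)"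
        using bd[rule_format, of "u + b * v"] by (simp add: norm_mult)
      also have "\<dots> \<le> \<epsilon> * ((1 + \<bar>u\<bar>) powr (- \<beta>) * (1 + \<bar>b * v\<bar>) powr \<beta>)"
      proof (rule mult_left_mono[OF _ e0])
        have "(1 + \<bar>u\<bar>) powr \<beta> \<le> ((1 + \<bar>u + b * v\<bar>) * (1 + \<bar>b * v\<bar>)) powr \<beta>"
          using one_plus_abs_add_le[of "u + b * v" "- b * v"] \<beta> by (intro powr_mono2) auto
        then show "(1 + \<bar>u + b * v\<bar>) powr (- \<beta>) \<le> (1 + \<bar>u\<bar>) powr (- \<beta>) * (1 + \<bar>b * v\<bar>) powr \<beta>"
          by (subst (asm) powr_mult) (simp_all add: powr_minus field_simps)
      qed
      finally show ?thesis by (simp add: mult.assoc)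
    qed
    have "cmod (ft (\<lambda>t. tent (b * t + d) * D t) u) \<le> (LINT v|fejer_distr. \<epsilon> * (1 + \<bar>u\<bar>) powr (- \<beta>) * (1 + \<bar>b * v\<bar>) powr \<beta>)"
      unfolding eq
    proof (rule Bochner_Integration.integral_norm_bound_integral)
      show "integrable fejer_distr (\<lambda>v. iexp (d * v) * ft D (u + b * v))"
        using P.integrable_snd[OF Fint] unfolding F_eq integral_mult_right_zero ft_def[symmetric] .
      show "integrable fejer_distr (\<lambda>v. \<epsilon> * (1 + \<bar>u\<bar>) powr (- \<beta>) * (1 + \<bar>b * v\<bar>) powr \<beta>)"
        using Cint by simp
    qed (use pt in auto)
    also have "\<dots> = C * \<epsilon> * (1 + \<bar>u\<bar>) powr (- \<beta>)" by (simp add: C_def)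
    finally show "cmod (ft (\<lambda>t. tent (b * t + d) * D t) u) \<le> C * \<epsilon> * (1 + \<bar>u\<bar>) powr (- \<beta>)" .
  qed
qed

subsection \<open>The limit measure\<close>

text \<open>The decay |u|^-1 of the rescaled tent sets in only at frequency b. Since 1 + |u| \<le> b
  (1 + |u / b|), weakening it to exponent \<beta> makes it hold from frequency 1 on, at the price
  b^\<beta>.\<close>

lemma ft_tent_scaled_le:
  assumes "1 \<le> b" "0 \<le> \<beta>" "\<beta> \<le> 1"
  shows "cmod (ft tent (u / b)) \<le> 10 * b powr \<beta> * (1 + \<bar>u\<bar>) powr (- \<beta>)"
proof -
  have "cmod (ft tent (u / b)) \<le> 10 * (1 + \<bar>u / b\<bar>) powr (- 1)"
    using ft_tent_le[of "u / b"] by (simp add: powr_minus divide_inverse)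
  also have "\<dots> \<le> 10 * (1 + \<bar>u / b\<bar>) powr (- \<beta>)"
    using assms by (intro mult_left_mono powr_mono) auto
  also have "(1 + \<bar>u / b\<bar>) powr (- \<beta>) \<le> b powr \<beta> * (1 + \<bar>u\<bar>) powr (- \<beta>)"
  proof -
    have "1 + \<bar>u\<bar> \<le> b * (1 + \<bar>u / b\<bar>)" using assms by (simp add: field_simps)
    then have "(1 + \<bar>u\<bar>) powr \<beta> \<le> (b * (1 + \<bar>u / b\<bar>)) powr \<beta>"
      using assms by (intro powr_mono2) auto
    also have "\<dots> = b powr \<beta> * (1 + \<bar>u / b\<bar>) powr \<beta>" by (rule powr_mult)
    finally have "(1 + \<bar>u\<bar>) powr \<beta> \<le> b powr \<beta> * (1 + \<bar>u / b\<bar>) powr \<beta>" .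
    moreover have "inverse w \<le> c * inverse v" if "v \<le> c * w" "0 < v" "0 < w" for v w c :: real
      using that by (simp add: field_simps)
    moreover have "0 < (1 + \<bar>x\<bar>) powr \<beta>" for x :: real
      using abs_ge_zero[of x] unfolding powr_gt_zero by linarith
    ultimately show ?thesis unfolding powr_minus by blast
  qed
  finally show ?thesis by simp
qed

lemma fourier_bounded_mono:
  "fourier_bounded \<beta> \<epsilon> f \<Longrightarrow> \<epsilon> \<le> \<delta> \<Longrightarrow> fourier_bounded \<beta> \<delta> f"
  unfolding fourier_bounded_def by (meson mult_right_mono order_trans powr_ge_zero)

lemma fourier_bounded_integral: "fourier_bounded \<beta> \<epsilon> f \<Longrightarrow> \<bar>LINT t|lborel. f t\<bar> \<le> \<epsilon>"
  unfolding fourier_bounded_def using ft_0[of f]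
  by (metis norm_of_real abs_zero add_0_right mult.right_neutral powr_one_eq_one)

text \<open>Invariant of the partial products. The support stays in {1/4..3/4}, away from the ends
  of the grid, where every late density is exactly 1 + error; being a multiplier allows the effect
  of the next error to be estimated.\<close>

definition good_density :: "real \<Rightarrow> (real \<Rightarrow> real) \<Rightarrow> bool" where
  "good_density \<beta> f \<longleftrightarrow> continuous_on UNIV f \<and> (\<forall>t. 0 \<le> f t) \<and> fourier_multiplier \<beta> f \<and>
     (\<forall>t. t \<notin> {1/4..3/4} \<longrightarrow> f t = 0) \<and> integrable lborel f"

text \<open>Multiplying f by 1 + D changes it by f * D, whose Fourier bound is C * \<epsilon> with C
  the multiplier constant of f. As C is fixed before n, a late scale makes the change as small as
  desired.\<close>

lemma good_density_step:
  fixes \<nu> D :: "nat \<Rightarrow> real \<Rightarrow> real"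
  assumes f: "good_density \<beta> f"
    and \<nu>: "\<And>n. continuous_on UNIV (\<nu> n)" "\<And>n t. 0 \<le> \<nu> n t" "\<And>n. fourier_multiplier \<beta> (\<nu> n)"
    and D: "\<forall>\<^sub>F n in sequentially. (\<forall>t\<in>{1/4..3/4}. \<nu> n t = 1 + D n t) \<and> fourier_bounded \<beta> (\<epsilon> n) (D n)"
    and \<epsilon>: "\<epsilon> \<longlonglongrightarrow> 0" and \<delta>: "0 < \<delta>"
  shows "\<exists>n>m. good_density \<beta> (\<lambda>t. f t * \<nu> n t) \<and> fourier_bounded \<beta> \<delta> (\<lambda>t. f t * \<nu> n t - f t)"
proof -
  obtain C where C: "0 \<le> C" "\<forall>D \<epsilon>. fourier_bounded \<beta> \<epsilon> D \<longrightarrow> fourier_bounded \<beta> (C * \<epsilon>) (\<lambda>t. f t * D t)"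
    using f unfolding good_density_def fourier_multiplier_def by auto
  have "(\<lambda>n. C * \<epsilon> n) \<longlonglongrightarrow> 0" using tendsto_mult_right_zero[OF \<epsilon>] .
  then have "\<forall>\<^sub>F n in sequentially. C * \<epsilon> n < \<delta>" using \<delta> by (rule order_tendstoD)
  with D eventually_gt_at_top[of m]
  have "\<forall>\<^sub>F n in sequentially. n > m \<and> C * \<epsilon> n < \<delta> \<and> (\<forall>t\<in>{1/4..3/4}. \<nu> n t = 1 + D n t) \<and> fourier_bounded \<beta> (\<epsilon> n) (D n)"
    by eventually_elim auto
  then obtain n where n: "n > m" "C * \<epsilon> n < \<delta>" "\<forall>t\<in>{1/4..3/4}. \<nu> n t = 1 + D n t" "fourier_bounded \<beta> (\<epsilon> n) (D n)"
    using eventually_happens by fastforce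
  \<comment> \<open>Outside {1/4..3/4} both sides vanish with f, so \<nu> = 1 + D is used only where
    it holds.\<close>
  have eq: "f t * \<nu> n t - f t = f t * D n t" for t
    using f n(3) by (cases "t \<in> {1/4..3/4}") (auto simp: good_density_def algebra_simps)
  have fb: "fourier_bounded \<beta> \<delta> (\<lambda>t. f t * \<nu> n t - f t)"
    unfolding eq using C(2) n by (blast intro: fourier_bounded_mono less_imp_le)
  have "integrable lborel (\<lambda>t. (f t * \<nu> n t - f t) + f t)"
    using fb f by (intro Bochner_Integration.integrable_add) (auto simp: fourier_bounded_def good_density_def)
  then have "good_density \<beta> (\<lambda>t. f t * \<nu> n t)"
    using f \<nu> unfolding good_density_def by (auto intro!: continuous_on_mult fourier_multiplier_mult)
  then show ?thesis using n fb by blast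
qed

lemma good_density_tent:
  assumes "0 \<le> \<beta>" "\<beta> \<le> 1/2"
  shows "good_density \<beta> (\<lambda>t. tent (4 * t - 2))"
    and "0 < (LINT t|lborel. tent (4 * t - 2))"
    and "\<exists>c\<ge>0. fourier_bounded \<beta> c (\<lambda>t. tent (4 * t - 2))"
proof -
  have int: "integrable lborel (\<lambda>t. tent (4 * t - 2))"
    using lborel_integrable_real_affine[OF integrable_tent, of 4 "-2"] by (simp add: algebra_simps)
  show "good_density \<beta> (\<lambda>t. tent (4 * t - 2))" unfolding good_density_def
    using int fourier_multiplier_tent[OF assms, of 4 "-2"] tent_bounds
    by (auto intro!: continuous_intros simp: tent_eq_0_iff)
  have "(1/8 :: real) = (LINT t|lborel. 1/2 * indicator {3/8..5/8::real} t)" by simp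
  also have "\<dots> \<le> (LINT t|lborel. tent (4 * t - 2))"
  proof (rule integral_mono)
    show "1/2 * indicator {3/8..5/8} t \<le> tent (4 * t - 2)" for t :: real
    proof (cases "t \<in> {3/8..5/8}")
      case True
      then have "3/8 \<le> t" "t \<le> 5/8" by auto
      then have "\<bar>4 * t - 2\<bar> \<le> 1/2" by linarith
      then show ?thesis using True by (simp add: tent_def)
    qed (simp add: tent_bounds)
  qed (use int in \<open>auto simp: integrable_indicator_iff\<close>)
  finally show "0 < (LINT t|lborel. tent (4 * t - 2))" by simp
  have "fourier_bounded \<beta> (1/4 * (10 * 4 powr \<beta>)) (\<lambda>t. tent (4 * t - 2))"
    unfolding fourier_bounded_def using int
  proof (intro conjI allI)
    fix u
    have "cmod (ft (\<lambda>t. tent (4 * t - 2)) u) = 1/4 * cmod (ft tent (u / 4))"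
      by (subst ft_affine) (auto simp: norm_mult)
    then show "cmod (ft (\<lambda>t. tent (4 * t - 2)) u) \<le> 1/4 * (10 * 4 powr \<beta>) * (1 + \<bar>u\<bar>) powr (- \<beta>)"
      using ft_tent_scaled_le[of 4 \<beta> u] assms by simp
  qed
  then show "\<exists>c\<ge>0. fourier_bounded \<beta> c (\<lambda>t. tent (4 * t - 2))"
    by (intro exI[of _ "1/4 * (10 * 4 powr \<beta>)"]) auto
qed

text \<open>The changes m0 / 2^(j+2) add up to at most m0 / 2, so the products keep mass at least m0
  / 2 and a uniform Fourier bound. A weak limit of their normalisations inherits the decay pointwise
  through its characteristic function, and it lives on \<open>S n\<close> for each chosen scale n
  because all later products retain the factor \<nu> n.\<close>

lemma limit_measure_exists:
  fixes \<nu> D :: "nat \<Rightarrow> real \<Rightarrow> real" and S :: "nat \<Rightarrow> real set"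
  assumes \<beta>: "0 \<le> \<beta>" "\<beta> \<le> 1/2"
    and S: "\<And>n. closed (S n)"
    and \<nu>: "\<And>n. continuous_on UNIV (\<nu> n)" "\<And>n t. 0 \<le> \<nu> n t" "\<And>n. fourier_multiplier \<beta> (\<nu> n)"
    and supp: "\<And>n t. t \<notin> S n \<Longrightarrow> \<nu> n t = 0"
    and D: "\<forall>\<^sub>F n in sequentially. (\<forall>t\<in>{1/4..3/4}. \<nu> n t = 1 + D n t) \<and> fourier_bounded \<beta> (\<epsilon> n) (D n)"
    and \<epsilon>: "\<epsilon> \<longlonglongrightarrow> 0"
  shows "\<exists>K \<mu> C. compact K \<and> K \<subseteq> {1/4..3/4} \<and> (\<forall>t\<in>K. \<exists>\<^sub>F n in sequentially. t \<in> S n) \<and>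
    carries K \<mu> \<and> (\<forall>u. cmod (char \<mu> u) \<le> C * (1 + \<bar>u\<bar>) powr (- \<beta>))"
proof -
  define f0 where "f0 t = tent (4 * t - 2)" for t
  define m0 where "m0 = (LINT t|lborel. f0 t)"
  have m0: "0 < m0" unfolding m0_def f0_def by (rule good_density_tent(2)[OF \<beta>])
  obtain c0 where c0: "0 \<le> c0" "fourier_bounded \<beta> c0 f0"
    using good_density_tent(3)[OF \<beta>] unfolding f0_def[abs_def] by auto
  \<comment> \<open>\<open>h j\<close> pairs the last scale with the current product. The scale in
    \<open>h 0\<close> is only a starting value; the factors in the products belong to
    \<open>fst (h (Suc j))\<close>.\<close>
  have ex: "\<exists>h. \<forall>j. (good_density \<beta> (snd (h j)) \<and> (j = 0 \<longrightarrow> snd (h j) = f0)) \<and>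
     (fst (h (Suc j)) > fst (h j) \<and> snd (h (Suc j)) = (\<lambda>t. snd (h j) t * \<nu> (fst (h (Suc j))) t) \<and>
      fourier_bounded \<beta> (m0 / 2 ^ (j + 2)) (\<lambda>t. snd (h (Suc j)) t - snd (h j) t))"
  proof (rule dependent_nat_choice)
    show "\<exists>x::nat \<times> (real \<Rightarrow> real). good_density \<beta> (snd x) \<and> (0 = (0::nat) \<longrightarrow> snd x = f0)"
      using good_density_tent(1)[OF \<beta>] by (intro exI[of _ "(0, f0)"]) (simp add: f0_def[abs_def])
    fix x :: "nat \<times> (real \<Rightarrow> real)" and j :: nat
    assume "good_density \<beta> (snd x) \<and> (j = 0 \<longrightarrow> snd x = f0)"
    then have "good_density \<beta> (snd x)" ..
    from good_density_step[OF this \<nu> D \<epsilon>, of "m0 / 2 ^ (j + 2)" "fst x"] m0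
    obtain n where "n > fst x" "good_density \<beta> (\<lambda>t. snd x t * \<nu> n t)"
      "fourier_bounded \<beta> (m0 / 2 ^ (j + 2)) (\<lambda>t. snd x t * \<nu> n t - snd x t)" by auto
    then show "\<exists>y. (good_density \<beta> (snd y) \<and> (Suc j = 0 \<longrightarrow> snd y = f0)) \<and> fst y > fst x \<and>
      snd y = (\<lambda>t. snd x t * \<nu> (fst y) t) \<and> fourier_bounded \<beta> (m0 / 2 ^ (j + 2)) (\<lambda>t. snd y t - snd x t)"
      by (intro exI[of _ "(n, \<lambda>t. snd x t * \<nu> n t)"]) simp
  qed
  obtain h where h': "\<forall>j. (good_density \<beta> (snd (h j)) \<and> (j = 0 \<longrightarrow> snd (h j) = f0)) \<and>
     (fst (h (Suc j)) > fst (h j) \<and> snd (h (Suc j)) = (\<lambda>t. snd (h j) t * \<nu> (fst (h (Suc j))) t) \<and>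
      fourier_bounded \<beta> (m0 / 2 ^ (j + 2)) (\<lambda>t. snd (h (Suc j)) t - snd (h j) t))"
    using ex by (rule exE)
  have h: "\<And>j. good_density \<beta> (snd (h j))" "snd (h 0) = f0" "\<And>j. fst (h (Suc j)) > fst (h j)"
     "\<And>j. snd (h (Suc j)) = (\<lambda>t. snd (h j) t * \<nu> (fst (h (Suc j))) t)"
     "\<And>j. fourier_bounded \<beta> (m0 / 2 ^ (j + 2)) (\<lambda>t. snd (h (Suc j)) t - snd (h j) t)"
    using h' by blast+
  define N where "N j = fst (h j)" for j
  define F where "F j = snd (h j)" for j
  have N: "strict_mono N" using h(3) by (simp add: strict_mono_Suc_iff N_def)
  have F_cont: "continuous_on UNIV (F j)" and F_nn: "0 \<le> F j t" and F_supp: "t \<notin> {1/4..3/4} \<Longrightarrow> F j t = 0"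
    and F_int: "integrable lborel (F j)" for j t
    using h(1)[of j] by (auto simp: good_density_def F_def)
  have F_meas[measurable]: "F j \<in> borel_measurable borel" for j
    using F_cont[of j] by (intro borel_measurable_continuous_onI)
  have F_Suc: "F (Suc j) t = F j t * \<nu> (N (Suc j)) t" for j t using h(4)[of j] by (simp add: F_def N_def)
  have F_diff: "fourier_bounded \<beta> (m0 / 2 ^ (j + 2)) (\<lambda>t. F (Suc j) t - F j t)" for j
    using h(5)[of j] by (simp add: F_def)
  have F0: "F 0 = f0" using h(2) by (simp add: F_def)
  have Ffb: "fourier_bounded \<beta> (c0 + m0 / 2 * (1 - 1 / 2 ^ j)) (F j)" for j
  proof (induction j)
    case 0
    then show ?case using c0 F0 by simp
  next
    case (Suc j)
    have "fourier_bounded \<beta> ((c0 + m0 / 2 * (1 - 1 / 2 ^ j)) + m0 / 2 ^ (j + 2)) (\<lambda>t. F j t + (F (Suc j) t - F j t))"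
      by (rule fourier_bounded_add[OF Suc.IH F_diff])
    moreover have "c0 + m0 / 2 * (1 - 1 / 2 ^ j) + m0 / 2 ^ (j + 2) = c0 + m0 / 2 * (1 - 1 / 2 ^ Suc j)"
      by (simp add: field_simps)
    moreover have "(\<lambda>t. F j t + (F (Suc j) t - F j t)) = F (Suc j)" by simp
    ultimately show ?case by (simp only:)
  qed
  define mass where "mass j = (LINT t|lborel. F j t)" for j
  have mass: "\<bar>mass j - m0\<bar> \<le> m0 / 2 * (1 - 1 / 2 ^ j)" for j
  proof (induction j)
    case 0
    then show ?case by (simp add: mass_def F0 m0_def)
  next
    case (Suc j)
    have "\<bar>mass (Suc j) - mass j\<bar> \<le> m0 / 2 ^ (j + 2)"
      using fourier_bounded_integral[OF F_diff[of j]] F_int by (simp add: mass_def)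
    moreover have "m0 / 2 * (1 - 1 / 2 ^ j) + m0 / 2 ^ (j + 2) = m0 / 2 * (1 - 1 / 2 ^ Suc j)"
      by (simp add: field_simps)
    ultimately show ?case using Suc.IH by linarith
  qed
  have mass_ge: "m0 / 2 \<le> mass j" for j
  proof -
    have "m0 / 2 * (1 - 1 / 2 ^ j) \<le> m0 / 2 * 1" using m0 by (intro mult_left_mono) auto
    then show ?thesis using mass[of j] by linarith
  qed
  have mass_pos: "0 < mass j" for j using mass_ge[of j] m0 by linarith
  \<comment> \<open>Normalised to mass 1, so that tightness and Levy's continuity theorem apply;
    dividing by the mass costs the decay a factor of at most 2 / m0.\<close>
  define P where "P j = density lborel (\<lambda>t. ennreal (F j t / mass j))" for j
  have P_dist: "real_distribution (P j)" for j
  proof -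
    have "emeasure (P j) UNIV = (\<integral>\<^sup>+t. ennreal (F j t / mass j) \<partial>lborel)"
      by (simp add: P_def emeasure_density)
    also have "\<dots> = ennreal (LINT t|lborel. F j t / mass j)"
      using F_int[of j] F_nn mass_pos[of j] by (intro nn_integral_eq_integral) auto
    also have "\<dots> = 1" using mass_pos[of j] by (simp flip: mass_def)
    finally have "prob_space (P j)" by (intro prob_spaceI) (simp add: P_def)
    then show ?thesis unfolding real_distribution_def real_distribution_axioms_def by (simp add: P_def)
  qed
  have P_AE: "AE t in P j. t \<in> A" if "\<And>t. t \<notin> A \<Longrightarrow> F j t = 0" for j A
  proof -
    have "t \<in> A" if "0 < ennreal (F j t / mass j)" for t
      using that \<open>\<And>t. t \<notin> A \<Longrightarrow> F j t = 0\<close>[of t] by (cases "t \<in> A") auto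
    then show ?thesis unfolding P_def by (subst AE_density) auto
  qed
  have char_P: "cmod (char (P j) u) \<le> (c0 + m0) / (m0 / 2) * (1 + \<bar>u\<bar>) powr (- \<beta>)" for j u
  proof -
    have "char (P j) u = (CLINT t|lborel. (F j t / mass j) *\<^sub>R iexp (u * t))"
      unfolding char_def P_def using F_nn mass_pos[of j] by (intro integral_density) auto
    also have "\<dots> = (CLINT t|lborel. of_real (1 / mass j) * (iexp (u * t) * of_real (F j t)))"
      by (intro Bochner_Integration.integral_cong refl) (simp add: scaleR_conv_of_real)
    also have "\<dots> = of_real (1 / mass j) * ft (F j) u" unfolding ft_def by (rule integral_mult_right_zero)
    finally have "cmod (char (P j) u) = cmod (ft (F j) u) / mass j"
      using mass_pos[of j] by (simp add: norm_divide)
    also have "\<dots> \<le> ((c0 + m0) * (1 + \<bar>u\<bar>) powr (- \<beta>)) / (m0 / 2)"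
    proof (rule frac_le)
      have "m0 / 2 * (1 - 1 / 2 ^ j) \<le> m0 / 2 * 1" using m0 by (intro mult_left_mono) auto
      then have "fourier_bounded \<beta> (c0 + m0) (F j)"
        using m0 by (intro fourier_bounded_mono[OF Ffb]) linarith
      then show "cmod (ft (F j) u) \<le> (c0 + m0) * (1 + \<bar>u\<bar>) powr (- \<beta>)" by (simp add: fourier_bounded_def)
    qed (use mass_ge m0 c0 in auto)
    finally show ?thesis by (simp only: times_divide_eq_left)
  qed
  have "tight P" unfolding tight_def
  proof (intro conjI allI impI)
    fix e :: real assume e: "0 < e"
    have "measure (P j) {0<..1} = 1" for j
    proof -
      interpret real_distribution "P j" by (rule P_dist)
      have "AE t in P j. t \<in> {0<..1}" by (rule P_AE) (auto intro!: F_supp)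
      then show ?thesis by (intro prob_eq_1[THEN iffD2]) auto
    qed
    then show "\<exists>a b. a < b \<and> (\<forall>n. 1 - e < measure (P n) {a<..b})"
      using e by (intro exI[of _ 0] exI[of _ 1]) auto
  qed (rule P_dist)
  from tight_imp_convergent_subsubsequence[OF this strict_mono_id]
  obtain r \<mu> where r: "strict_mono r" and \<mu>: "real_distribution \<mu>" and wc: "weak_conv_m (\<lambda>j. P (r j)) \<mu>"
    by (auto simp: comp_def)
  interpret \<mu>: real_distribution \<mu> by (rule \<mu>)
  have char_mu: "cmod (char \<mu> u) \<le> (c0 + m0) / (m0 / 2) * (1 + \<bar>u\<bar>) powr (- \<beta>)" for u
  proof (rule LIMSEQ_le_const2)
    show "(\<lambda>j. cmod (char (P (r j)) u)) \<longlonglongrightarrow> cmod (char \<mu> u)"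
      by (intro tendsto_norm levy_continuity1[OF P_dist \<mu> wc])
  qed (use char_P in blast)
  define T where "T i = S (N (Suc i)) \<inter> {1/4..3/4}" for i
  have T_closed: "closed (T i)" for i using S by (auto simp: T_def)
  have F_T: "F j t = 0" if "t \<notin> T i" "Suc i \<le> j" for i j t
    using that(2)
  proof (induction j rule: dec_induct)
    case base
    show ?case using that(1) F_supp[of t i] supp[of t "N (Suc i)"] by (auto simp: F_Suc T_def)
  next
    case (step j)
    then show ?case by (simp add: F_Suc)
  qed
  have T_AE: "AE t in \<mu>. t \<in> T i" for i
  proof -
    \<comment> \<open>\<open>infdist\<close> to the empty set is 0 by convention, so the test
      function below detects \<open>T i\<close> only when it is nonempty; emptiness would give a
      product of mass 0.\<close>
    have ne: "T i \<noteq> {}"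
    proof
      assume "T i = {}"
      then have "F (Suc i) = (\<lambda>t. 0)" using F_T[of _ i "Suc i"] by auto
      then show False using mass_pos[of "Suc i"] by (simp add: mass_def)
    qed
    \<comment> \<open>A bounded continuous function whose zero set is the closed set
      \<open>T i\<close>: its integral vanishes along the tail of the sequence, hence in the weak
      limit.\<close>
    define g where "g t = min 1 (infdist t (T i))" for t
    have g_cont: "continuous_on UNIV g" unfolding g_def by (intro continuous_intros)
    have g_bd: "0 \<le> g t" "g t \<le> 1" for t by (auto simp: g_def infdist_nonneg)
    have [measurable]: "g \<in> borel_measurable borel" using g_cont by (rule borel_measurable_continuous_onI)
    have lim: "(\<lambda>j. LINT t|P (r j). g t) \<longlonglongrightarrow> (LINT t|\<mu>. g t)"
      using g_bd g_cont
      by (intro weak_conv_imp_integral_bdd_continuous_conv[OF P_dist \<mu> wc, of g 1])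
         (auto simp: continuous_on_eq_continuous_at)
    have "\<forall>\<^sub>F j in sequentially. (LINT t|P (r j). g t) = 0"
      using eventually_ge_at_top[of "Suc i"]
    proof eventually_elim
      case (elim j)
      have "AE t in P (r j). t \<in> T i"
        using elim seq_suble[OF r, of j] by (intro P_AE F_T) auto
      then have "AE t in P (r j). g t = 0" by eventually_elim (simp add: g_def)
      then show ?case by (rule integral_eq_zero_AE)
    qed
    then have "(LINT t|\<mu>. g t) = 0"
      by (rule LIMSEQ_unique[OF lim tendsto_eventually])
    moreover have "integrable \<mu> g" using g_bd by (intro \<mu>.integrable_const_bound[where B = 1]) auto
    ultimately have "AE t in \<mu>. g t = 0"
      using g_bd by (subst (asm) integral_nonneg_eq_0_iff_AE) auto
    then show ?thesis
      by eventually_elim (use T_closed ne in \<open>auto simp: g_def min_def in_closed_iff_infdist_zero split: if_splits\<close>)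
  qed
  define K where "K = (\<Inter>i. T i)"
  have K: "K \<subseteq> {1/4..3/4}" by (auto simp: K_def T_def)
  have K_closed: "closed K" unfolding K_def using T_closed by auto
  have K_compact: "compact K" using K_closed K bounded_subset[OF bounded_closed_interval]
    by (auto simp: compact_eq_bounded_closed)
  have "AE t in \<mu>. t \<in> K" unfolding K_def using T_AE by (simp add: AE_all_countable)
  moreover have "- K \<in> sets \<mu>" using K_closed by auto
  ultimately have "emeasure \<mu> (- K) = 0"
    by (subst (asm) AE_iff_measurable[of "- K"]) auto
  then have "carries K \<mu>" unfolding carries_def
    using \<mu>.emeasure_space_1 \<mu>.finite_measure_axioms by auto
  moreover have "\<exists>\<^sub>F n in sequentially. t \<in> S n" if "t \<in> K" for t
    unfolding frequently_sequentially
  proof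
    fix m
    have "m \<le> N (Suc m)" using seq_suble[OF N, of "Suc m"] by simp
    moreover have "t \<in> S (N (Suc m))" using that by (auto simp: K_def T_def)
    ultimately show "\<exists>n\<ge>m. t \<in> S n" by blast
  qed
  ultimately show ?thesis using K_compact K char_mu by blast
qed

subsection \<open>The lower bound\<close>

text \<open>The indices below (2^n - 1) * 2^q are the r + i * 2^q with r < 2^q and i < 2^n - 1: the
  windows covered by the exponential-sum estimate, all ending by time 1. The balls are the supports
  of the tents in \<open>hit_density\<close>.\<close>

definition hit_set :: "real \<Rightarrow> nat \<Rightarrow> nat \<Rightarrow> (real \<Rightarrow> real) \<Rightarrow> real set" where
  "hit_set a q n f = (\<Union>k\<in>{k. k < (2 ^ n - 1) * 2 ^ q \<and> hit a q n f k}.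
     cball (real k / 2 ^ (n + q)) (1 / 2 ^ (n + q)))"

definition hit_density :: "real \<Rightarrow> nat \<Rightarrow> nat \<Rightarrow> (real \<Rightarrow> real) \<Rightarrow> real \<Rightarrow> real" where
  "hit_density a q n f t =
     (\<Sum>k<(2 ^ n - 1) * 2 ^ q. hit_weight a q n f k * tent (2 ^ (n + q) * t - real k))"

definition hit_error :: "real \<Rightarrow> nat \<Rightarrow> nat \<Rightarrow> (real \<Rightarrow> real) \<Rightarrow> real \<Rightarrow> real" where
  "hit_error a q n f t =
     (\<Sum>k<(2 ^ n - 1) * 2 ^ q. (hit_weight a q n f k - 1) * tent (2 ^ (n + q) * t - real k))"

text \<open>The tents form a partition of unity away from the ends of the grid; n \<ge> 4 makes the
  index range long enough for {1/4..3/4}.\<close>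

lemma hit_density_eq:
  assumes "4 \<le> n" "t \<in> {1/4..3/4}"
  shows "hit_density a q n f t = 1 + hit_error a q n f t"
proof -
  have "(\<Sum>k<(2 ^ n - 1) * 2 ^ q. tent (2 ^ (n + q) * t - real k)) = 1"
  proof (rule sum_tent)
    show "0 \<le> 2 ^ (n + q) * t" using assms by simp
    have "(2::real) ^ 4 \<le> 2 ^ n" using assms(1) by (intro power_increasing) auto
    then have "16 * (2::real) ^ q \<le> 2 ^ n * 2 ^ q" by simp
    moreover have "(1::real) \<le> 2 ^ q" by simp
    moreover have "2 ^ (n + q) * t \<le> 2 ^ n * 2 ^ q * (3/4)" using assms(2) by (simp add: power_add)
    ultimately have "2 ^ (n + q) * t < 2 ^ n * 2 ^ q - 2 ^ q - 1" by linarith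
    then show "2 ^ (n + q) * t < real ((2 ^ n - 1) * 2 ^ q) - 1"
      by (simp add: of_nat_diff algebra_simps)
  qed
  then show ?thesis unfolding hit_density_def hit_error_def
    by (simp add: left_diff_distrib sum_subtractf)
qed

text \<open>A tent centred at k / 2^(n+q) contributes a phase. Writing k = r + i * 2^q splits this
  phase and leaves, for each class r, an exponential sum in i at the angle u / 2^n; a bound uniform
  in the angle therefore serves all u.\<close>

lemma ft_hit_error:
  "ft (hit_error a q n f) u = of_real (1 / 2 ^ (n + q)) * ft tent (u / 2 ^ (n + q)) *
    (\<Sum>r<2^q. iexp (u * real r / 2 ^ (n + q)) *
      (\<Sum>i<2^n-1. of_real (hit_weight a q n f (r + i * 2 ^ q) - 1) * cis (real i * (u / 2 ^ n))))"
proof -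
  let ?b = "2 ^ (n + q) :: real" and ?w = "\<lambda>k. hit_weight a q n f k - 1"
  have int: "integrable lborel (\<lambda>t. tent (?b * t - d))" for d
    using lborel_integrable_real_affine[OF integrable_tent, of ?b "- d"] by (simp add: algebra_simps)
  have "ft (hit_error a q n f) u = (\<Sum>k<(2 ^ n - 1) * 2 ^ q. of_real (?w k) * (of_real (1 / ?b) * iexp (u * real k / ?b) * ft tent (u / ?b)))"
    unfolding hit_error_def[abs_def] using int by (subst ft_sum) (auto simp: ft_cmult ft_affine)
  also have "\<dots> = of_real (1 / ?b) * ft tent (u / ?b) * (\<Sum>k<(2 ^ n - 1) * 2 ^ q. of_real (?w k) * iexp (u * real k / ?b))"
    unfolding sum_distrib_left by (intro sum.cong refl) (simp only: mult_ac)
  also have "(\<Sum>k<(2 ^ n - 1) * 2 ^ q. of_real (?w k) * iexp (u * real k / ?b))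
      = (\<Sum>i<2^n-1. \<Sum>r<2^q. of_real (?w (r + i * 2 ^ q)) * iexp (u * real (r + i * 2 ^ q) / ?b))"
    by (rule sum_mult_product)
  also have "\<dots> = (\<Sum>r<2^q. \<Sum>i<2^n-1. of_real (?w (r + i * 2 ^ q)) * iexp (u * real (r + i * 2 ^ q) / ?b))"
    by (rule sum.swap)
  also have "\<dots> = (\<Sum>r<2^q. iexp (u * real r / ?b) * (\<Sum>i<2^n-1. of_real (?w (r + i * 2 ^ q)) * cis (real i * (u / 2 ^ n))))"
  proof -
    have "iexp (u * real (r + i * 2 ^ q) / ?b) = iexp (u * real r / ?b) * cis (real i * (u / 2 ^ n))" for r i
    proof -
      have "u * real (r + i * 2 ^ q) / ?b = u * real r / ?b + real i * (u / 2 ^ n)"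
        by (simp add: power_add field_simps)
      then show ?thesis by (simp only: cis_conv_exp of_real_add distrib_left exp_add)
    qed
    then show ?thesis unfolding sum_distrib_left by (simp only: mult_ac)
  qed
  finally show ?thesis .
qed

text \<open>There are 2^q class sums of size 3 n^2 * 2^(n (1 + \<rho>) / 2), multiplied by 1 / b
  from the width of the tents and by 10 b^\<beta> from their decay, with b = 2^(n+q). The exponents
  combine to \<beta> - 1 + (1 + \<rho>) / 2 = \<beta> - (1 - \<rho>) / 2 per unit of n, and 30 = 3 *
  10.\<close>

lemma hit_error_fourier_bounded:
  assumes \<beta>: "0 \<le> \<beta>" "\<beta> \<le> 1" and p: "2 powr (- \<rho> * real n) \<le> hit_prob a n"
    and sums: "\<And>r \<phi>. r < 2 ^ q \<Longrightarrow>
      cmod (\<Sum>i<2^n-1. of_real (hit_weight a q n f (r + i * 2 ^ q) - 1) * cis (real i * \<phi>))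
      \<le> 3 * (real n)\<^sup>2 * sqrt (2 ^ n / hit_prob a n)"
  shows "fourier_bounded \<beta> (30 * 2 ^ q * (real n)\<^sup>2 * 2 powr (real n * (\<beta> - (1 - \<rho>) / 2))) (hit_error a q n f)"
  unfolding fourier_bounded_def
proof (intro conjI allI)
  let ?b = "2 ^ (n + q) :: real" and ?s = "3 * (real n)\<^sup>2 * 2 powr (real n * ((1 + \<rho>) / 2))"
  have int: "integrable lborel (\<lambda>t. tent (?b * t - d))" for d
    using lborel_integrable_real_affine[OF integrable_tent, of ?b "- d"] by (simp add: algebra_simps)
  show "integrable lborel (hit_error a q n f)"
    unfolding hit_error_def[abs_def] using int by auto
  fix u
  have sq: "sqrt (2 ^ n / hit_prob a n) \<le> 2 powr (real n * ((1 + \<rho>) / 2))"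
  proof -
    have "2 ^ n / hit_prob a n \<le> 2 ^ n / 2 powr (- \<rho> * real n)"
      using less_le_trans[OF powr_gt_zero[THEN iffD2] p] by (intro divide_left_mono[OF p] mult_pos_pos) auto
    also have "\<dots> = 2 powr (real n * (1 + \<rho>))"
      by (simp add: powr_realpow[symmetric] powr_diff[symmetric] algebra_simps)
    finally have "sqrt (2 ^ n / hit_prob a n) \<le> sqrt (2 powr (real n * (1 + \<rho>)))" by simp
    then show ?thesis by (simp add: powr_half_sqrt[symmetric] powr_powr)
  qed
  have "cmod (\<Sum>r<2^q. iexp (u * real r / ?b) *
      (\<Sum>i<2^n-1. of_real (hit_weight a q n f (r + i * 2 ^ q) - 1) * cis (real i * (u / 2 ^ n)))) \<le> (\<Sum>r<(2::nat)^q. ?s)"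
  proof (rule sum_norm_le)
    fix r :: nat assume "r \<in> {..<2 ^ q}"
    then have "cmod (\<Sum>i<2^n-1. of_real (hit_weight a q n f (r + i * 2 ^ q) - 1) * cis (real i * (u / 2 ^ n)))
        \<le> 3 * (real n)\<^sup>2 * sqrt (2 ^ n / hit_prob a n)"
      by (intro sums) simp
    also have "\<dots> \<le> ?s" using sq by (intro mult_left_mono) auto
    finally show "cmod (iexp (u * real r / ?b) *
      (\<Sum>i<2^n-1. of_real (hit_weight a q n f (r + i * 2 ^ q) - 1) * cis (real i * (u / 2 ^ n)))) \<le> ?s"
      by (simp only: norm_mult norm_exp_i_times mult_1_left)
  qed
  also have "\<dots> = 2 ^ q * ?s" by simp
  finally have "cmod (ft (hit_error a q n f) u)
      \<le> (1 / ?b * (10 * ?b powr \<beta> * (1 + \<bar>u\<bar>) powr (- \<beta>))) * (2 ^ q * ?s)"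
    unfolding ft_hit_error norm_mult using \<beta>
    by (intro mult_mono ft_tent_scaled_le) (auto simp: norm_divide norm_power intro!: mult_nonneg_nonneg)
  also have "\<dots> = (30 * 2 ^ q * (real n)\<^sup>2 * (1 / ?b * ?b powr \<beta> * 2 powr (real n * ((1 + \<rho>) / 2)))) * (1 + \<bar>u\<bar>) powr (- \<beta>)"
    by simp
  also have "\<dots> \<le> (30 * 2 ^ q * (real n)\<^sup>2 * 2 powr (real n * (\<beta> - (1 - \<rho>) / 2))) * (1 + \<bar>u\<bar>) powr (- \<beta>)"
  proof (intro mult_right_mono mult_left_mono)
    have "1 / ?b * ?b powr \<beta> = ?b powr (\<beta> - 1)" by (simp add: powr_diff)
    \<comment> \<open>The exponent \<beta> - 1 is at most 0, so replacing the base by the smaller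
      2^n only increases the power; this removes q from the exponent.\<close>
    also have "\<dots> \<le> (2 ^ n) powr (\<beta> - 1)" using \<beta> by (intro powr_mono2') (auto simp: power_increasing)
    also have "\<dots> = 2 powr (real n * (\<beta> - 1))" by (simp add: powr_realpow[symmetric] powr_powr)
    finally have "1 / ?b * ?b powr \<beta> * 2 powr (real n * ((1 + \<rho>) / 2))
        \<le> 2 powr (real n * (\<beta> - 1)) * 2 powr (real n * ((1 + \<rho>) / 2))" by (intro mult_right_mono) auto
    also have "\<dots> = 2 powr (real n * (\<beta> - (1 - \<rho>) / 2))"
      by (simp add: powr_add[symmetric]) (simp add: field_simps)
    finally show "1 / ?b * ?b powr \<beta> * 2 powr (real n * ((1 + \<rho>) / 2)) \<le> 2 powr (real n * (\<beta> - (1 - \<rho>) / 2))" .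
  qed auto
  finally show "cmod (ft (hit_error a q n f) u)
      \<le> 30 * 2 ^ q * (real n)\<^sup>2 * 2 powr (real n * (\<beta> - (1 - \<rho>) / 2)) * (1 + \<bar>u\<bar>) powr (- \<beta>)" .
qed

lemma hit_measure_exists:
  assumes a: "0 \<le> a" and \<beta>: "0 \<le> \<beta>" "2 * \<beta> < 1 - a\<^sup>2"
    and sums: "\<forall>\<^sub>F n in sequentially. \<forall>r<2^q. \<forall>\<phi>.
      cmod (\<Sum>i<2^n-1. of_real (hit_weight a q n f (r + i * 2 ^ q) - 1) * cis (real i * \<phi>))
      \<le> 3 * (real n)\<^sup>2 * sqrt (2 ^ n / hit_prob a n)"
  shows "\<exists>K \<mu> C. compact K \<and> K \<subseteq> {1/4..3/4} \<and> (\<forall>t\<in>K. \<exists>\<^sub>F n in sequentially. t \<in> hit_set a q n f) \<and>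
    carries K \<mu> \<and> (\<forall>u. cmod (char \<mu> u) \<le> C * (1 + \<bar>u\<bar>) powr (- \<beta>))"
proof -
  \<comment> \<open>Midpoint of a^2 and 1 - 2 \<beta>: above a^2, so that hit probabilities are
    eventually at least 2^(-\<rho> n), and below 1 - 2 \<beta>, so that the error bounds tend to
    0.\<close>
  define \<rho> where "\<rho> = (a\<^sup>2 + (1 - 2 * \<beta>)) / 2"
  have \<rho>: "a\<^sup>2 < \<rho>" "\<rho> < 1 - 2 * \<beta>" using \<beta> by (auto simp: \<rho>_def)
  have \<beta>2: "\<beta> \<le> 1/2" using \<beta> zero_le_power2[of a] by linarith
  define \<epsilon> where "\<epsilon> n = 30 * 2 ^ q * (real n)\<^sup>2 * 2 powr (real n * (\<beta> - (1 - \<rho>) / 2))" for n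
  show ?thesis
  proof (rule limit_measure_exists[where S = "\<lambda>n. hit_set a q n f" and \<nu> = "\<lambda>n. hit_density a q n f" and D = "\<lambda>n. hit_error a q n f" and \<epsilon> = \<epsilon>])
    show "closed (hit_set a q n f)" for n
      unfolding hit_set_def by (rule closed_UN) auto
    show "continuous_on UNIV (hit_density a q n f)" for n
      unfolding hit_density_def by (intro continuous_intros)
    show "0 \<le> hit_density a q n f t" for n t
      unfolding hit_density_def by (intro sum_nonneg mult_nonneg_nonneg hit_weight_bounds tent_bounds a)
    show "fourier_multiplier \<beta> (hit_density a q n f)" for n
      unfolding hit_density_def
    proof (intro fourier_multiplier_sum fourier_multiplier_mult fourier_multiplier_const)
      show "fourier_multiplier \<beta> (\<lambda>t. tent (2 ^ (n + q) * t - real k))" for k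
        using fourier_multiplier_tent[OF \<beta>(1) \<beta>2, of "2 ^ (n + q)" "- real k"] by simp
    qed simp
    show "hit_density a q n f t = 0" if "t \<notin> hit_set a q n f" for n t
      unfolding hit_density_def
    proof (rule sum.neutral, rule ballI)
      fix k :: nat assume k: "k \<in> {..<(2 ^ n - 1) * 2 ^ q}"
      show "hit_weight a q n f k * tent (2 ^ (n + q) * t - real k) = 0"
      proof (cases "hit a q n f k")
        case True
        then have "1 / 2 ^ (n + q) < \<bar>real k / 2 ^ (n + q) - t\<bar>"
          using that k by (auto simp: hit_set_def dist_real_def not_le)
        then have "1 / 2 ^ (n + q) * 2 ^ (n + q) < \<bar>real k / 2 ^ (n + q) - t\<bar> * 2 ^ (n + q)"
          by (rule mult_strict_right_mono) simp
        also have "\<bar>real k / 2 ^ (n + q) - t\<bar> * 2 ^ (n + q) = \<bar>(real k / 2 ^ (n + q) - t) * 2 ^ (n + q)\<bar>"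
          by (simp add: abs_mult)
        also have "(real k / 2 ^ (n + q) - t) * 2 ^ (n + q) = - (2 ^ (n + q) * t - real k)"
          by (simp add: left_diff_distrib mult.commute[of t])
        finally have "tent (2 ^ (n + q) * t - real k) = 0" by (simp add: tent_eq_0_iff)
        then show ?thesis by simp
      qed (simp add: hit_weight_def)
    qed
    from sums hit_prob_lower[OF a \<rho>(1)] eventually_ge_at_top[of 4]
    show "\<forall>\<^sub>F n in sequentially. (\<forall>t\<in>{1/4..3/4}. hit_density a q n f t = 1 + hit_error a q n f t) \<and>
        fourier_bounded \<beta> (\<epsilon> n) (hit_error a q n f)"
    proof eventually_elim
      case (elim n)
      then show ?case unfolding \<epsilon>_def using hit_density_eq hit_error_fourier_bounded[of \<beta> \<rho> n a q f] \<beta> \<beta>2 by auto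
    qed
    define c where "c = (1 - \<rho>) / 2 - \<beta>"
    have "0 < c" using \<rho> by (simp add: c_def)
    then have "(\<lambda>n. 30 * 2 ^ q * (real n)\<^sup>2 * 2 powr (real n * (- c))) \<longlonglongrightarrow> 0" by real_asymp
    then show "\<epsilon> \<longlonglongrightarrow> 0" unfolding \<epsilon>_def[abs_def] c_def by simp
  qed (use \<beta> \<beta>2 in auto)
qed

section \<open>From hits at infinitely many scales to rapid points\<close>

lemma rapid_pointsI:
  assumes "t \<in> {0..1}"
    and "\<And>\<delta>. 0 < \<delta> \<Longrightarrow> \<exists>h. h \<noteq> 0 \<and> \<bar>h\<bar> < \<delta> \<and> t + h \<in> {0..1} \<and>
      \<alpha> \<le> \<bar>f (t + h) - f t\<bar> / sqrt (2 * \<bar>h\<bar> * ln (1 / \<bar>h\<bar>))"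
  shows "t \<in> rapid_points \<alpha> f"
proof -
  let ?F = "at 0 within {h. t + h \<in> {0..1}}"
  let ?g = "\<lambda>h. ereal (\<bar>f (t + h) - f t\<bar> / sqrt (2 * \<bar>h\<bar> * ln (1 / \<bar>h\<bar>)))"
  have "\<not> Limsup ?F ?g < ereal \<alpha>"
  proof
    assume "Limsup ?F ?g < ereal \<alpha>"
    then have "\<forall>\<^sub>F h in ?F. ?g h < ereal \<alpha>" by (rule Limsup_lessD)
    then obtain \<delta> where "0 < \<delta>" "\<And>h. t + h \<in> {0..1} \<Longrightarrow> h \<noteq> 0 \<Longrightarrow> \<bar>h\<bar> < \<delta> \<Longrightarrow> ?g h < ereal \<alpha>"
      unfolding eventually_at dist_real_def by auto
    then show False using assms(2)[of \<delta>] by force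
  qed
  then show ?thesis using assms(1) by (auto simp: rapid_points_def not_less)
qed

text \<open>A point t of \<open>hit_set\<close> is within 2^-(n+q) of the start x of a window with a
  large increment, and the increment used for t runs to the end s of that same window. Replacing x
  by t costs the modulus at distance 2^-(n+q) and lengthens the window by a factor of at most 1 +
  2^-q; \<open>ev\<close> says that the gap between \<alpha> and a pays for both.\<close>

lemma hit_rapid:
  assumes mod: "has_modulus f" and q: "1 \<le> q"
    and ev: "\<forall>\<^sub>F n in sequentially. \<alpha> * sqrt (2 * (1 + 1 / 2 ^ q) * (real n + 1) * ln 2) + 22 * sqrt ((real n + real q) / 2 ^ q)
       \<le> rapid_threshold a n"
    and \<alpha>: "0 \<le> \<alpha>"
    and t: "t \<in> {1/4..3/4}" and fr: "\<exists>\<^sub>F n in sequentially. t \<in> hit_set a q n f"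
  shows "t \<in> rapid_points \<alpha> f"
proof (rule rapid_pointsI)
  show "t \<in> {0..1}" using t by auto
  fix \<delta> :: real assume \<delta>: "0 < \<delta>"
  have "\<forall>\<^sub>F n in sequentially. \<forall>s\<in>{0..1}. \<forall>t\<in>{0..1}.
     \<bar>s - t\<bar> \<le> 1 / 2 ^ (n + q) \<longrightarrow> \<bar>f s - f t\<bar> \<le> 22 * sqrt (real (n + q) / 2 ^ (n + q))"
    using mod unfolding has_modulus_def by (rule sequentially_offset)
  moreover have "\<forall>\<^sub>F n in sequentially. 2 / 2 ^ n < \<delta>"
    using \<delta> by real_asymp
  ultimately have "\<forall>\<^sub>F n in sequentially. (\<forall>s\<in>{0..1}. \<forall>t\<in>{0..1}.
     \<bar>s - t\<bar> \<le> 1 / 2 ^ (n + q) \<longrightarrow> \<bar>f s - f t\<bar> \<le> 22 * sqrt (real (n + q) / 2 ^ (n + q))) \<and> 2 / 2 ^ n < \<delta> \<and> 2 \<le> n \<and>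
     \<alpha> * sqrt (2 * (1 + 1 / 2 ^ q) * (real n + 1) * ln 2) + 22 * sqrt ((real n + real q) / 2 ^ q)
       \<le> rapid_threshold a n"
    using ev eventually_ge_at_top[of 2] by eventually_elim auto
  from frequently_ex[OF frequently_eventually_conj[OF fr this]]
  obtain n where nS: "t \<in> hit_set a q n f" and md: "\<And>s t. s \<in> {0..1} \<Longrightarrow> t \<in> {0..1} \<Longrightarrow>
     \<bar>s - t\<bar> \<le> 1 / 2 ^ (n + q) \<Longrightarrow> \<bar>f s - f t\<bar> \<le> 22 * sqrt (real (n + q) / 2 ^ (n + q))"
     and n\<delta>: "2 / 2 ^ n < \<delta>" and n2: "2 \<le> n"
     and ineq: "\<alpha> * sqrt (2 * (1 + 1 / 2 ^ q) * (real n + 1) * ln 2) + 22 * sqrt ((real n + real q) / 2 ^ q)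
       \<le> rapid_threshold a n" by blast
  obtain k where k: "k < (2 ^ n - 1) * 2 ^ q" "hit a q n f k" "\<bar>real k / 2 ^ (n + q) - t\<bar> \<le> 1 / 2 ^ (n + q)"
    using nS by (auto simp: hit_set_def dist_real_def)
  define x where "x = real k / 2 ^ (n + q)"
  define s where "s = (real k + 2 ^ q) / 2 ^ (n + q)"
  define e where "e = (1 / 2 ^ n :: real)"
  have e0: "0 < e" by (simp add: e_def)
  have sx: "s = x + e" by (simp add: s_def x_def e_def add_divide_distrib power_add)
  have bq: "1 / 2 ^ (n + q) = e * (1 / 2 ^ q)" by (simp add: e_def power_add)
  have q2: "1 / 2 ^ q \<le> (1/2 :: real)"
    using power_decreasing[of 1 q "1/2::real"] q by (simp add: power_one_over)
  have eq2: "e * (1 / 2 ^ q) \<le> e * (1/2)" using e0 q2 by (intro mult_left_mono) auto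
  have xt: "\<bar>x - t\<bar> \<le> e * (1 / 2 ^ q)" using k(3) by (simp add: x_def bq)
  have s1: "s \<le> 1"
  proof -
    have "k + 2 ^ q \<le> (2 ^ n - 1) * 2 ^ q + 2 ^ q" using k(1) by simp
    also have "\<dots> = 2 ^ (n + q)" by (simp add: power_add algebra_simps)
    finally have "real (k + 2 ^ q) \<le> real (2 ^ (n + q))" by (rule of_nat_mono)
    then show ?thesis by (simp add: s_def)
  qed
  have x0: "0 \<le> x" by (simp add: x_def)
  define h where "h = s - t"
  \<comment> \<open>The lower bound gives ln (1 / h) \<le> (n + 1) ln 2, the source of
    \<open>real n + 1\<close> in \<open>ev\<close>; the upper bound is the source of 1 +
    2^-q.\<close>
  have h: "e * (1/2) \<le> h" "h \<le> e * (1 + 1 / 2 ^ q)"     using xt sx eq2 unfolding h_def distrib_left by linarith+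
  have h0: "0 < h" using h e0 by linarith
  have e4: "e \<le> 1/4"
    using power_decreasing[of 2 n "1/2::real"] n2 by (simp add: e_def power_one_over power2_eq_square)
  have "e * (1 + 1 / 2 ^ q) \<le> e * 2" using e0 q2 by (intro mult_left_mono) auto
  moreover have "e * 2 < \<delta>" using n\<delta> by (simp add: e_def)
  ultimately have h1: "h < 1" "h < \<delta>" using h e4 by linarith+
  have big: "rapid_threshold a n * sqrt e \<le> \<bar>f s - f x\<bar>"
    using k(2) by (simp add: hit_def s_def x_def e_def)
  have small: "\<bar>f x - f t\<bar> \<le> 22 * sqrt ((real n + real q) / 2 ^ q) * sqrt e"
  proof -
    have "\<bar>f x - f t\<bar> \<le> 22 * sqrt (real (n + q) / 2 ^ (n + q))"
      using x0 s1 sx e0 t xt by (intro md) (auto simp: bq)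
    also have "real (n + q) / 2 ^ (n + q) = (real n + real q) / 2 ^ q * e" by (simp add: e_def power_add)
    finally show ?thesis by (simp only: real_sqrt_mult mult.assoc)
  qed
  have "\<alpha> * sqrt (2 * \<bar>h\<bar> * ln (1 / \<bar>h\<bar>)) \<le> \<alpha> * (sqrt (2 * (1 + 1 / 2 ^ q) * (real n + 1) * ln 2) * sqrt e)"
  proof (rule mult_left_mono[OF _ \<alpha>])
    have "ln (1 / h) \<le> ln (2 ^ (n + 1))"
      using h0 h(1) by (subst ln_le_cancel_iff) (auto simp: e_def field_simps)
    also have "\<dots> = (real n + 1) * ln 2" by (subst ln_realpow) auto
    finally have l: "ln (1 / h) \<le> (real n + 1) * ln 2" .
    have "2 * h * ln (1 / h) \<le> 2 * (e * (1 + 1 / 2 ^ q)) * ((real n + 1) * ln 2)"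
      using h h0 l h1 e0 by (intro mult_mono) (auto intro!: ln_ge_zero)
    also have "\<dots> = 2 * (1 + 1 / 2 ^ q) * (real n + 1) * ln 2 * e" by (simp only: mult_ac)
    finally show "sqrt (2 * \<bar>h\<bar> * ln (1 / \<bar>h\<bar>)) \<le> sqrt (2 * (1 + 1 / 2 ^ q) * (real n + 1) * ln 2) * sqrt e"
      unfolding real_sqrt_mult[symmetric] using h0 by (intro real_sqrt_le_mono) simp
  qed
  also have "\<dots> \<le> (rapid_threshold a n - 22 * sqrt ((real n + real q) / 2 ^ q)) * sqrt e"
    unfolding mult.assoc[symmetric] using ineq e0 by (intro mult_right_mono) auto
  also have "\<dots> \<le> \<bar>f s - f t\<bar>" using big small by (simp add: left_diff_distrib)
  finally have main: "\<alpha> * sqrt (2 * \<bar>h\<bar> * ln (1 / \<bar>h\<bar>)) \<le> \<bar>f (t + h) - f t\<bar>" by (simp add: h_def)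
  have "0 < sqrt (2 * \<bar>h\<bar> * ln (1 / \<bar>h\<bar>))" using h0 h1 by (auto intro!: mult_pos_pos ln_gt_zero)
  with main have "\<alpha> \<le> \<bar>f (t + h) - f t\<bar> / sqrt (2 * \<bar>h\<bar> * ln (1 / \<bar>h\<bar>))" by (simp add: le_divide_eq)
  then show "\<exists>h. h \<noteq> 0 \<and> \<bar>h\<bar> < \<delta> \<and> t + h \<in> {0..1} \<and>
      \<alpha> \<le> \<bar>f (t + h) - f t\<bar> / sqrt (2 * \<bar>h\<bar> * ln (1 / \<bar>h\<bar>))"
    using h0 h1 s1 x0 sx e0 by (intro exI[of _ h]) (auto simp: h_def)
qed

text \<open>Divided by sqrt n, the left side tends to an expression in q alone as n grows, and that
  tends to \<alpha> * sqrt (2 ln 2) < a * sqrt (2 ln 2) as q grows. Hence q is fixed first and n is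
  taken large afterwards.\<close>

lemma scale_ratio_exists:
  assumes "0 \<le> \<alpha>" "\<alpha> < a"
  shows "\<exists>q\<ge>1. \<forall>\<^sub>F n in sequentially. \<alpha> * sqrt (2 * (1 + 1 / 2 ^ q) * (real n + 1) * ln 2) +
    22 * sqrt ((real n + real q) / 2 ^ q) \<le> rapid_threshold a n"
proof -
  let ?L = "\<lambda>q::nat. \<alpha> * sqrt (2 * (1 + 1 / 2 ^ q) * ln 2) + 22 * sqrt (1 / 2 ^ q)"
  have "(\<lambda>q. (1 / 2 :: real) ^ q) \<longlonglongrightarrow> 0" by (rule LIMSEQ_realpow_zero) auto
  then have z: "(\<lambda>q. 1 / 2 ^ q :: real) \<longlonglongrightarrow> 0" by (simp add: power_one_over)
  have "?L \<longlonglongrightarrow> \<alpha> * sqrt (2 * (1 + 0) * ln 2) + 22 * sqrt 0"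
    by (intro tendsto_intros z)
  moreover have "\<alpha> * sqrt (2 * (1 + 0) * ln 2) + 22 * sqrt 0 < a * sqrt (2 * ln 2)"
    using assms by simp
  ultimately have "\<forall>\<^sub>F q in sequentially. ?L q < a * sqrt (2 * ln 2)"
    by (rule order_tendstoD(2))
  with eventually_ge_at_top[of 1] have "\<forall>\<^sub>F q in sequentially. 1 \<le> q \<and> ?L q < a * sqrt (2 * ln 2)"
    by eventually_elim auto
  then obtain q where q: "1 \<le> q" "?L q < a * sqrt (2 * ln 2)"
    using eventually_happens by fastforce
  have "(\<lambda>n. \<alpha> * sqrt (2 * (1 + 1 / 2 ^ q) * (1 + 1 / real n) * ln 2) + 22 * sqrt ((1 + real q / real n) / 2 ^ q))
      \<longlonglongrightarrow> \<alpha> * sqrt (2 * (1 + 1 / 2 ^ q) * (1 + 0) * ln 2) + 22 * sqrt ((1 + 0) / 2 ^ q)"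
    by (intro tendsto_intros lim_const_over_n) auto
  then have "\<forall>\<^sub>F n in sequentially. \<alpha> * sqrt (2 * (1 + 1 / 2 ^ q) * (1 + 1 / real n) * ln 2) +
      22 * sqrt ((1 + real q / real n) / 2 ^ q) < a * sqrt (2 * ln 2)"
    by (rule order_tendstoD(2)) (use q in simp)
  with eventually_gt_at_top[of 0] have "\<forall>\<^sub>F n in sequentially. \<alpha> * sqrt (2 * (1 + 1 / 2 ^ q) * (real n + 1) * ln 2) +
    22 * sqrt ((real n + real q) / 2 ^ q) \<le> rapid_threshold a n"
  proof eventually_elim
    case (elim n)
    have "2 * (1 + 1 / 2 ^ q) * (real n + 1) * ln 2 = (2 * (1 + 1 / 2 ^ q) * (1 + 1 / real n) * ln 2) * real n"
      "(real n + real q) / 2 ^ q = (1 + real q / real n) / 2 ^ q * real n"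
      "2 * real n * ln 2 = (2 * ln 2) * real n"
      using elim(1) by (simp_all add: divide_simps distrib_left)
    then show ?case unfolding rapid_threshold_def
      using mult_right_mono[OF less_imp_le[OF elim(2)], of "sqrt (real n)"]
      by (simp only: real_sqrt_mult[of _ "real n"] distrib_right) (simp add: mult.assoc)
  qed
  with q(1) show ?thesis by blast
qed

lemma fourier_decayI:
  assumes "\<And>u. cmod (char \<mu> u) \<le> C * (1 + \<bar>u\<bar>) powr (- \<beta>)" and "\<gamma> < \<beta>"
  shows "fourier_decay \<mu> \<gamma>"
proof -
  have "(\<lambda>u::real. (1 + \<bar>u\<bar>) powr (- \<beta>)) \<in> o[at_top](\<lambda>u. \<bar>u\<bar> powr (- \<gamma>))"
    using assms(2) by real_asymp
  moreover have "(\<lambda>u::real. (1 + \<bar>u\<bar>) powr (- \<beta>)) \<in> o[at_bot](\<lambda>u. \<bar>u\<bar> powr (- \<gamma>))"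
    using assms(2) by real_asymp
  ultimately have "(\<lambda>u::real. (1 + \<bar>u\<bar>) powr (- \<beta>)) \<in> o[at_infinity](\<lambda>u. \<bar>u\<bar> powr (- \<gamma>))"
    unfolding at_infinity_eq_at_top_bot by (intro landau_o.small.sup)
  moreover have "(\<lambda>u. norm (char \<mu> u)) \<in> O[at_infinity](\<lambda>u. (1 + \<bar>u\<bar>) powr (- \<beta>))"
    using assms(1) by (intro bigoI[of _ C]) auto
  ultimately show ?thesis unfolding fourier_decay_def by (rule landau_o.big_small_trans[rotated])
qed

lemma (in brownian_motion_01) AE_rapid_measure:
  assumes \<alpha>: "0 < \<alpha>" "\<alpha> < 1" and \<gamma>: "\<gamma> < 1 - \<alpha>\<^sup>2"
  shows "AE \<omega> in M. \<exists>K \<mu>. compact K \<and> K \<subseteq> rapid_points \<alpha> (\<lambda>t. X t \<omega>) \<and> carries K \<mu> \<and> fourier_decay \<mu> (\<gamma> / 2)"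
proof -
  \<comment> \<open>A negative \<gamma> is replaced by 0: the construction works with exponents
    \<beta> \<ge> 0, and faster decay implies the claim.\<close>
  define \<gamma>' where "\<gamma>' = max \<gamma> 0"
  have "\<gamma>' < 1 - \<alpha>\<^sup>2" using \<gamma> \<alpha> by (simp add: \<gamma>'_def abs_square_less_1)
  then have "\<alpha> < sqrt (1 - \<gamma>')" using \<alpha> by (intro real_less_rsqrt) simp
  then obtain a where a: "\<alpha> < a" "a < sqrt (1 - \<gamma>')" using dense by blast
  have g0: "0 \<le> \<gamma>'" by (simp add: \<gamma>'_def)
  have a2: "a\<^sup>2 < 1 - \<gamma>'"
  proof -
    have "a\<^sup>2 < (sqrt (1 - \<gamma>'))\<^sup>2" using a \<alpha> by (intro power_strict_mono) auto
    moreover have "0 \<le> 1 - \<gamma>'" using \<open>\<gamma>' < 1 - \<alpha>\<^sup>2\<close> zero_le_power2[of \<alpha>] by linarith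
    ultimately show ?thesis by simp
  qed
  have a01: "0 \<le> a" "a < 1"
  proof -
    show "0 \<le> a" using a \<alpha> by simp
    have "a\<^sup>2 < 1" using a2 g0 by linarith
    then show "a < 1" by (simp add: abs_square_less_1)
  qed
  \<comment> \<open>Midpoint of \<gamma>' / 2 and (1 - a^2) / 2: below the second, so that the
    construction applies, and above \<gamma> / 2, so that a big-O bound becomes little-o.\<close>
  define \<beta> where "\<beta> = (\<gamma>' + (1 - a\<^sup>2)) / 4"
  have \<beta>: "0 \<le> \<beta>" "2 * \<beta> < 1 - a\<^sup>2" "\<gamma> / 2 < \<beta>"
    using a2 g0 by (auto simp: \<beta>_def \<gamma>'_def)
  obtain q where q: "1 \<le> q" "\<forall>\<^sub>F n in sequentially. \<alpha> * sqrt (2 * (1 + 1 / 2 ^ q) * (real n + 1) * ln 2) +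
    22 * sqrt ((real n + real q) / 2 ^ q) \<le> rapid_threshold a n"
    using scale_ratio_exists[of \<alpha> a] \<alpha> a by auto
  from AE_has_modulus AE_hit_sums_small[OF a01, of q] show ?thesis
  proof eventually_elim
    case (elim \<omega>)
    from hit_measure_exists[OF a01(1) \<beta>(1,2) elim(2)] obtain K \<mu> C where
      *: "compact K" "K \<subseteq> {1/4..3/4}" "\<forall>t\<in>K. \<exists>\<^sub>F n in sequentially. t \<in> hit_set a q n (\<lambda>t. X t \<omega>)"
        "carries K \<mu>" "\<forall>u. cmod (char \<mu> u) \<le> C * (1 + \<bar>u\<bar>) powr (- \<beta>)" by blast
    have "K \<subseteq> rapid_points \<alpha> (\<lambda>t. X t \<omega>)"
    proof
      fix t assume "t \<in> K"
      then show "t \<in> rapid_points \<alpha> (\<lambda>t. X t \<omega>)"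
        using * \<alpha> by (intro hit_rapid[OF elim(1) q]) auto
    qed
    moreover have "fourier_decay \<mu> (\<gamma> / 2)" using *(5) \<beta>(3) by (intro fourier_decayI[of \<mu> C \<beta>]) auto
    ultimately show ?case using * by blast
  qed
qed

subsection \<open>The upper bound\<close>

text \<open>Scaling gives (1 + |z| / r)^-a = r^a (r + |z|)^-a. On |z| \<le> 1 the density is at most
  1 and (r + |z|)^-a has integral at most 4 / (1 - a), finite because a < 1; beyond, the power is at
  most 1 and the density contributes at most 1.\<close>

lemma gaussian_powr_bound:
  assumes a: "0 < a" "a < 1" and r: "0 < r" "r \<le> 1"
  shows "integrable std_normal_distribution (\<lambda>z. (1 + \<bar>z / r\<bar>) powr (- a))"
    and "(LINT z|std_normal_distribution. (1 + \<bar>z / r\<bar>) powr (- a)) \<le> (4 / (1 - a) + 1) * r powr a"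
proof -
  interpret real_distribution std_normal_distribution by (rule real_dist_normal_dist)
  show int: "integrable std_normal_distribution (\<lambda>z. (1 + \<bar>z / r\<bar>) powr (- a))"
  proof (rule integrable_const_bound[where B = 1])
    have "(1 + \<bar>z / r\<bar>) powr (- a) \<le> 1 powr (- a)" for z
      using a by (intro powr_mono2') auto
    then show "AE z in std_normal_distribution. norm ((1 + \<bar>z / r\<bar>) powr (- a)) \<le> 1" by simp
  qed simp
  have I1: "has_bochner_integral lborel (\<lambda>z. (r + z) powr (- a) * indicator {0..1} z)
      ((r + 1) powr (1 - a) / (1 - a) - (r + 0) powr (1 - a) / (1 - a))"
    using a r
    by (intro has_bochner_integral_FTC_Icc_real)
       (auto intro!: derivative_eq_intros continuous_intros)
  have I2: "has_bochner_integral lborel (\<lambda>z. (r - z) powr (- a) * indicator {-1..0} z)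
      (- ((r - 0) powr (1 - a) / (1 - a)) - (- ((r - (-1)) powr (1 - a) / (1 - a))))"
    using a r
    by (intro has_bochner_integral_FTC_Icc_real)
       (auto intro!: derivative_eq_intros continuous_intros)
  have J: "(r + 1) powr (1 - a) / (1 - a) \<le> 2 / (1 - a)"
  proof (rule divide_right_mono)
    have "(r + 1) powr (1 - a) \<le> (r + 1) powr 1" using a r by (intro powr_mono) auto
    then show "(r + 1) powr (1 - a) \<le> 2" using r by simp
  qed (use a in simp)
  have pt: "std_normal_density z * (1 + \<bar>z / r\<bar>) powr (- a)
      \<le> r powr a * ((r + z) powr (- a) * indicator {0..1} z + (r - z) powr (- a) * indicator {-1..0} z + std_normal_density z)" for z
  proof -
    have d1: "std_normal_density z \<le> 1"
    proof -
      have "1 \<le> sqrt (2 * pi)" using pi_gt3 by simp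
      then have "1 / sqrt (2 * pi) * exp (- z\<^sup>2 / 2) \<le> 1 * 1" by (intro mult_mono) auto
      then show ?thesis by (simp add: std_normal_density_def)
    qed
    have eq: "(1 + \<bar>z / r\<bar>) powr (- a) = r powr a * (r + \<bar>z\<bar>) powr (- a)"
    proof -
      have "1 + \<bar>z / r\<bar> = (r + \<bar>z\<bar>) / r" using r by (simp add: field_simps)
      then have "(1 + \<bar>z / r\<bar>) powr (- a) = (r + \<bar>z\<bar>) powr (- a) / r powr (- a)"
        by (simp only: powr_divide)
      then show ?thesis by (simp only: powr_minus divide_inverse inverse_inverse_eq mult.commute)
    qed
    have "std_normal_density z * (r + \<bar>z\<bar>) powr (- a)
      \<le> (r + z) powr (- a) * indicator {0..1} z + (r - z) powr (- a) * indicator {-1..0} z + std_normal_density z"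
    proof (cases "\<bar>z\<bar> \<le> 1")
      case True
      have "std_normal_density z * (r + \<bar>z\<bar>) powr (- a) \<le> 1 * (r + \<bar>z\<bar>) powr (- a)"
        using d1 by (intro mult_right_mono) auto
      also have "\<dots> \<le> (r + z) powr (- a) * indicator {0..1} z + (r - z) powr (- a) * indicator {-1..0} z"
        using True by (cases "0 \<le> z") (auto simp: indicator_def)
      finally show ?thesis using normal_density_nonneg[of 0 1 z] by linarith
    next
      case False
      have "(r + \<bar>z\<bar>) powr (- a) \<le> 1 powr (- a)" using a r False by (intro powr_mono2') auto
      then have "std_normal_density z * (r + \<bar>z\<bar>) powr (- a) \<le> std_normal_density z * 1"
        by (intro mult_left_mono) auto
      then show ?thesis by (simp add: add_nonneg_nonneg order_trans[of _ "std_normal_density z"])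
    qed
    then show ?thesis unfolding eq
      using mult_left_mono[of "std_normal_density z * (r + \<bar>z\<bar>) powr (- a)" _ "r powr a"] by (simp add: mult.left_commute)
  qed
  have I3: "integrable lborel std_normal_density" "(LINT z|lborel. std_normal_density z) = 1"
    using integrable_std_normal_moment[of 0] integral_std_normal_moment_even[of 0] by auto
  have int': "integrable lborel (\<lambda>z. std_normal_density z * (1 + \<bar>z / r\<bar>) powr (- a))"
    using int by (subst (asm) integrable_density) auto
  have "(LINT z|std_normal_distribution. (1 + \<bar>z / r\<bar>) powr (- a)) = (LINT z|lborel. std_normal_density z * (1 + \<bar>z / r\<bar>) powr (- a))"
    by (subst integral_density) auto
  also have "\<dots> \<le> (LINT z|lborel. r powr a * ((r + z) powr (- a) * indicator {0..1} z + (r - z) powr (- a) * indicator {-1..0} z + std_normal_density z))"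
    using I1 I2 I3 int' pt by (intro integral_mono) (auto simp: has_bochner_integral_iff)
  also have "\<dots> = r powr a * (((r + 1) powr (1 - a) / (1 - a) - (r + 0) powr (1 - a) / (1 - a))
     + (- ((r - 0) powr (1 - a) / (1 - a)) - (- ((r - (-1)) powr (1 - a) / (1 - a)))) + 1)"
    using I1 I2 I3 by (simp add: has_bochner_integral_iff)
  also have "\<dots> \<le> r powr a * (4 / (1 - a) + 1)"
  proof (intro mult_left_mono)
    have "0 \<le> r powr (1 - a) / (1 - a)" using a by simp
    then show "((r + 1) powr (1 - a) / (1 - a) - (r + 0) powr (1 - a) / (1 - a))
     + (- ((r - 0) powr (1 - a) / (1 - a)) - (- ((r - (-1)) powr (1 - a) / (1 - a)))) + 1 \<le> 4 / (1 - a) + 1"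
      using J by simp
  qed simp
  finally show "(LINT z|std_normal_distribution. (1 + \<bar>z / r\<bar>) powr (- a)) \<le> (4 / (1 - a) + 1) * r powr a"
    by (simp only: mult.commute)
qed

text \<open>The Gaussian kernel is the characteristic function of the standard normal law at (x - y)
  / r. Fubini, applied once for y and once for x, turns the energy of \<mu> into an average of the
  squared transform at frequencies of order 1 / r.\<close>

lemma gaussian_energy:
  assumes "finite_measure \<mu>" and [measurable_cong]: "sets \<mu> = sets borel"
  shows "(LINT x|\<mu>. LINT y|\<mu>. exp (- ((x - y) / r)\<^sup>2 / 2))
    = (LINT z|std_normal_distribution. (cmod (char \<mu> (z / r)))\<^sup>2)"
proof -
  interpret \<mu>: finite_measure \<mu> by fact
  interpret \<gamma>: real_distribution std_normal_distribution by (rule real_dist_normal_dist)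
  interpret P: pair_sigma_finite \<mu> std_normal_distribution ..
  have fin: "finite_measure (\<mu> \<Otimes>\<^sub>M std_normal_distribution)"
    by (rule finite_measure_pair_measure) (rule \<gamma>.finite_measure_axioms, rule \<mu>.finite_measure_axioms)
  have char_bd: "cmod (char \<mu> u) \<le> measure \<mu> UNIV" for u
  proof -
    have "cmod (char \<mu> u) \<le> (LINT x|\<mu>. cmod (iexp (u * x)))"
      unfolding char_def by (rule integral_norm_bound)
    then show ?thesis using sets_eq_imp_space_eq[OF assms(2)] by simp
  qed
  have [measurable]: "char \<mu> \<in> borel_measurable borel"
    unfolding char_def[abs_def] by measurable
  have [measurable]: "cnj \<in> borel_measurable borel"
    by (intro borel_measurable_continuous_onI continuous_intros)
  have inner: "complex_of_real (exp (- ((x - y) / r)\<^sup>2 / 2)) = (CLINT z|std_normal_distribution. iexp (z / r * x) * cnj (iexp (z / r * y)))" for x y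
  proof -
    have "complex_of_real (exp (- ((x - y) / r)\<^sup>2 / 2)) = char std_normal_distribution ((x - y) / r)"
      by (simp add: char_std_normal_distribution)
    also have "\<dots> = (CLINT z|std_normal_distribution. iexp (z / r * x) * cnj (iexp (z / r * y)))"
      unfolding char_def
    proof (intro Bochner_Integration.integral_cong refl)
      fix z
      have "(x - y) / r * z = z / r * x + - (z / r * y)" by (simp add: diff_divide_distrib algebra_simps)
      then have "iexp ((x - y) / r * z) = iexp (z / r * x) * iexp (- (z / r * y))"
        by (simp only: of_real_add distrib_left exp_add)
      also have "iexp (- (z / r * y)) = cnj (iexp (z / r * y))" by (simp add: exp_cnj)
      finally show "iexp ((x - y) / r * z) = iexp (z / r * x) * cnj (iexp (z / r * y))" .
    qed
    finally show ?thesis .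
  qed
  have 1: "(CLINT y|\<mu>. complex_of_real (exp (- ((x - y) / r)\<^sup>2 / 2)))
      = (CLINT z|std_normal_distribution. iexp (z / r * x) * cnj (char \<mu> (z / r)))" for x
  proof -
    have "integrable (\<mu> \<Otimes>\<^sub>M std_normal_distribution) (\<lambda>(y, z). iexp (z / r * x) * cnj (iexp (z / r * y)))"
    proof (rule finite_measure.integrable_const_bound[OF fin, where B = 1])
      show "(\<lambda>(y, z). iexp (z / r * x) * cnj (iexp (z / r * y))) \<in> borel_measurable (\<mu> \<Otimes>\<^sub>M std_normal_distribution)"
        by measurable
    qed (auto simp: norm_mult split: prod.splits)
    from P.Fubini_integral[OF this]
    have "(CLINT y|\<mu>. complex_of_real (exp (- ((x - y) / r)\<^sup>2 / 2)))
       = (CLINT z|std_normal_distribution. CLINT y|\<mu>. iexp (z / r * x) * cnj (iexp (z / r * y)))"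
      unfolding inner by simp
    also have "\<dots> = (CLINT z|std_normal_distribution. iexp (z / r * x) * cnj (char \<mu> (z / r)))"
      unfolding char_def
      by (intro Bochner_Integration.integral_cong refl) (simp only: integral_mult_right_zero Bochner_Integration.integral_cnj)
    finally show ?thesis .
  qed
  have "integrable (\<mu> \<Otimes>\<^sub>M std_normal_distribution) (\<lambda>(x, z). iexp (z / r * x) * cnj (char \<mu> (z / r)))"
  proof (rule finite_measure.integrable_const_bound[OF fin, where B = "measure \<mu> UNIV"])
    show "(\<lambda>(x, z). iexp (z / r * x) * cnj (char \<mu> (z / r))) \<in> borel_measurable (\<mu> \<Otimes>\<^sub>M std_normal_distribution)"
      by measurable
  qed (auto simp: norm_mult char_bd split: prod.splits)
  from P.Fubini_integral[OF this]
  have "(CLINT x|\<mu>. CLINT y|\<mu>. complex_of_real (exp (- ((x - y) / r)\<^sup>2 / 2)))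
     = (CLINT z|std_normal_distribution. CLINT x|\<mu>. iexp (z / r * x) * cnj (char \<mu> (z / r)))"
    unfolding 1 by simp
  also have "\<dots> = (CLINT z|std_normal_distribution. complex_of_real ((cmod (char \<mu> (z / r)))\<^sup>2))"
  proof (intro Bochner_Integration.integral_cong refl)
    fix z
    have "(CLINT x|\<mu>. iexp (z / r * x) * cnj (char \<mu> (z / r))) = char \<mu> (z / r) * cnj (char \<mu> (z / r))"
      unfolding char_def by (rule integral_mult_left_zero)
    then show "(CLINT x|\<mu>. iexp (z / r * x) * cnj (char \<mu> (z / r))) = complex_of_real ((cmod (char \<mu> (z / r)))\<^sup>2)"
      by (simp only: complex_norm_square)
  qed
  finally have "complex_of_real (LINT x|\<mu>. LINT y|\<mu>. exp (- ((x - y) / r)\<^sup>2 / 2))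
    = complex_of_real (LINT z|std_normal_distribution. (cmod (char \<mu> (z / r)))\<^sup>2)"
    by (simp only: integral_complex_of_real)
  then show ?thesis by (simp only: of_real_eq_iff)
qed

text \<open>Two points of one cell are at distance at most r, where the Gaussian kernel is at least
  exp (- 1/2); this is the factor exp (1/2). The remaining constant is that of the decay bound
  averaged over the frequencies z / r.\<close>

lemma measure_cells_le:
  assumes fin: "finite_measure \<mu>" and [measurable_cong]: "sets \<mu> = sets borel"
    and a: "0 < a" "a < 1" and C: "0 \<le> C" "\<And>u. (cmod (char \<mu> u))\<^sup>2 \<le> C * (1 + \<bar>u\<bar>) powr (- a)"
    and r: "0 < r" "r \<le> 1" and J: "finite J" "disjoint_family_on I J"
    and I: "\<And>k. k \<in> J \<Longrightarrow> I k \<in> sets borel" "\<And>k x y. k \<in> J \<Longrightarrow> x \<in> I k \<Longrightarrow> y \<in> I k \<Longrightarrow> \<bar>x - y\<bar> \<le> r"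
  shows "(measure \<mu> (\<Union>k\<in>J. I k))\<^sup>2 \<le> real (card J) * (exp (1/2) * C * (4 / (1 - a) + 1) * r powr a)"
proof -
  interpret \<mu>: finite_measure \<mu> by fact
  interpret \<gamma>: real_distribution std_normal_distribution by (rule real_dist_normal_dist)
  have space: "space \<mu> = UNIV" using sets_eq_imp_space_eq[OF assms(2)] by simp
  define \<Phi> where "\<Phi> x y = exp (- ((x - y) / r)\<^sup>2 / 2)" for x y :: real
  have \<Phi>m: "(\<lambda>(x, y). \<Phi> x y) \<in> borel_measurable (\<mu> \<Otimes>\<^sub>M \<mu>)" unfolding \<Phi>_def by measurable
  have \<Phi>1: "\<Phi> x y \<le> 1" "0 \<le> \<Phi> x y" for x y by (auto simp: \<Phi>_def)
  have \<Phi>i: "integrable \<mu> (\<Phi> x)" for x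
    using \<Phi>1 by (intro \<mu>.integrable_const_bound[where B = 1]) (auto simp: \<Phi>_def[abs_def])
  have \<Phi>ii: "integrable \<mu> (\<lambda>x. LINT y|\<mu>. \<Phi> x y)"
  proof (rule \<mu>.integrable_const_bound[where B = "measure \<mu> UNIV"])
    have "\<bar>LINT y|\<mu>. \<Phi> x y\<bar> \<le> measure \<mu> UNIV" for x
    proof -
      have "(LINT y|\<mu>. \<Phi> x y) \<le> (LINT y|\<mu>. 1)" using \<Phi>i \<Phi>1 by (intro integral_mono) auto
      moreover have "0 \<le> (LINT y|\<mu>. \<Phi> x y)" using \<Phi>1 by (intro Bochner_Integration.integral_nonneg) auto
      ultimately show ?thesis using space by simp
    qed
    then show "AE x in \<mu>. norm (LINT y|\<mu>. \<Phi> x y) \<le> measure \<mu> UNIV" by simp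
    show "(\<lambda>x. LINT y|\<mu>. \<Phi> x y) \<in> borel_measurable \<mu>"
      using \<Phi>m by (intro \<mu>.borel_measurable_lebesgue_integral)
  qed
  have Im: "I k \<in> sets \<mu>" if "k \<in> J" for k using I(1)[OF that] by simp
  have sq: "(measure \<mu> (I k))\<^sup>2 = (LINT x|\<mu>. LINT y|\<mu>. indicator (I k) x * indicator (I k) y)" if "k \<in> J" for k
    using Im[OF that] by (simp add: power2_eq_square space)
  have ii: "integrable \<mu> (indicat_real (I k))" if "k \<in> J" for k
    using Im[OF that] by (auto simp: integrable_indicator_iff \<mu>.emeasure_eq_measure)
  have "(\<Sum>k\<in>J. (measure \<mu> (I k))\<^sup>2) = (LINT x|\<mu>. LINT y|\<mu>. (\<Sum>k\<in>J. indicator (I k) x * indicator (I k) y))"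
    using ii Im by (simp add: sq)
  also have "\<dots> \<le> (LINT x|\<mu>. exp (1/2) * (LINT y|\<mu>. \<Phi> x y))"
  proof (rule integral_mono)
    show "integrable \<mu> (\<lambda>x. LINT y|\<mu>. (\<Sum>k\<in>J. indicat_real (I k) x * indicat_real (I k) y))"
      using ii Im by simp
    show "integrable \<mu> (\<lambda>x. exp (1/2) * (LINT y|\<mu>. \<Phi> x y))" using \<Phi>ii by simp
    fix x
    have "(LINT y|\<mu>. (\<Sum>k\<in>J. indicat_real (I k) x * indicat_real (I k) y)) \<le> (LINT y|\<mu>. exp (1/2) * \<Phi> x y)"
    proof (rule integral_mono)
      show "integrable \<mu> (\<lambda>y. \<Sum>k\<in>J. indicat_real (I k) x * indicat_real (I k) y)" using ii by simp
      show "integrable \<mu> (\<lambda>y. exp (1/2) * \<Phi> x y)" using \<Phi>i by simp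
      fix y
      show "(\<Sum>k\<in>J. indicat_real (I k) x * indicat_real (I k) y) \<le> exp (1/2) * \<Phi> x y"
      proof (cases "\<exists>k\<in>J. x \<in> I k \<and> y \<in> I k")
        case True
        then obtain k where k: "k \<in> J" "x \<in> I k" "y \<in> I k" by blast
        have "(\<Sum>j\<in>J. indicat_real (I j) x * indicat_real (I j) y) = (\<Sum>j\<in>{k}. indicat_real (I j) x * indicat_real (I j) y)"
        proof (rule sum.mono_neutral_right)
          show "\<forall>j\<in>J - {k}. indicat_real (I j) x * indicat_real (I j) y = 0"
            using J(2) k unfolding disjoint_family_on_def indicator_def by auto
        qed (use J k in auto)
        also have "\<dots> = 1" using k by simp
        also have "1 \<le> exp (1/2) * \<Phi> x y"
        proof -
          have "\<bar>(x - y) / r\<bar> \<le> 1" using I(2)[OF k] r by simp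
          then have "((x - y) / r)\<^sup>2 \<le> 1" by (simp add: abs_square_le_1)
          then show ?thesis unfolding \<Phi>_def exp_add[symmetric] by simp
        qed
        finally show ?thesis .
      next
        case False
        then have "(\<Sum>k\<in>J. indicat_real (I k) x * indicat_real (I k) y) = 0"
          by (intro sum.neutral) (auto simp: indicator_def)
        then show ?thesis using \<Phi>1 by simp
      qed
    qed
    then show "(LINT y|\<mu>. (\<Sum>k\<in>J. indicat_real (I k) x * indicat_real (I k) y)) \<le> exp (1/2) * (LINT y|\<mu>. \<Phi> x y)"
      by simp
  qed
  also have "\<dots> = exp (1/2) * (LINT z|std_normal_distribution. (cmod (char \<mu> (z / r)))\<^sup>2)"
    unfolding \<Phi>_def using gaussian_energy[OF assms(1,2), of r] by simp
  also have "(LINT z|std_normal_distribution. (cmod (char \<mu> (z / r)))\<^sup>2)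
      \<le> (LINT z|std_normal_distribution. C * (1 + \<bar>z / r\<bar>) powr (- a))"
  proof (rule integral_mono)
    have [measurable]: "char \<mu> \<in> borel_measurable borel" unfolding char_def[abs_def] by measurable
    have "C * (1 + \<bar>u\<bar>) powr (- a) \<le> C * 1" for u :: real
    proof (rule mult_left_mono[OF _ C(1)])
      have "(1 + \<bar>u\<bar>) powr (- a) \<le> 1 powr (- a)" using a by (intro powr_mono2') auto
      then show "(1 + \<bar>u\<bar>) powr (- a) \<le> 1" by simp
    qed
    then have "(cmod (char \<mu> u))\<^sup>2 \<le> C" for u using order_trans[OF C(2)[of u]] by simp
    then show "integrable std_normal_distribution (\<lambda>z. (cmod (char \<mu> (z / r)))\<^sup>2)"
      by (intro \<gamma>.integrable_const_bound[where B = C]) auto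
    show "integrable std_normal_distribution (\<lambda>z. C * (1 + \<bar>z / r\<bar>) powr (- a))"
      using gaussian_powr_bound(1)[OF a r] by simp
  qed (rule C(2))
  also have "\<dots> \<le> C * ((4 / (1 - a) + 1) * r powr a)"
    using gaussian_powr_bound(2)[OF a r] C(1) by (simp add: mult_left_mono)
  finally have sumsq: "(\<Sum>k\<in>J. (measure \<mu> (I k))\<^sup>2) \<le> exp (1/2) * (C * ((4 / (1 - a) + 1) * r powr a))" by simp
  have "(measure \<mu> (\<Union>k\<in>J. I k))\<^sup>2 = (\<Sum>k\<in>J. measure \<mu> (I k))\<^sup>2"
    using J Im by (subst \<mu>.finite_measure_finite_Union) auto
  also have "\<dots> \<le> (\<Sum>k\<in>J. (measure \<mu> (I k))\<^sup>2) * card J" by (rule sum_squared_le_sum_of_squares)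
  also have "\<dots> \<le> (exp (1/2) * (C * ((4 / (1 - a) + 1) * r powr a))) * card J"
    using sumsq by (intro mult_right_mono) auto
  finally show ?thesis by (simp only: mult_ac)
qed

text \<open>Partners j are sought on both sides of k because h may have either sign. Scaling the
  threshold by the actual distance gives every pair the same probability, at the level belonging to
  scale n. The range 2 * 2^q leaves room for rounding both ends of an increment of length at most
  2^-n.\<close>

definition bad_cell :: "real \<Rightarrow> nat \<Rightarrow> nat \<Rightarrow> (real \<Rightarrow> real) \<Rightarrow> nat \<Rightarrow> bool" where
  "bad_cell a q n f k \<longleftrightarrow> (\<exists>j\<le>2 ^ (n + q). j \<noteq> k \<and> \<bar>real j - real k\<bar> \<le> 2 * 2 ^ q \<and>
     rapid_threshold a n * sqrt (\<bar>real j - real k\<bar> / 2 ^ (n + q)) \<le> \<bar>f (real j / 2 ^ (n + q)) - f (real k / 2 ^ (n + q))\<bar>)"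

lemma rapid_threshold_tail:
  assumes "0 \<le> a"
  shows "hit_prob a n \<le> 2 * 2 powr (- (a\<^sup>2) * real n)"
proof -
  have "hit_prob a n \<le> 2 * exp (- (rapid_threshold a n)\<^sup>2 / 2)"
    unfolding hit_prob_def using assms by (intro gauss_tail_upper) (simp add: rapid_threshold_def)
  also have "exp (- (rapid_threshold a n)\<^sup>2 / 2) = 2 powr (- (a\<^sup>2) * real n)"
    by (simp add: rapid_threshold_def power_mult_distrib powr_def)
  finally show ?thesis .
qed

context brownian_motion_01
begin

text \<open>Union bound over at most 4 * 2^q + 1 \<le> 5 * 2^q partners j, each with probability
  exactly \<open>hit_prob a n\<close> by Brownian scaling.\<close>

lemma bad_cell_prob:
  assumes a: "0 \<le> a" and k: "k \<le> 2 ^ (n + q)"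
  shows "{\<omega> \<in> space M. bad_cell a q n (\<lambda>t. X t \<omega>) k} \<in> events"
    and "prob {\<omega> \<in> space M. bad_cell a q n (\<lambda>t. X t \<omega>) k} \<le> 10 * 2 ^ q * 2 powr (- (a\<^sup>2) * real n)"
proof -
  let ?b = "2 ^ (n + q) :: real"
  define J where "J = {j. j \<le> 2 ^ (n + q) \<and> j \<noteq> k \<and> \<bar>real j - real k\<bar> \<le> 2 * 2 ^ q}"
  define E where "E j = {\<omega> \<in> space M. rapid_threshold a n * sqrt (\<bar>real j - real k\<bar> / ?b) \<le> \<bar>X (real j / ?b) \<omega> - X (real k / ?b) \<omega>\<bar>}" for j
  have J: "finite J" by (rule finite_subset[of _ "{..2 ^ (n + q)}"]) (auto simp: J_def)
  have card: "real (card J) \<le> 5 * 2 ^ q"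
  proof -
    have "J \<subseteq> {k - 2 * 2 ^ q..k + 2 * 2 ^ q}"
    proof
      fix j assume "j \<in> J"
      then have "real j \<le> real (k + 2 * 2 ^ q)" "real k \<le> real (j + 2 * 2 ^ q)" by (auto simp: J_def abs_le_iff)
      then have "j \<le> k + 2 * 2 ^ q" "k \<le> j + 2 * 2 ^ q" by (simp_all only: of_nat_le_iff)
      then show "j \<in> {k - 2 * 2 ^ q..k + 2 * 2 ^ q}" by auto
    qed
    then have "card J \<le> card {k - 2 * 2 ^ q..k + 2 * 2 ^ q}" by (intro card_mono) auto
    also have "\<dots> \<le> 4 * 2 ^ q + 1" by simp
    also have "\<dots> \<le> 5 * 2 ^ q" by simp
    finally have "real (card J) \<le> real (5 * 2 ^ q)" by (rule of_nat_mono)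
    then show ?thesis by simp
  qed
  have in01: "real j / ?b \<in> {0..1}" if "j \<le> 2 ^ (n + q)" for j
  proof -
    have "real j \<le> real (2 ^ (n + q))" using that by (rule of_nat_mono)
    then show ?thesis by simp
  qed
  have Em: "E j \<in> events" if "j \<in> J" for j
  proof -
    have [measurable]: "(\<lambda>\<omega>. X (real j / ?b) \<omega> - X (real k / ?b) \<omega>) \<in> borel_measurable M"
      using in01[of j] in01[OF k] that by (intro increment_measurable) (auto simp: J_def)
    show ?thesis unfolding E_def by measurable
  qed
  have Ep: "prob (E j) \<le> 2 * 2 powr (- (a\<^sup>2) * real n)" if "j \<in> J" for j
  proof -
    have jb: "j \<le> 2 ^ (n + q)" "j \<noteq> k" using that by (auto simp: J_def)
    have "prob (E j) = gauss_tail (rapid_threshold a n)"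
    proof (cases "k < j")
      case True
      then have "E j = {\<omega> \<in> space M. \<bar>X (real j / ?b) \<omega> - X (real k / ?b) \<omega>\<bar> \<ge> rapid_threshold a n * sqrt (real j / ?b - real k / ?b)}"
        by (auto simp: E_def diff_divide_distrib)
      also have "prob \<dots> = gauss_tail (rapid_threshold a n)"
        using True in01[OF jb(1)] by (intro prob_increment_ge) (auto simp: divide_strict_right_mono)
      finally show ?thesis .
    next
      case False
      then have "E j = {\<omega> \<in> space M. \<bar>X (real k / ?b) \<omega> - X (real j / ?b) \<omega>\<bar> \<ge> rapid_threshold a n * sqrt (real k / ?b - real j / ?b)}"
        by (auto simp: E_def diff_divide_distrib abs_minus_commute)
      also have "prob \<dots> = gauss_tail (rapid_threshold a n)"
        using False jb in01[OF k] by (intro prob_increment_ge) (auto simp: divide_strict_right_mono)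
      finally show ?thesis .
    qed
    then show ?thesis using rapid_threshold_tail[OF a, of n] by (simp add: hit_prob_def)
  qed
  have eq: "{\<omega> \<in> space M. bad_cell a q n (\<lambda>t. X t \<omega>) k} = (\<Union>j\<in>J. E j)"
    by (auto simp: bad_cell_def J_def E_def)
  show "{\<omega> \<in> space M. bad_cell a q n (\<lambda>t. X t \<omega>) k} \<in> events"
    unfolding eq using J Em by auto
  have "prob (\<Union>j\<in>J. E j) \<le> (\<Sum>j\<in>J. prob (E j))"
    using J Em by (intro finite_measure_subadditive_finite) auto
  also have "\<dots> \<le> real (card J) * (2 * 2 powr (- (a\<^sup>2) * real n))"
    using Ep by (rule sum_bounded_above)
  also have "\<dots> \<le> 5 * 2 ^ q * (2 * 2 powr (- (a\<^sup>2) * real n))"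
    using card by (intro mult_right_mono) auto
  finally show "prob {\<omega> \<in> space M. bad_cell a q n (\<lambda>t. X t \<omega>) k} \<le> 10 * 2 ^ q * 2 powr (- (a\<^sup>2) * real n)"
    unfolding eq by simp
qed

text \<open>First moment: 2^(n+q) + 1 cells of probability of order 2^(-a^2 n) give an expected
  count of order 2^((1 - a^2) n), and s > 1 - a^2 makes Markov's bound summable in n.\<close>

lemma AE_bad_cells_count:
  assumes a: "0 \<le> a" and s: "1 - a\<^sup>2 < s"
  shows "AE \<omega> in M. \<forall>\<^sub>F n in sequentially.
    real (card {k. k \<le> 2 ^ (n + q) \<and> bad_cell a q n (\<lambda>t. X t \<omega>) k}) \<le> 2 powr (s * real n)"
proof -
  define B where "B n k = {\<omega> \<in> space M. bad_cell a q n (\<lambda>t. X t \<omega>) k}" for n k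
  define N where "N n \<omega> = (\<Sum>k\<le>2 ^ (n + q). indicat_real (B n k) \<omega>)" for n \<omega>
  define A where "A n = {\<omega> \<in> space M. 2 powr (s * real n) \<le> N n \<omega>}" for n
  have Bm: "B n k \<in> events" and Bp: "prob (B n k) \<le> 10 * 2 ^ q * 2 powr (- (a\<^sup>2) * real n)"
    if "k \<le> 2 ^ (n + q)" for n k
    unfolding B_def using bad_cell_prob[OF a that] by auto
  have Nint: "integrable M (N n)" for n
    unfolding N_def using Bm by (intro Bochner_Integration.integrable_sum) (auto simp: emeasure_eq_measure)
  have N_card: "N n \<omega> = real (card {k. k \<le> 2 ^ (n + q) \<and> bad_cell a q n (\<lambda>t. X t \<omega>) k})" if "\<omega> \<in> space M" for n \<omega>
  proof -
    have "N n \<omega> = (\<Sum>k\<le>2 ^ (n + q). if bad_cell a q n (\<lambda>t. X t \<omega>) k then 1 else 0)"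
      unfolding N_def using that by (intro sum.cong) (auto simp: B_def)
    also have "\<dots> = (\<Sum>k\<in>{k\<in>{..2 ^ (n + q)}. bad_cell a q n (\<lambda>t. X t \<omega>) k}. 1)"
      by (rule sum.inter_filter[symmetric]) simp
    finally show ?thesis by simp
  qed
  have EN: "expectation (N n) \<le> 20 * 4 ^ q * 2 powr ((1 - a\<^sup>2) * real n)" for n
  proof -
    have "expectation (N n) = (\<Sum>k\<le>2 ^ (n + q). prob (B n k))"
      unfolding N_def using Bm by (subst Bochner_Integration.integral_sum) (auto simp: emeasure_eq_measure)
    also have "\<dots> \<le> (\<Sum>k\<le>(2::nat) ^ (n + q). 10 * 2 ^ q * 2 powr (- (a\<^sup>2) * real n))"
      using Bp by (intro sum_mono) auto
    also have "\<dots> = (2 ^ (n + q) + 1) * (10 * 2 ^ q * 2 powr (- (a\<^sup>2) * real n))" by simp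
    also have "\<dots> \<le> (2 * 2 ^ (n + q)) * (10 * 2 ^ q * 2 powr (- (a\<^sup>2) * real n))"
      by (intro mult_right_mono) auto
    also have "\<dots> = 20 * (2 ^ q * 2 ^ q) * (2 ^ n * 2 powr (- (a\<^sup>2) * real n))" by (simp add: power_add)
    also have "2 ^ n * 2 powr (- (a\<^sup>2) * real n) = 2 powr ((1 - a\<^sup>2) * real n)"
      by (simp add: powr_realpow[symmetric] powr_add[symmetric] algebra_simps)
    also have "(2 ^ q * 2 ^ q :: real) = 4 ^ q" by (simp flip: power_mult_distrib)
    finally show ?thesis .
  qed
  have "AE \<omega> in M. \<forall>\<^sub>F n in sequentially. \<omega> \<notin> A n"
  proof (rule AE_eventually_not_in[where b = "\<lambda>n. 20 * 4 ^ q * (2 powr (1 - a\<^sup>2 - s)) ^ n" and ?n0.0 = 0])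
    show "A n \<in> events" for n
      unfolding A_def using borel_measurable_integrable[OF Nint[of n]] by measurable
    show "prob (A n) \<le> 20 * 4 ^ q * (2 powr (1 - a\<^sup>2 - s)) ^ n" for n
    proof -
      have "prob (A n) \<le> (1 / 2 powr (s * real n)) * expectation (N n)"
      proof -
        have "0 \<le> N n \<omega>" for \<omega> by (simp add: N_def sum_nonneg)
        then show ?thesis
          unfolding A_def using integral_Markov_inequality_measure[OF Nint[of n], of "{}" "2 powr (s * real n)"]
          by simp
      qed
      also have "\<dots> \<le> (1 / 2 powr (s * real n)) * (20 * 4 ^ q * 2 powr ((1 - a\<^sup>2) * real n))"
        using EN by (intro mult_left_mono) auto
      also have "\<dots> = 20 * 4 ^ q * (2 powr ((1 - a\<^sup>2) * real n) / 2 powr (s * real n))" by simp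
      also have "2 powr ((1 - a\<^sup>2) * real n) / 2 powr (s * real n) = (2 powr (1 - a\<^sup>2 - s)) powr real n"
        unfolding powr_diff[symmetric] powr_powr by (simp add: algebra_simps)
      also have "\<dots> = (2 powr (1 - a\<^sup>2 - s)) ^ n" by (rule powr_realpow) simp
      finally show ?thesis .
    qed
    have "2 powr (1 - a\<^sup>2 - s) < 2 powr 0" using s by (subst powr_less_cancel_iff) auto
    then show "summable (\<lambda>n. 20 * 4 ^ q * (2 powr (1 - a\<^sup>2 - s)) ^ n)"
      by (intro summable_mult summable_geometric) simp
  qed
  with AE_space show ?thesis
  proof eventually_elim
    case (elim \<omega>)
    from elim(2) show ?case
      by eventually_elim (use elim(1) in \<open>auto simp: A_def N_card not_le\<close>)
  qed
qed

end

section \<open>Rapid points fall into bad cells at infinitely many scales\<close>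

lemma rapid_pointsD:
  assumes "t \<in> rapid_points \<alpha> f" "\<alpha>' < \<alpha>" "0 < \<delta>"
  obtains h where "h \<noteq> 0" "\<bar>h\<bar> < \<delta>" "t + h \<in> {0..1}"
    "\<alpha>' < \<bar>f (t + h) - f t\<bar> / sqrt (2 * \<bar>h\<bar> * ln (1 / \<bar>h\<bar>))"
proof -
  let ?F = "at 0 within {h. t + h \<in> {0..1}}"
  let ?g = "\<lambda>h. ereal (\<bar>f (t + h) - f t\<bar> / sqrt (2 * \<bar>h\<bar> * ln (1 / \<bar>h\<bar>)))"
  have "\<not> (\<forall>\<^sub>F h in ?F. ?g h \<le> ereal \<alpha>')"
  proof
    assume "\<forall>\<^sub>F h in ?F. ?g h \<le> ereal \<alpha>'"
    then have "Limsup ?F ?g \<le> ereal \<alpha>'" by (rule Limsup_bounded)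
    moreover have "ereal \<alpha> \<le> Limsup ?F ?g" using assms(1) by (simp add: rapid_points_def)
    ultimately have "ereal \<alpha> \<le> ereal \<alpha>'" by (rule order_trans[rotated])
    then show False using assms(2) by simp
  qed
  then obtain h where "t + h \<in> {0..1}" "h \<noteq> 0" "dist h 0 < \<delta>" "\<not> ?g h \<le> ereal \<alpha>'"
    unfolding eventually_at using assms(3) by blast
  then show ?thesis by (intro that[of h]) auto
qed

lemma dyadic_scale:
  fixes x :: real
  assumes "0 < x" "x < 1 / 2 ^ m"
  obtains n where "m \<le> n" "1 / 2 ^ Suc n < x" "x \<le> 1 / 2 ^ n"
proof -
  define n where "n = (LEAST n. 1 / 2 ^ Suc n < x)"
  obtain i where "(1 / 2) ^ i < x" using real_arch_pow_inv[of x "1/2"] assms by auto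
  moreover have "1 / 2 ^ Suc i = (1 / 2 :: real) ^ i / 2" by (simp add: power_one_over)
  moreover have "0 < (1 / 2 :: real) ^ i" by simp
  ultimately have "1 / 2 ^ Suc i < x" by linarith
  then have 1: "1 / 2 ^ Suc n < x" unfolding n_def by (rule LeastI)
  have 2: "x \<le> 1 / 2 ^ n"
  proof (cases n)
    case 0
    have "1 / 2 ^ m \<le> (1::real)" by simp
    then have "x \<le> 1" using assms by linarith
    then show ?thesis using 0 by simp
  next
    case (Suc i)
    then have "\<not> 1 / 2 ^ Suc i < x" using not_less_Least[of i "\<lambda>n. 1 / 2 ^ Suc n < x"] by (simp add: n_def)
    then show ?thesis using Suc by simp
  qed
  have "1 / 2 ^ Suc n < (1 / 2 ^ m :: real)" using 1 assms by linarith
  then have "(2::real) ^ m < 2 ^ Suc n" by (simp add: field_simps)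
  then have "m < Suc n" by (rule power_less_imp_less_exp[rotated]) simp
  then show ?thesis using 1 2 by (intro that[of n]) auto
qed

text \<open>An increment of length |h| between 2^-(n+1) and 2^-n is moved to the grid by rounding
  both ends down. With e = 2^-n and d the rounded length, each end costs one modulus term, and e
  \<le> 4 d turns 22 * sqrt e into 44 * sqrt d, so 88 = 2 * 44. The factor 1 - 4 / 2^q compares d
  with |h|.\<close>

lemma rapid_bad_cell:
  assumes mod: "has_modulus f" and t: "t \<in> rapid_points \<alpha> f" and \<alpha>: "0 \<le> \<alpha>'" "\<alpha>' < \<alpha>" and q: "3 \<le> q"
    and ev: "\<forall>\<^sub>F n in sequentially. rapid_threshold a n + 88 * sqrt ((real n + real q) / 2 ^ q)
      \<le> \<alpha>' * sqrt (2 * (1 - 4 / 2 ^ q) * real n * ln 2)"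
  shows "\<exists>\<^sub>F n in sequentially. bad_cell a q n f (nat \<lfloor>t * 2 ^ (n + q)\<rfloor>)"
  unfolding frequently_sequentially
proof
  fix m :: nat
  have "\<forall>\<^sub>F n in sequentially. \<forall>s\<in>{0..1}. \<forall>t\<in>{0..1}.
     \<bar>s - t\<bar> \<le> 1 / 2 ^ (n + q) \<longrightarrow> \<bar>f s - f t\<bar> \<le> 22 * sqrt (real (n + q) / 2 ^ (n + q))"
    using mod unfolding has_modulus_def by (rule sequentially_offset)
  with ev have "\<forall>\<^sub>F n in sequentially. (\<forall>s\<in>{0..1}. \<forall>t\<in>{0..1}.
     \<bar>s - t\<bar> \<le> 1 / 2 ^ (n + q) \<longrightarrow> \<bar>f s - f t\<bar> \<le> 22 * sqrt (real (n + q) / 2 ^ (n + q))) \<and>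
     rapid_threshold a n + 88 * sqrt ((real n + real q) / 2 ^ q) \<le> \<alpha>' * sqrt (2 * (1 - 4 / 2 ^ q) * real n * ln 2)"
    by eventually_elim auto
  then obtain m1 where m1: "\<And>n. m1 \<le> n \<Longrightarrow> (\<forall>s\<in>{0..1}. \<forall>t\<in>{0..1}.
     \<bar>s - t\<bar> \<le> 1 / 2 ^ (n + q) \<longrightarrow> \<bar>f s - f t\<bar> \<le> 22 * sqrt (real (n + q) / 2 ^ (n + q))) \<and>
     rapid_threshold a n + 88 * sqrt ((real n + real q) / 2 ^ q) \<le> \<alpha>' * sqrt (2 * (1 - 4 / 2 ^ q) * real n * ln 2)"
    unfolding eventually_sequentially by blast
  obtain h where h: "h \<noteq> 0" "\<bar>h\<bar> < 1 / 2 ^ max m m1" "t + h \<in> {0..1}"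
    "\<alpha>' < \<bar>f (t + h) - f t\<bar> / sqrt (2 * \<bar>h\<bar> * ln (1 / \<bar>h\<bar>))"
    using rapid_pointsD[OF t \<alpha>(2), of "1 / 2 ^ max m m1"] by auto
  obtain n where n: "max m m1 \<le> n" "1 / 2 ^ Suc n < \<bar>h\<bar>" "\<bar>h\<bar> \<le> 1 / 2 ^ n"
    using dyadic_scale[of "\<bar>h\<bar>" "max m m1"] h by auto
  have md: "\<bar>f s - f t\<bar> \<le> 22 * sqrt (real (n + q) / 2 ^ (n + q))"
    if "s \<in> {0..1}" "t \<in> {0..1}" "\<bar>s - t\<bar> \<le> 1 / 2 ^ (n + q)" for s t
    using m1[of n] n that by auto
  have ineq: "rapid_threshold a n + 88 * sqrt ((real n + real q) / 2 ^ q) \<le> \<alpha>' * sqrt (2 * (1 - 4 / 2 ^ q) * real n * ln 2)"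
    using m1[of n] n by auto
  have t01: "t \<in> {0..1}" using t by (simp add: rapid_points_def)
  let ?b = "2 ^ (n + q) :: real"
  define e where "e = (1 / 2 ^ n :: real)"
  have e0: "0 < e" by (simp add: e_def)
  have he: "e / 2 < \<bar>h\<bar>" "\<bar>h\<bar> \<le> e" using n by (simp_all add: e_def)
  have bq: "1 / ?b = e * (1 / 2 ^ q)" by (simp add: e_def power_add)
  have q8: "1 / 2 ^ q \<le> (1/8 :: real)"
    using power_decreasing[of 3 q "1/2::real"] q by (simp add: power_one_over power3_eq_cube)
  have eq8: "e * (1 / 2 ^ q) \<le> e * (1/8)" using e0 q8 by (intro mult_left_mono) auto
  have grid: "real (nat \<lfloor>u * ?b\<rfloor>) / ?b \<in> {0..1}" "\<bar>real (nat \<lfloor>u * ?b\<rfloor>) / ?b - u\<bar> \<le> e * (1 / 2 ^ q)"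
    "real (nat \<lfloor>u * ?b\<rfloor>) / ?b \<le> u" "u - e * (1 / 2 ^ q) \<le> real (nat \<lfloor>u * ?b\<rfloor>) / ?b"
    "nat \<lfloor>u * ?b\<rfloor> \<le> 2 ^ (n + q)" if u: "u \<in> {0..1}" for u
  proof -
    have r: "real (nat \<lfloor>u * ?b\<rfloor>) = of_int \<lfloor>u * ?b\<rfloor>" using u by simp
    have le: "real (nat \<lfloor>u * ?b\<rfloor>) \<le> u * ?b" unfolding r by simp
    then have le': "real (nat \<lfloor>u * ?b\<rfloor>) / ?b \<le> u" by (simp add: divide_le_eq)
    have "u * ?b - 1 \<le> real (nat \<lfloor>u * ?b\<rfloor>)" unfolding r by linarith
    then have "(u * ?b - 1) / ?b \<le> real (nat \<lfloor>u * ?b\<rfloor>) / ?b" by (intro divide_right_mono) auto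
    then have ge': "u - e * (1 / 2 ^ q) \<le> real (nat \<lfloor>u * ?b\<rfloor>) / ?b" unfolding bq[symmetric] by (simp add: diff_divide_distrib)
    show "real (nat \<lfloor>u * ?b\<rfloor>) / ?b \<le> u" "u - e * (1 / 2 ^ q) \<le> real (nat \<lfloor>u * ?b\<rfloor>) / ?b" by fact+
    then show "\<bar>real (nat \<lfloor>u * ?b\<rfloor>) / ?b - u\<bar> \<le> e * (1 / 2 ^ q)" by linarith
    have "0 \<le> real (nat \<lfloor>u * ?b\<rfloor>) / ?b" by simp
    moreover have "real (nat \<lfloor>u * ?b\<rfloor>) / ?b \<le> 1" using le' u by (meson atLeastAtMost_iff order_trans)
    ultimately show "real (nat \<lfloor>u * ?b\<rfloor>) / ?b \<in> {0..1}" unfolding atLeastAtMost_iff by blast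
    have "u * ?b \<le> 1 * ?b" using u by (intro mult_right_mono) auto
    then have "real (nat \<lfloor>u * ?b\<rfloor>) \<le> real (2 ^ (n + q))"
      using le unfolding of_nat_power of_nat_numeral mult_1_left by (rule order_trans[rotated])
    then show "nat \<lfloor>u * ?b\<rfloor> \<le> 2 ^ (n + q)" by (simp only: of_nat_le_iff)
  qed
  define k where "k = nat \<lfloor>t * ?b\<rfloor>"
  define j where "j = nat \<lfloor>(t + h) * ?b\<rfloor>"
  define x where "x = real k / ?b"
  define y where "y = real j / ?b"
  define d where "d = \<bar>y - x\<bar>"
  note gx = grid[OF t01, folded k_def, folded x_def] and gy = grid[OF h(3), folded j_def, folded y_def]
  \<comment> \<open>Both ends move down by at most e / 2^q, so the shifts partly cancel and the
    length changes by one such amount, not two.\<close>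
  have dh: "d \<le> \<bar>h\<bar> + e * (1 / 2 ^ q)" "\<bar>h\<bar> - e * (1 / 2 ^ q) \<le> d"
    using gx(3,4) gy(3,4) unfolding d_def by linarith+
  \<comment> \<open>Here \<open>3 \<le> q\<close> enters: |h| > e / 2 and a loss of at most e / 8
    leave more than e / 4.\<close>
  have d4: "e / 4 \<le> d" using dh(2) he(1) eq8 e0 by linarith
  have d0: "0 < d" using d4 e0 by linarith
  have jk: "\<bar>real j - real k\<bar> = d * ?b" by (simp add: d_def x_def y_def abs_divide flip: diff_divide_distrib)
  have dist: "\<bar>real j - real k\<bar> \<le> 2 * 2 ^ q"
  proof -
    have "d \<le> e * 2" using dh(1) he(2) eq8 e0 by linarith
    then have "d * ?b \<le> (e * 2) * ?b" by (intro mult_right_mono) auto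
    also have "\<dots> = 2 * 2 ^ q" by (simp add: e_def power_add)
    finally show ?thesis unfolding jk .
  qed
  have main: "rapid_threshold a n * sqrt d \<le> \<bar>f y - f x\<bar>"
  proof -
    have h1: "\<bar>h\<bar> < 1"
      using h(2) by (rule less_le_trans) simp
    have pos: "0 < sqrt (2 * \<bar>h\<bar> * ln (1 / \<bar>h\<bar>))"
      using h(1) h1 by (auto intro!: mult_pos_pos ln_gt_zero)
    have "real n * ln 2 = ln (2 ^ n)" by (simp add: ln_realpow)
    also have "\<dots> \<le> ln (1 / \<bar>h\<bar>)"
      using n(3) h(1) by (subst ln_le_cancel_iff) (auto simp: field_simps)
    finally have ln: "real n * ln 2 \<le> ln (1 / \<bar>h\<bar>)" .
    have hd: "(1 - 4 / 2 ^ q) * d \<le> \<bar>h\<bar>"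
    proof -
      have "e * (1 / 2 ^ q) \<le> (d * 4) * (1 / 2 ^ q)" using d4 by (intro mult_right_mono) auto
      then show ?thesis using dh(1) by (simp add: algebra_simps)
    qed
    have "\<alpha>' * (sqrt (2 * (1 - 4 / 2 ^ q) * real n * ln 2) * sqrt d) \<le> \<alpha>' * sqrt (2 * \<bar>h\<bar> * ln (1 / \<bar>h\<bar>))"
    proof (rule mult_left_mono[OF _ \<alpha>(1)])
      have "(2 * ((1 - 4 / 2 ^ q) * d)) * (real n * ln 2) \<le> (2 * \<bar>h\<bar>) * ln (1 / \<bar>h\<bar>)"
        by (rule mult_mono) (use hd ln in auto)
      also have "(2 * ((1 - 4 / 2 ^ q) * d)) * (real n * ln 2) = 2 * (1 - 4 / 2 ^ q) * real n * ln 2 * d"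
        by (simp only: mult_ac)
      finally show "sqrt (2 * (1 - 4 / 2 ^ q) * real n * ln 2) * sqrt d \<le> sqrt (2 * \<bar>h\<bar> * ln (1 / \<bar>h\<bar>))"
        unfolding real_sqrt_mult[symmetric] by (rule real_sqrt_le_mono)
    qed
    also have "\<dots> \<le> \<bar>f (t + h) - f t\<bar>"
      using h(4) pos by (simp add: less_divide_eq less_imp_le)
    finally have big: "\<alpha>' * sqrt (2 * (1 - 4 / 2 ^ q) * real n * ln 2) * sqrt d \<le> \<bar>f (t + h) - f t\<bar>"
      by (simp only: mult.assoc)
    have small: "22 * sqrt (real (n + q) / ?b) \<le> 44 * sqrt ((real n + real q) / 2 ^ q) * sqrt d"
    proof -
      have "real (n + q) / ?b = (real n + real q) / 2 ^ q * e" by (simp add: e_def power_add)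
      also have "\<dots> \<le> (real n + real q) / 2 ^ q * (4 * d)" using d4 by (intro mult_left_mono) auto
      finally have "sqrt (real (n + q) / ?b) \<le> sqrt ((real n + real q) / 2 ^ q * (4 * d))" by (rule real_sqrt_le_mono)
      also have "\<dots> = sqrt ((real n + real q) / 2 ^ q) * (2 * sqrt d)" by (simp only: real_sqrt_mult real_sqrt_four)
      finally show ?thesis by linarith
    qed
    have "\<bar>f x - f t\<bar> \<le> 22 * sqrt (real (n + q) / ?b)"
      using gx(1,2) t01 by (intro md) (auto simp: bq)
    moreover have "\<bar>f y - f (t + h)\<bar> \<le> 22 * sqrt (real (n + q) / ?b)"
      using gy(1,2) h(3) by (intro md) (auto simp: bq)
    ultimately have "\<alpha>' * sqrt (2 * (1 - 4 / 2 ^ q) * real n * ln 2) * sqrt d - 88 * sqrt ((real n + real q) / 2 ^ q) * sqrt d \<le> \<bar>f y - f x\<bar>"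
      using big small by linarith
    moreover have "(rapid_threshold a n + 88 * sqrt ((real n + real q) / 2 ^ q)) * sqrt d
      \<le> \<alpha>' * sqrt (2 * (1 - 4 / 2 ^ q) * real n * ln 2) * sqrt d"
      using ineq d0 by (intro mult_right_mono) auto
    ultimately show ?thesis unfolding distrib_right by linarith
  qed
  have "bad_cell a q n f k" unfolding bad_cell_def
  proof (intro exI[of _ j] conjI)
    show "j \<le> 2 ^ (n + q)" by (rule gy(5))
    show "j \<noteq> k" using d0 jk by auto
    show "\<bar>real j - real k\<bar> \<le> 2 * 2 ^ q" by (rule dist)
    have "\<bar>real j - real k\<bar> / ?b = d" unfolding jk by simp
    then show "rapid_threshold a n * sqrt (\<bar>real j - real k\<bar> / ?b) \<le> \<bar>f (real j / ?b) - f (real k / ?b)\<bar>"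
      using main by (simp add: x_def y_def)
  qed
  then show "\<exists>n\<ge>m. bad_cell a q n f (nat \<lfloor>t * 2 ^ (n + q)\<rfloor>)"
    using n(1) by (intro exI[of _ n]) (auto simp: k_def)
qed

text \<open>The same two limits as in \<open>scale_ratio_exists\<close> with the roles exchanged:
  now a lies below \<alpha>', and the rounding losses are charged to their gap.\<close>

lemma scale_ratio_exists':
  assumes "a < \<alpha>'"
  shows "\<exists>q\<ge>3. \<forall>\<^sub>F n in sequentially. rapid_threshold a n + 88 * sqrt ((real n + real q) / 2 ^ q)
      \<le> \<alpha>' * sqrt (2 * (1 - 4 / 2 ^ q) * real n * ln 2)"
proof -
  let ?L = "\<lambda>q::nat. \<alpha>' * sqrt (2 * (1 - 4 * (1 / 2 ^ q)) * ln 2) - 88 * sqrt (1 / 2 ^ q)"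
  have "(\<lambda>q. (1 / 2 :: real) ^ q) \<longlonglongrightarrow> 0" by (rule LIMSEQ_realpow_zero) auto
  then have z: "(\<lambda>q. 1 / 2 ^ q :: real) \<longlonglongrightarrow> 0" by (simp add: power_one_over)
  have "?L \<longlonglongrightarrow> \<alpha>' * sqrt (2 * (1 - 4 * 0) * ln 2) - 88 * sqrt 0"
    by (intro tendsto_intros z)
  moreover have "a * sqrt (2 * ln 2) < \<alpha>' * sqrt (2 * (1 - 4 * 0) * ln 2) - 88 * sqrt 0"
    using assms by simp
  ultimately have "\<forall>\<^sub>F q in sequentially. a * sqrt (2 * ln 2) < ?L q"
    by (rule order_tendstoD(1))
  with eventually_ge_at_top[of 3] have "\<forall>\<^sub>F q in sequentially. 3 \<le> q \<and> a * sqrt (2 * ln 2) < ?L q"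
    by eventually_elim auto
  then obtain q where q: "3 \<le> q" "a * sqrt (2 * ln 2) < ?L q"
    using eventually_happens by fastforce
  have "(\<lambda>n. a * sqrt (2 * ln 2) + 88 * sqrt ((1 + real q / real n) / 2 ^ q))
      \<longlonglongrightarrow> a * sqrt (2 * ln 2) + 88 * sqrt ((1 + 0) / 2 ^ q)"
    by (intro tendsto_intros lim_const_over_n) auto
  then have "\<forall>\<^sub>F n in sequentially. a * sqrt (2 * ln 2) + 88 * sqrt ((1 + real q / real n) / 2 ^ q)
      < \<alpha>' * sqrt (2 * (1 - 4 / 2 ^ q) * ln 2)"
    by (rule order_tendstoD(2)) (use q in simp)
  with eventually_gt_at_top[of 0] have "\<forall>\<^sub>F n in sequentially. rapid_threshold a n + 88 * sqrt ((real n + real q) / 2 ^ q)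
      \<le> \<alpha>' * sqrt (2 * (1 - 4 / 2 ^ q) * real n * ln 2)"
  proof eventually_elim
    case (elim n)
    have "2 * (1 - 4 / 2 ^ q) * real n * ln 2 = (2 * (1 - 4 / 2 ^ q) * ln 2) * real n"
      "(real n + real q) / 2 ^ q = (1 + real q / real n) / 2 ^ q * real n"
      "2 * real n * ln 2 = (2 * ln 2) * real n"
      using elim(1) by (simp_all add: divide_simps distrib_left)
    then show ?case unfolding rapid_threshold_def
      using mult_right_mono[OF less_imp_le[OF elim(2)], of "sqrt (real n)"]
      by (simp only: real_sqrt_mult[of _ "real n"] distrib_right) (simp add: mult.assoc)
  qed
  with q(1) show ?thesis by blast
qed

section \<open>Measures with fast Fourier decay do not charge the rapid points\<close>

lemma fourier_decayD:
  assumes fin: "finite_measure \<mu>" and s: "sets \<mu> = sets borel" and dec: "fourier_decay \<mu> (c / 2)"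
    and c': "0 < c'" "c' \<le> c"
  shows "\<exists>C\<ge>0. \<forall>u. (cmod (char \<mu> u))\<^sup>2 \<le> C * (1 + \<bar>u\<bar>) powr (- c')"
proof -
  interpret finite_measure \<mu> by fact
  define m where "m = measure \<mu> UNIV"
  have bd: "cmod (char \<mu> u) \<le> m" for u
  proof -
    have "cmod (char \<mu> u) \<le> (LINT x|\<mu>. cmod (iexp (u * x)))"
      unfolding char_def by (rule integral_norm_bound)
    then show ?thesis using sets_eq_imp_space_eq[OF s] by (simp add: m_def)
  qed
  have "\<forall>\<^sub>F u in at_infinity. norm (norm (char \<mu> u)) \<le> 1 * norm (\<bar>u\<bar> powr (- (c / 2)))"
    using dec unfolding fourier_decay_def by (rule landau_o.smallD) simp
  then obtain R where R: "\<And>u. R \<le> \<bar>u\<bar> \<Longrightarrow> cmod (char \<mu> u) \<le> \<bar>u\<bar> powr (- (c / 2))"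
    unfolding eventually_at_infinity by auto
  define S where "S = max R 1"
  have S: "1 \<le> S" "R \<le> S" by (auto simp: S_def)
  show ?thesis
  \<comment> \<open>The first summand serves |u| \<ge> S, where (1 + |u|) / 2 \<le> |u|; the second
    serves |u| < S, where the transform is at most the total mass.\<close>
  proof (intro exI[of _ "2 powr c' + m\<^sup>2 * (1 + S) powr c'"] conjI allI)
    fix u :: real
    show "(cmod (char \<mu> u))\<^sup>2 \<le> (2 powr c' + m\<^sup>2 * (1 + S) powr c') * (1 + \<bar>u\<bar>) powr (- c')"
    proof (cases "S \<le> \<bar>u\<bar>")
      case True
      have "(cmod (char \<mu> u))\<^sup>2 \<le> (\<bar>u\<bar> powr (- (c / 2)))\<^sup>2"
        using R[of u] True S by (intro power_mono) auto
      also have "\<dots> = \<bar>u\<bar> powr (- c)"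
        by (simp add: power2_eq_square powr_add[symmetric])
      also have "\<dots> \<le> \<bar>u\<bar> powr (- c')" using True S c' by (intro powr_mono) auto
      also have "\<dots> \<le> ((1 + \<bar>u\<bar>) / 2) powr (- c')" using True S c' by (intro powr_mono2') auto
      also have "\<dots> = (1 + \<bar>u\<bar>) powr (- c') / 2 powr (- c')" by (rule powr_divide)
      also have "\<dots> = 2 powr c' * (1 + \<bar>u\<bar>) powr (- c')"
        by (simp only: powr_minus divide_inverse inverse_inverse_eq mult.commute)
      also have "\<dots> \<le> (2 powr c' + m\<^sup>2 * (1 + S) powr c') * (1 + \<bar>u\<bar>) powr (- c')"
        by (intro mult_right_mono) auto
      finally show ?thesis .
    next
      case False
      have "(cmod (char \<mu> u))\<^sup>2 \<le> m\<^sup>2" using bd by (intro power_mono) auto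
      also have "\<dots> \<le> m\<^sup>2 * ((1 + S) powr c' * (1 + \<bar>u\<bar>) powr (- c'))"
      proof -
        have "(1 + \<bar>u\<bar>) powr c' \<le> (1 + S) powr c'" using False c' by (intro powr_mono2) auto
        then have "1 \<le> (1 + S) powr c' / (1 + \<bar>u\<bar>) powr c'"
          using abs_ge_zero[of u] by (subst le_divide_eq_1_pos) (auto simp: add_nonneg_eq_0_iff)
        then have "m\<^sup>2 * 1 \<le> m\<^sup>2 * ((1 + S) powr c' / (1 + \<bar>u\<bar>) powr c')" by (intro mult_left_mono) auto
        then show ?thesis by (simp add: powr_minus divide_inverse)
      qed
      also have "\<dots> \<le> (2 powr c' + m\<^sup>2 * (1 + S) powr c') * (1 + \<bar>u\<bar>) powr (- c')"
        by (simp add: distrib_right mult.assoc)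
      finally show ?thesis .
    qed
  qed simp
qed

text \<open>Deterministic: a path with the stated modulus and cell counts excludes all admissible K
  and c at once. The union of the bad cells of scale n has mass of order 2^((s - c') n / 2) under
  the measure in question. Borel-Cantelli for that measure, not for the probability, then says that
  almost no point lies in infinitely many of these unions, whereas every rapid point does.\<close>

lemma rapid_not_M_set:
  assumes mod: "has_modulus f" and \<alpha>: "0 \<le> \<alpha>'" "\<alpha>' < \<alpha>" and q: "3 \<le> q"
    and ev: "\<forall>\<^sub>F n in sequentially. rapid_threshold a n + 88 * sqrt ((real n + real q) / 2 ^ q)
      \<le> \<alpha>' * sqrt (2 * (1 - 4 / 2 ^ q) * real n * ln 2)"
    and cnt: "\<forall>\<^sub>F n in sequentially. real (card {k. k \<le> 2 ^ (n + q) \<and> bad_cell a q n f k}) \<le> 2 powr (s * real n)"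
    and s: "0 < s" "s < 1" "s < c" and K: "K \<subseteq> rapid_points \<alpha> f"
  shows "\<not> M_set (c / 2) K"
proof
  assume "M_set (c / 2) K"
  then obtain \<mu> where \<mu>: "carries K \<mu>" "fourier_decay \<mu> (c / 2)" by (auto simp: M_set_def)
  have fin: "finite_measure \<mu>" and sets: "sets \<mu> = sets borel" and nz: "emeasure \<mu> UNIV \<noteq> 0" and out: "emeasure \<mu> (- K) = 0"
    using \<mu>(1) by (auto simp: carries_def)
  interpret finite_measure \<mu> by fact
  have space: "space \<mu> = UNIV" using sets_eq_imp_space_eq[OF sets] by simp
  \<comment> \<open>At most c and strictly between s and 1: the energy estimate takes exponents
    below 1, summability over the scales asks for one above s.\<close>
  define c' where "c' = min c ((1 + s) / 2)"
  have c': "0 < c'" "c' < 1" "c' \<le> c" "s < c'" using s by (auto simp: c'_def min_less_iff_disj)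
  obtain C where C: "0 \<le> C" "\<And>u. (cmod (char \<mu> u))\<^sup>2 \<le> C * (1 + \<bar>u\<bar>) powr (- c')"
    using fourier_decayD[OF fin sets \<mu>(2) c'(1,3)] by auto
  define J where "J n = {k. k \<le> 2 ^ (n + q) \<and> bad_cell a q n f k}" for n
  \<comment> \<open>Half-open cells are disjoint and rounding down identifies the cell of a point;
    the index k = 2^(n+q) takes care of the time 1.\<close>
  define I where "I n k = {real k / 2 ^ (n + q)..<(real k + 1) / 2 ^ (n + q)}" for n k :: nat
  define A where "A n = (\<Union>k\<in>J n. I n k)" for n
  define B where "B = exp (1/2) * C * (4 / (1 - c') + 1)"
  have B: "0 \<le> B" using C c' by (simp add: B_def)
  have Jfin: "finite (J n)" for n by (rule finite_subset[of _ "{..2 ^ (n + q)}"]) (auto simp: J_def)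
  have I_floor: "k = nat \<lfloor>x * 2 ^ (n + q)\<rfloor>" if "x \<in> I n k" for x n k
  proof -
    have "real k \<le> x * 2 ^ (n + q)" "x * 2 ^ (n + q) < real k + 1"
      using that by (auto simp: I_def divide_le_eq less_divide_eq)
    then have "\<lfloor>x * 2 ^ (n + q)\<rfloor> = int k" by (intro floor_unique) auto
    then show ?thesis by simp
  qed
  have Am: "A n \<in> sets \<mu>" for n unfolding A_def I_def using Jfin sets by auto
  have meas: "(measure \<mu> (A n))\<^sup>2 \<le> real (card (J n)) * (B * (1 / 2 ^ (n + q)) powr c')" for n
    unfolding A_def B_def
  proof (rule measure_cells_le[OF fin sets c'(1,2) C])
    show "disjoint_family_on (I n) (J n)"
      unfolding disjoint_family_on_def using I_floor by blast
    show "\<bar>x - y\<bar> \<le> 1 / 2 ^ (n + q)" if "x \<in> I n k" "y \<in> I n k" for k x y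
      using that by (auto simp: I_def add_divide_distrib abs_le_iff)
  qed (auto simp: Jfin I_def)
  have "AE x in \<mu>. \<forall>\<^sub>F n in sequentially. x \<in> space \<mu> - A n"
  proof (rule borel_cantelli_AE1)
    show "A n \<in> sets \<mu>" for n by (rule Am)
    show "emeasure \<mu> (A n) < \<infinity>" for n by (simp add: less_top emeasure_eq_measure)
    define \<theta> where "\<theta> = 2 powr ((s - c') / 2)"
    have \<theta>: "0 < \<theta>" "\<theta> < 1"
    proof -
      have "\<theta> < 2 powr 0" unfolding \<theta>_def using c' by (subst powr_less_cancel_iff) auto
      then show "0 < \<theta>" "\<theta> < 1" by (auto simp: \<theta>_def)
    qed
    show "summable (\<lambda>n. measure \<mu> (A n))"
    proof (rule summable_comparison_test_ev)
      show "summable (\<lambda>n. sqrt B * \<theta> ^ n)" using \<theta> by (intro summable_mult summable_geometric) auto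
      show "\<forall>\<^sub>F n in sequentially. norm (measure \<mu> (A n)) \<le> sqrt B * \<theta> ^ n"
        using cnt
      proof eventually_elim
        case (elim n)
        have "(measure \<mu> (A n))\<^sup>2 \<le> real (card (J n)) * (B * (1 / 2 ^ (n + q)) powr c')" by (rule meas)
        also have "\<dots> \<le> 2 powr (s * real n) * (B * (1 / 2 ^ n) powr c')"
          using elim B c' by (intro mult_mono mult_left_mono powr_mono2)
            (auto simp: J_def divide_simps intro!: power_increasing)
        also have "\<dots> = B * (2 powr (s * real n) * 2 powr (- (c' * real n)))"
        proof -
          have "1 / 2 ^ n = (2::real) powr (- real n)" by (simp add: powr_minus powr_realpow divide_inverse)
          then have "(1 / 2 ^ n) powr c' = 2 powr (- (c' * real n))"
            by (simp only: powr_powr mult_minus_left mult_minus_right mult.commute)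
          then show ?thesis by simp
        qed
        also have "2 powr (s * real n) * 2 powr (- (c' * real n)) = (\<theta> ^ n)\<^sup>2"
        proof -
          have "(\<theta> ^ n)\<^sup>2 = (\<theta> powr real n)\<^sup>2" using \<theta> by (simp add: powr_realpow)
          also have "\<dots> = 2 powr ((s - c') / 2 * real n + (s - c') / 2 * real n)"
            unfolding \<theta>_def powr_powr power2_eq_square powr_add ..
          also have "(s - c') / 2 * real n + (s - c') / 2 * real n = s * real n + - (c' * real n)"
            by (simp add: field_simps)
          finally show ?thesis by (simp only: powr_add)
        qed
        finally have "sqrt ((measure \<mu> (A n))\<^sup>2) \<le> sqrt (B * (\<theta> ^ n)\<^sup>2)" by (rule real_sqrt_le_mono)
        then show ?case using \<theta> B by (simp add: real_sqrt_mult)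
      qed
    qed
  qed
  moreover have "AE x in \<mu>. x \<in> K"
  proof (rule AE_I[of _ _ "- K"])
    have "closed K" using \<open>M_set (c / 2) K\<close> by (auto simp: M_set_def compact_imp_closed)
    then show "- K \<in> sets \<mu>" unfolding sets by auto
  qed (use out in auto)
  ultimately have "AE x in \<mu>. False"
  proof eventually_elim
    case (elim x)
    then have xr: "x \<in> rapid_points \<alpha> f" using K by auto
    then have x01: "x \<in> {0..1}" by (simp add: rapid_points_def)
    have "\<exists>\<^sub>F n in sequentially. x \<in> A n"
    proof (rule frequently_elim1[OF rapid_bad_cell[OF mod xr \<alpha> q ev]])
      fix n assume bad: "bad_cell a q n f (nat \<lfloor>x * 2 ^ (n + q)\<rfloor>)"
      let ?k = "nat \<lfloor>x * 2 ^ (n + q)\<rfloor>"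
      have r: "real ?k = of_int \<lfloor>x * 2 ^ (n + q)\<rfloor>" using x01 by simp
      have le: "real ?k \<le> x * 2 ^ (n + q)" "x * 2 ^ (n + q) < real ?k + 1" unfolding r by linarith+
      have "x * 2 ^ (n + q) \<le> 1 * 2 ^ (n + q)" using x01 by (intro mult_right_mono) auto
      then have "real ?k \<le> real (2 ^ (n + q))"
        using le(1) unfolding of_nat_power of_nat_numeral mult_1_left by (rule order_trans[rotated])
      then have "?k \<le> 2 ^ (n + q)" by (simp only: of_nat_le_iff)
      moreover have "x \<in> I n ?k" using le by (simp add: I_def divide_le_eq less_divide_eq)
      ultimately show "x \<in> A n" unfolding A_def J_def using bad by blast
    qed
    moreover have "\<forall>\<^sub>F n in sequentially. x \<notin> A n"
      using elim(1) by (rule eventually_mono) simp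
    ultimately show False by (simp add: frequently_def)
  qed
  then have "emeasure \<mu> (space \<mu>) = 0" by (simp add: AE_iff_null null_sets_def)
  then show False using nz space by simp
qed

text \<open>The quantifiers over the uncountably many K and c stand inside \<open>AE\<close> because
  the null set depends on s alone. In sqrt (1 - s) < a < \<alpha>' < \<alpha> the first gap controls
  the cell count, the second pays for rounding, and the third extracts actual increments from the
  limsup.\<close>

lemma (in brownian_motion_01) AE_not_M_set:
  assumes \<alpha>: "0 < \<alpha>" "\<alpha> < 1" and s: "1 - \<alpha>\<^sup>2 < s" "s < 1"
  shows "AE \<omega> in M. \<forall>K c. K \<subseteq> rapid_points \<alpha> (\<lambda>t. X t \<omega>) \<longrightarrow> s < c \<longrightarrow> \<not> M_set (c / 2) K"
proof -
  have "sqrt (1 - s) < \<alpha>" using s \<alpha> by (intro real_less_lsqrt) auto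
  then obtain a where a: "sqrt (1 - s) < a" "a < \<alpha>" using dense by blast
  obtain \<alpha>' where \<alpha>': "a < \<alpha>'" "\<alpha>' < \<alpha>" using dense a by blast
  have a0: "0 \<le> a" using a(1) s order_trans[OF real_sqrt_ge_zero[of "1 - s"]] by simp
  have "1 - s = (sqrt (1 - s))\<^sup>2" using s by simp
  also have "\<dots> < a\<^sup>2" using a(1) s by (intro power_strict_mono) auto
  finally have as: "1 - a\<^sup>2 < s" by simp
  have s0: "0 < s" using s \<alpha> abs_square_less_1[of \<alpha>] by linarith
  obtain q where q: "3 \<le> q" "\<forall>\<^sub>F n in sequentially. rapid_threshold a n + 88 * sqrt ((real n + real q) / 2 ^ q)
      \<le> \<alpha>' * sqrt (2 * (1 - 4 / 2 ^ q) * real n * ln 2)"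
    using scale_ratio_exists'[OF \<alpha>'(1)] by auto
  from AE_has_modulus AE_bad_cells_count[OF a0 as, of q] show ?thesis
  proof eventually_elim
    case (elim \<omega>)
    show ?case using rapid_not_M_set[OF elim(1) _ \<alpha>'(2) q elim(2) s0 s(2)] a0 \<alpha>' by auto
  qed
qed

theorem theorem1p2:
  fixes M :: "'a measure" and X :: "real \<Rightarrow> 'a \<Rightarrow> real" and \<alpha> :: real
  assumes "brownian_motion_01 M X"
    and "0 < \<alpha>" and "\<alpha> < 1"
  shows "(\<forall>\<gamma>::real. \<gamma> < 1 - \<alpha>\<^sup>2 \<longrightarrow>
           (AE \<omega> in M. \<exists>K \<mu>. compact K \<and> K \<subseteq> rapid_points \<alpha> (\<lambda>t. X t \<omega>) \<and>
              carries K \<mu> \<and> fourier_decay \<mu> (\<gamma> / 2))) \<and>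
         (AE \<omega> in M. fourier_dim (rapid_points \<alpha> (\<lambda>t. X t \<omega>)) = ereal (1 - \<alpha>\<^sup>2))"
proof
  interpret brownian_motion_01 M X by fact
  show lower: "\<forall>\<gamma>::real. \<gamma> < 1 - \<alpha>\<^sup>2 \<longrightarrow>
           (AE \<omega> in M. \<exists>K \<mu>. compact K \<and> K \<subseteq> rapid_points \<alpha> (\<lambda>t. X t \<omega>) \<and>
              carries K \<mu> \<and> fourier_decay \<mu> (\<gamma> / 2))"
    using AE_rapid_measure assms by blast
  \<comment> \<open>Exponents tending to 1 - \<alpha>^2 from below and, as \<open>s\<close>, from
    above; being countably many, they share one null set. All \<open>g j\<close> are positive, as
    \<open>M_set\<close> demands, and all \<open>s j\<close> are below 1, as
    \<open>AE_not_M_set\<close> demands.\<close>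
  define g where "g j = (1 - \<alpha>\<^sup>2) - (1 - \<alpha>\<^sup>2) / real (j + 2)" for j :: nat
  define s where "s j = (1 - \<alpha>\<^sup>2) + \<alpha>\<^sup>2 / real (j + 2)" for j :: nat
  have \<alpha>2: "0 < \<alpha>\<^sup>2" "\<alpha>\<^sup>2 < 1" using assms by (auto simp: abs_square_less_1)
  have g: "0 < g j" "g j < 1 - \<alpha>\<^sup>2" for j
  proof -
    have "(1 - \<alpha>\<^sup>2) / real (j + 2) < (1 - \<alpha>\<^sup>2) / 1" using \<alpha>2 by (intro divide_strict_left_mono) auto
    moreover have "0 < (1 - \<alpha>\<^sup>2) / real (j + 2)" using \<alpha>2 by simp
    ultimately show "0 < g j" "g j < 1 - \<alpha>\<^sup>2" by (simp_all add: g_def)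
  qed
  have s: "1 - \<alpha>\<^sup>2 < s j" "s j < 1" for j
  proof -
    have "\<alpha>\<^sup>2 / real (j + 2) < \<alpha>\<^sup>2 / 1" using \<alpha>2 by (intro divide_strict_left_mono) auto
    moreover have "0 < \<alpha>\<^sup>2 / real (j + 2)" using \<alpha>2 by simp
    ultimately show "1 - \<alpha>\<^sup>2 < s j" "s j < 1" by (simp_all add: s_def)
  qed
  have glim: "g \<longlonglongrightarrow> 1 - \<alpha>\<^sup>2" unfolding g_def by real_asymp
  have slim: "s \<longlonglongrightarrow> 1 - \<alpha>\<^sup>2" unfolding s_def by real_asymp
  have "AE \<omega> in M. \<forall>j. \<exists>K \<mu>. compact K \<and> K \<subseteq> rapid_points \<alpha> (\<lambda>t. X t \<omega>) \<and> carries K \<mu> \<and> fourier_decay \<mu> (g j / 2)"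
    unfolding AE_all_countable using lower g by blast
  moreover have "AE \<omega> in M. \<forall>j. \<forall>K c. K \<subseteq> rapid_points \<alpha> (\<lambda>t. X t \<omega>) \<longrightarrow> s j < c \<longrightarrow> \<not> M_set (c / 2) K"
    unfolding AE_all_countable using AE_not_M_set[OF assms(2,3)] s by blast
  ultimately show "AE \<omega> in M. fourier_dim (rapid_points \<alpha> (\<lambda>t. X t \<omega>)) = ereal (1 - \<alpha>\<^sup>2)"
  proof eventually_elim
    case (elim \<omega>)
    let ?E = "rapid_points \<alpha> (\<lambda>t. X t \<omega>)"
    have "fourier_dim ?E \<le> ereal (1 - \<alpha>\<^sup>2)"
      unfolding fourier_dim_def fourier_dim_compact_def
    proof (intro SUP_least Sup_least)
      fix K z assume K: "K \<in> {K. compact K \<and> K \<subseteq> ?E}" and z: "z \<in> insert 0 {ereal a |a. 0 < a \<and> M_set (a / 2) K}"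
      from z consider "z = 0" | c where "z = ereal c" "M_set (c / 2) K" by auto
      then show "z \<le> ereal (1 - \<alpha>\<^sup>2)"
      proof cases
        case 1
        then show ?thesis using \<alpha>2 by simp
      next
        case 2
        have "c \<le> 1 - \<alpha>\<^sup>2"
        proof (rule LIMSEQ_le_const[OF slim])
          have "c \<le> s n" for n
          proof (rule ccontr)
            assume "\<not> c \<le> s n"
            then have "s n < c" by simp
            then show False using elim(2)[rule_format, of K n c] K 2(2) by auto
          qed
          then show "\<exists>N. \<forall>n\<ge>N. c \<le> s n" by blast
        qed
        then show ?thesis using 2 by simp
      qed
    qed
    moreover have "ereal (1 - \<alpha>\<^sup>2) \<le> fourier_dim ?E"
    proof (rule LIMSEQ_le_const2)
      show "(\<lambda>j. ereal (g j)) \<longlonglongrightarrow> ereal (1 - \<alpha>\<^sup>2)" using glim by simp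
      have "ereal (g j) \<le> fourier_dim ?E" for j
      proof -
        obtain K \<mu> where K: "compact K" "K \<subseteq> ?E" "carries K \<mu>" "fourier_decay \<mu> (g j / 2)" using elim(1) by blast
        then have "M_set (g j / 2) K" using g[of j] by (auto simp: M_set_def)
        then have "ereal (g j) \<le> fourier_dim_compact K"
          unfolding fourier_dim_compact_def using g[of j] by (intro Sup_upper) auto
        also have "\<dots> \<le> fourier_dim ?E" unfolding fourier_dim_def using K by (intro SUP_upper) auto
        finally show ?thesis .
      qed
      then show "\<exists>N. \<forall>n\<ge>N. ereal (g n) \<le> fourier_dim ?E" by blast
    qed
    ultimately show ?case by (rule antisym)
  qed
qed

end
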